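(* Let $p_1,\ldots,p_r$ be distinct primes and let $\psi : P^{-1}\mathbb{Z}\to\mathbb{R}_{\ge 0}$ satisfy $\psi(\gamma)\le \frac{1}{2L(\gamma)}$ for all $\gamma$. Then the set $\mathcal{E}(\psi)$ of those $\mathbf{x}\in\mathbb{Z}_P$ such that $$d(\gamma\mathbf{x},\iota(\beta)) \le \psi(\gamma)$$ for infinitely many coprime $\beta,\gamma\in P^{-1}\mathbb{Z}$ has measure $0$ or $1$.
   Context: $P=\{\infty,p_1,\ldots,p_r\}$, $\mathbb{Q}_P = \mathbb{R}\times\mathbb{Q}_{p_1}\times\cdots\times\mathbb{Q}_{p_r}$, $P^{-1}\mathbb{Z} = \{ n p_1^{\nu_1}\cdots p_r^{\nu_r}: n,\nu_i\in\mathbb{Z}\}$; each element is written $\gamma = n p_1^{\nu_1}\cdots p_r^{\nu_r}$ with $n$ an integer coprime to each $p_i$, and $\beta = m p_1^{\mu_1}\cdots p_r^{\mu_r}$, $\gamma$ are coprime if $\gcd(m,n)=1$. Absolute values: usual at $\infty$, $|p|_p = p^{-1}$. $L(\gamma) = \max_{p\in P}\frac{|\gamma|_\infty|\gamma|_{p_1}\cdots|\gamma|_{p_r}}{|\gamma|_p}$. $\iota$ is the diagonal embedding $\mathbb{Q}\to\mathbb{Q}_P$; $d(\mathbf{x},\mathbf{y})=\max_{p\in P}|x_p-y_p|_p$. $\mathbb{Z}_P = [0,1)\times\mathbb{Z}_{p_1}\times\cdots\times\mathbb{Z}_{p_r}$. The measure is the product of Lebesgue measure on $\mathbb{R}$ and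 Haar measures on the $\mathbb{Q}_{p_i}$ normalised so that $\mathbb{Z}_{p_i}$ has measure $1$. *)

theory Defs
  imports "HOL-Analysis.Analysis" "HOL-Computational_Algebra.Primes"
begin

section \<open>The $p$-adic absolute value on the rationals\<close>

definition padic_abs :: "nat \<Rightarrow> rat \<Rightarrow> real" where
  "padic_abs p x =
     (if x = 0 then 0
      else real p powi (int (multiplicity (int p) (snd (quotient_of x)))
                      - int (multiplicity (int p) (fst (quotient_of x)))))"

lemma padic_abs_0 [simp]: "padic_abs p 0 = 0"
  by (simp add: padic_abs_def)

lemma padic_abs_nonneg [simp]: "0 \<le> padic_abs p x"
  by (simp add: padic_abs_def)

lemma padic_abs_Fract:
  fixes a b :: int
  assumes p: "prime p" and "a \<noteq> 0" "b \<noteq> 0"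
  shows "padic_abs p (of_int a / of_int b)
           = real p powi (int (multiplicity (int p) b) - int (multiplicity (int p) a))"
proof -
  obtain c d where cd: "quotient_of (of_int a / of_int b) = (c, d)"
    by (meson surj_pair)
  have d: "d > 0" using quotient_of_denom_pos[OF cd] .
  have eq: "(of_int a / of_int b :: rat) = of_int c / of_int d"
    using quotient_of_div[OF cd] .
  then have "(of_int (a * d) :: rat) = of_int (c * b)"
    using d assms by (simp add: field_simps)
  then have ad: "a * d = c * b" by (simp only: of_int_eq_iff)
  have c: "c \<noteq> 0" using ad assms d by auto
  have pe: "prime_elem (int p)" using p by auto
  have "multiplicity (int p) (a * d) = multiplicity (int p) (c * b)"
    using ad by simp
  then have "multiplicity (int p) a + multiplicity (int p) d
      = multiplicity (int p) c + multiplicity (int p) b"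
    using assms c d pe by (simp add: prime_elem_multiplicity_mult_distrib)
  then have "int (multiplicity (int p) d) - int (multiplicity (int p) c)
      = int (multiplicity (int p) b) - int (multiplicity (int p) a)"
    by linarith
  then show ?thesis
    using assms by (simp add: padic_abs_def cd)
qed

lemma padic_abs_eq_0_iff [simp]: "prime p \<Longrightarrow> padic_abs p x = 0 \<longleftrightarrow> x = 0"
  by (auto simp: padic_abs_def dest: prime_gt_0_nat)

lemma padic_abs_self:
  assumes "prime p" shows "padic_abs p (of_nat p) = 1 / real p"
proof -
  have "padic_abs p (of_int (int p) / of_int 1)
      = real p powi (int (multiplicity (int p) 1) - int (multiplicity (int p) (int p)))"
    using assms prime_gt_0_nat[OF assms] by (intro padic_abs_Fract) auto
  then show ?thesis
    using assms by (simp add: power_int_minus divide_inverse)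
qed

lemma padic_abs_mult:
  assumes p: "prime p"
  shows "padic_abs p (x * y) = padic_abs p x * padic_abs p y"
proof (cases "x = 0 \<or> y = 0")
  case False
  obtain a b where a: "x = of_int a / of_int b" "b \<noteq> 0"
    by (metis quotient_of_div quotient_of_denom_pos surj_pair less_irrefl)
  obtain c d where c: "y = of_int c / of_int d" "d \<noteq> 0"
    by (metis quotient_of_div quotient_of_denom_pos surj_pair less_irrefl)
  have nz: "a \<noteq> 0" "c \<noteq> 0" using False a c by auto
  have pe: "prime_elem (int p)" and p0: "real p \<noteq> 0"
    using p prime_gt_0_nat[OF p] by auto
  have "padic_abs p (x * y) = padic_abs p (of_int (a * c) / of_int (b * d))"
    using a c by simp
  also have "\<dots> = real p powi (int (multiplicity (int p) (b * d))
                               - int (multiplicity (int p) (a * c)))"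
    using nz a c by (intro padic_abs_Fract p) auto
  also have "\<dots> = real p powi ((int (multiplicity (int p) b) - int (multiplicity (int p) a))
                             + (int (multiplicity (int p) d) - int (multiplicity (int p) c)))"
    using nz a c pe by (simp add: prime_elem_multiplicity_mult_distrib algebra_simps)
  also have "\<dots> = padic_abs p x * padic_abs p y"
    using nz a c p p0 by (simp add: padic_abs_Fract power_int_add)
  finally show ?thesis .
qed auto

lemma padic_abs_uminus [simp]: "padic_abs p (- x) = padic_abs p x"
proof -
  have "quotient_of (- x) = (- fst (quotient_of x), snd (quotient_of x))"
    by (simp add: rat_uminus_code case_prod_unfold Let_def)
  moreover have "multiplicity (int p) (- fst (quotient_of x)) = multiplicity (int p) (fst (quotient_of x))"
    by (metis abs_minus_cancel multiplicity_normalize_right normalize_int_def)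
  ultimately show ?thesis by (simp add: padic_abs_def)
qed

lemma padic_abs_minus_commute: "padic_abs p (x - y) = padic_abs p (y - x)"
  by (metis minus_diff_eq padic_abs_uminus)

lemma padic_abs_ultrametric:
  assumes p: "prime p"
  shows "padic_abs p (x + y) \<le> max (padic_abs p x) (padic_abs p y)"
proof (cases "x = 0 \<or> y = 0 \<or> x + y = 0")
  case True
  then show ?thesis by (auto simp: max_def)
next
  case False
  obtain a b where a: "x = of_int a / of_int b" "b \<noteq> 0"
    by (metis quotient_of_div quotient_of_denom_pos surj_pair less_irrefl)
  obtain c d where c: "y = of_int c / of_int d" "d \<noteq> 0"
    by (metis quotient_of_div quotient_of_denom_pos surj_pair less_irrefl)
  define u v w where "u = a * d" and "v = c * b" and "w = b * d"
  have w: "w \<noteq> 0" and xy: "x = of_int u / of_int w" "y = of_int v / of_int w"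
    using a c by (auto simp: u_def v_def w_def)
  have xpy: "x + y = of_int (u + v) / of_int w"
    using xy by (simp add: add_divide_distrib)
  have nz: "u \<noteq> 0" "v \<noteq> 0" "u + v \<noteq> 0"
    using False xy xpy by auto
  define m where "m = min (multiplicity (int p) u) (multiplicity (int p) v)"
  have "int p ^ m dvd u + v"
    by (intro dvd_add multiplicity_dvd') (auto simp: m_def)
  then have m: "m \<le> multiplicity (int p) (u + v)"
    using nz p prime_gt_1_nat[OF p] by (intro multiplicity_geI) auto
  have p1: "1 \<le> real p" using prime_gt_0_nat[OF p] by linarith
  have "padic_abs p (x + y) \<le> real p powi (int (multiplicity (int p) w) - int m)"
    unfolding xpy padic_abs_Fract[OF p nz(3) w] using m p1 by (intro power_int_increasing) auto
  also have "\<dots> \<le> max (padic_abs p x) (padic_abs p y)"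
    using nz w p unfolding xy m_def by (auto simp: padic_abs_Fract min_def)
  finally show ?thesis .
qed

lemma padic_abs_triangle:
  assumes "prime p" shows "padic_abs p (x + y) \<le> padic_abs p x + padic_abs p y"
  using padic_abs_ultrametric[OF assms, of x y] padic_abs_nonneg[of p x] padic_abs_nonneg[of p y]
  by linarith

lemma padic_abs_triangle_sub:
  assumes "prime p" shows "\<bar>padic_abs p x - padic_abs p y\<bar> \<le> padic_abs p (x - y)"
  using padic_abs_triangle[OF assms, of "x - y" y] padic_abs_triangle[OF assms, of "y - x" x]
        padic_abs_minus_commute[of p x y] by simp

section \<open>The $p$-adic numbers\<close>

text \<open>
  The field of $p$-adic numbers is the completion of the rationals with respect to
  \<^const>\<open>padic_abs\<close>: its elements are the classes of Cauchy sequences modulo null sequences.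
  Since \<open>p\<close> is a value, it is a carrier set depending on \<open>p\<close> rather than a type.
\<close>

definition padic_Cauchy :: "nat \<Rightarrow> (nat \<Rightarrow> rat) set" where
  "padic_Cauchy p = {X. \<forall>e>0. \<exists>N. \<forall>m\<ge>N. \<forall>n\<ge>N. padic_abs p (X m - X n) < e}"

definition padic_rel :: "nat \<Rightarrow> ((nat \<Rightarrow> rat) \<times> (nat \<Rightarrow> rat)) set" where
  "padic_rel p = {(X, Y). X \<in> padic_Cauchy p \<and> Y \<in> padic_Cauchy p \<and>
                          (\<lambda>n. padic_abs p (X n - Y n)) \<longlonglongrightarrow> 0}"

type_synonym padic = "(nat \<Rightarrow> rat) set"

definition Qp :: "nat \<Rightarrow> padic set" where
  "Qp p = padic_Cauchy p // padic_rel p"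

definition padic_of_rat :: "nat \<Rightarrow> rat \<Rightarrow> padic" where
  "padic_of_rat p q = padic_rel p `` {\<lambda>_. q}"

definition padic_add :: "nat \<Rightarrow> padic \<Rightarrow> padic \<Rightarrow> padic" where
  "padic_add p x y = (\<Union>X\<in>x. \<Union>Y\<in>y. padic_rel p `` {\<lambda>n. X n + Y n})"

definition padic_diff :: "nat \<Rightarrow> padic \<Rightarrow> padic \<Rightarrow> padic" where
  "padic_diff p x y = (\<Union>X\<in>x. \<Union>Y\<in>y. padic_rel p `` {\<lambda>n. X n - Y n})"

definition padic_mult :: "nat \<Rightarrow> padic \<Rightarrow> padic \<Rightarrow> padic" where
  "padic_mult p x y = (\<Union>X\<in>x. \<Union>Y\<in>y. padic_rel p `` {\<lambda>n. X n * Y n})"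

definition padic_norm :: "nat \<Rightarrow> padic \<Rightarrow> real" where
  "padic_norm p x = (THE a. \<forall>X\<in>x. (\<lambda>n. padic_abs p (X n)) \<longlonglongrightarrow> a)"

definition Zp :: "nat \<Rightarrow> padic set" where
  "Zp p = {x \<in> Qp p. padic_norm p x \<le> 1}"

text \<open>
  The value outside the carrier only serves the locale \<^locale>\<open>Metric_space\<close>, which wants
  non-negativity and symmetry on the whole type.
\<close>

definition padic_dist :: "nat \<Rightarrow> padic \<Rightarrow> padic \<Rightarrow> real" where
  "padic_dist p x y = (if x \<in> Qp p \<and> y \<in> Qp p then padic_norm p (padic_diff p x y) else 0)"

definition padic_topology :: "nat \<Rightarrow> padic topology" where
  "padic_topology p = Metric_space.mtopology (Qp p) (padic_dist p)"

subsection \<open>The operations are well defined\<close>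

lemma padic_CauchyE:
  assumes "X \<in> padic_Cauchy p" "0 < e"
  obtains N where "\<And>m n. m \<ge> N \<Longrightarrow> n \<ge> N \<Longrightarrow> padic_abs p (X m - X n) < e"
  using assms unfolding padic_Cauchy_def by blast

lemma padic_Cauchy_const [simp]: "(\<lambda>_. q) \<in> padic_Cauchy p"
  by (simp add: padic_Cauchy_def)

lemma padic_Cauchy_bounded:
  assumes p: "prime p" and X: "X \<in> padic_Cauchy p"
  obtains B where "B > 0" "\<And>n. padic_abs p (X n) \<le> B"
proof -
  obtain N where N: "\<And>m n. m \<ge> N \<Longrightarrow> n \<ge> N \<Longrightarrow> padic_abs p (X m - X n) < 1"
    using padic_CauchyE[OF X zero_less_one] by blast
  define B where "B = 1 + (\<Sum>k\<le>N. padic_abs p (X k))"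
  have B: "padic_abs p (X k) \<le> B - 1" if "k \<le> N" for k
    unfolding B_def using that member_le_sum[of k "{..N}" "\<lambda>k. padic_abs p (X k)"] by simp
  have "padic_abs p (X n) \<le> B" for n
  proof (cases "n \<le> N")
    case False
    then show ?thesis
      using N[of n N] B[of N] padic_abs_triangle[OF p, of "X n - X N" "X N"] by simp
  qed (use B[of n] in simp)
  moreover have "B > 0" using B[of N] padic_abs_nonneg[of p "X N"] by linarith
  ultimately show ?thesis using that by blast
qed

lemma padic_Cauchy_add:
  assumes p: "prime p" and X: "X \<in> padic_Cauchy p" and Y: "Y \<in> padic_Cauchy p"
  shows "(\<lambda>n. X n + Y n) \<in> padic_Cauchy p"
  unfolding padic_Cauchy_def
proof (clarify)
  fix e :: real assume e: "e > 0"
  obtain M where M: "\<And>m n. m \<ge> M \<Longrightarrow> n \<ge> M \<Longrightarrow> padic_abs p (X m - X n) < e / 2"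
    using padic_CauchyE[OF X half_gt_zero[OF e]] by blast
  obtain N where N: "\<And>m n. m \<ge> N \<Longrightarrow> n \<ge> N \<Longrightarrow> padic_abs p (Y m - Y n) < e / 2"
    using padic_CauchyE[OF Y half_gt_zero[OF e]] by blast
  have "padic_abs p (X m + Y m - (X n + Y n)) < e" if "m \<ge> max M N" "n \<ge> max M N" for m n
    using M[of m n] N[of m n] that padic_abs_triangle[OF p, of "X m - X n" "Y m - Y n"]
    by (simp add: algebra_simps)
  then show "\<exists>N. \<forall>m\<ge>N. \<forall>n\<ge>N. padic_abs p (X m + Y m - (X n + Y n)) < e" by blast
qed

lemma padic_Cauchy_uminus: "X \<in> padic_Cauchy p \<Longrightarrow> (\<lambda>n. - X n) \<in> padic_Cauchy p"
  by (simp add: padic_Cauchy_def padic_abs_minus_commute)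

lemma padic_Cauchy_diff:
  assumes "prime p" "X \<in> padic_Cauchy p" "Y \<in> padic_Cauchy p"
  shows "(\<lambda>n. X n - Y n) \<in> padic_Cauchy p"
  using padic_Cauchy_add[OF assms(1,2) padic_Cauchy_uminus[OF assms(3)]] by simp

lemma padic_Cauchy_mult:
  assumes p: "prime p" and X: "X \<in> padic_Cauchy p" and Y: "Y \<in> padic_Cauchy p"
  shows "(\<lambda>n. X n * Y n) \<in> padic_Cauchy p"
  unfolding padic_Cauchy_def
proof (clarify)
  fix e :: real assume e: "e > 0"
  obtain A where A: "A > 0" "\<And>n. padic_abs p (X n) \<le> A"
    using padic_Cauchy_bounded[OF p X] by blast
  obtain B where B: "B > 0" "\<And>n. padic_abs p (Y n) \<le> B"
    using padic_Cauchy_bounded[OF p Y] by blast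
  obtain M where M: "\<And>m n. m \<ge> M \<Longrightarrow> n \<ge> M \<Longrightarrow> padic_abs p (X m - X n) < e / (2 * B)"
    by (rule padic_CauchyE[OF X, of "e / (2 * B)"]) (use e B in auto)
  obtain N where N: "\<And>m n. m \<ge> N \<Longrightarrow> n \<ge> N \<Longrightarrow> padic_abs p (Y m - Y n) < e / (2 * A)"
    by (rule padic_CauchyE[OF Y, of "e / (2 * A)"]) (use e A in auto)
  have "padic_abs p (X m * Y m - X n * Y n) < e" if "m \<ge> max M N" "n \<ge> max M N" for m n
  proof -
    have "padic_abs p (X m * Y m - X n * Y n)
        = padic_abs p (X m * (Y m - Y n) + (X m - X n) * Y n)"
      by (simp add: algebra_simps)
    also have "\<dots> \<le> padic_abs p (X m) * padic_abs p (Y m - Y n)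
                    + padic_abs p (X m - X n) * padic_abs p (Y n)"
      using padic_abs_triangle[OF p] by (simp flip: padic_abs_mult[OF p])
    also have "\<dots> \<le> A * padic_abs p (Y m - Y n) + padic_abs p (X m - X n) * B"
      using A B by (intro add_mono mult_mono) auto
    also have "\<dots> < A * (e / (2 * A)) + e / (2 * B) * B"
      using A B M[of m n] N[of m n] that
      by (intro add_strict_mono mult_strict_left_mono mult_strict_right_mono) auto
    finally show ?thesis using A B by simp
  qed
  then show "\<exists>N. \<forall>m\<ge>N. \<forall>n\<ge>N. padic_abs p (X m * Y m - X n * Y n) < e" by blast
qed

lemma tendsto_0_padic_add:
  assumes p: "prime p" and "(\<lambda>n. padic_abs p (X n)) \<longlonglongrightarrow> 0" "(\<lambda>n. padic_abs p (Y n)) \<longlonglongrightarrow> 0"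
  shows "(\<lambda>n. padic_abs p (X n + Y n)) \<longlonglongrightarrow> 0"
proof (rule tendsto_sandwich[of "\<lambda>_. 0"])
  show "(\<lambda>n. padic_abs p (X n) + padic_abs p (Y n)) \<longlonglongrightarrow> 0"
    using tendsto_add[OF assms(2,3)] by simp
qed (use padic_abs_triangle[OF p] in \<open>auto intro: always_eventually\<close>)

lemma equiv_padic_rel:
  assumes p: "prime p" shows "equiv (padic_Cauchy p) (padic_rel p)"
proof (rule equivI)
  show "padic_rel p \<subseteq> padic_Cauchy p \<times> padic_Cauchy p"
    by (auto simp: padic_rel_def)
  show "refl_on (padic_Cauchy p) (padic_rel p)"
    by (auto simp: refl_on_def padic_rel_def)
  show "sym (padic_rel p)"
    by (auto simp: sym_def padic_rel_def padic_abs_minus_commute)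
  show "trans (padic_rel p)"
  proof (rule transI)
    fix X Y Z assume "(X, Y) \<in> padic_rel p" "(Y, Z) \<in> padic_rel p"
    then show "(X, Z) \<in> padic_rel p"
      using tendsto_0_padic_add[OF p, of "\<lambda>n. X n - Y n" "\<lambda>n. Y n - Z n"]
      by (auto simp: padic_rel_def)
  qed
qed

lemma padic_class_in_Qp: "X \<in> padic_Cauchy p \<Longrightarrow> padic_rel p `` {X} \<in> Qp p"
  by (simp add: Qp_def quotientI)

lemma Qp_cases:
  assumes "x \<in> Qp p"
  obtains X where "X \<in> padic_Cauchy p" "x = padic_rel p `` {X}"
  using assms unfolding Qp_def by (auto elim: quotientE)

lemma padic_rel_add:
  assumes p: "prime p" and "(X, X') \<in> padic_rel p" "(Y, Y') \<in> padic_rel p"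
  shows "(\<lambda>n. X n + Y n, \<lambda>n. X' n + Y' n) \<in> padic_rel p"
  using assms padic_Cauchy_add[OF p]
    tendsto_0_padic_add[OF p, of "\<lambda>n. X n - X' n" "\<lambda>n. Y n - Y' n"]
  by (auto simp: padic_rel_def algebra_simps)

lemma padic_rel_uminus:
  "(X, X') \<in> padic_rel p \<Longrightarrow> (\<lambda>n. - X n, \<lambda>n. - X' n) \<in> padic_rel p"
  using padic_Cauchy_uminus[of X p] padic_Cauchy_uminus[of X' p]
  by (auto simp: padic_rel_def padic_abs_minus_commute)

lemma padic_rel_diff:
  assumes "prime p" "(X, X') \<in> padic_rel p" "(Y, Y') \<in> padic_rel p"
  shows "(\<lambda>n. X n - Y n, \<lambda>n. X' n - Y' n) \<in> padic_rel p"
  using padic_rel_add[OF assms(1,2) padic_rel_uminus[OF assms(3)]] by simp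

lemma tendsto_0_padic_mult:
  assumes p: "prime p" and X: "X \<in> padic_Cauchy p" and "(\<lambda>n. padic_abs p (Y n)) \<longlonglongrightarrow> 0"
  shows "(\<lambda>n. padic_abs p (X n * Y n)) \<longlonglongrightarrow> 0"
proof -
  obtain A where A: "A > 0" "\<And>n. padic_abs p (X n) \<le> A"
    using padic_Cauchy_bounded[OF p X] by blast
  show ?thesis
  proof (rule tendsto_sandwich[of "\<lambda>_. 0"])
    show "(\<lambda>n. A * padic_abs p (Y n)) \<longlonglongrightarrow> 0"
      using tendsto_mult_left[OF assms(3), of A] by simp
  qed (use A in \<open>auto simp: padic_abs_mult[OF p] intro!: always_eventually mult_right_mono\<close>)
qed

lemma padic_rel_mult:
  assumes p: "prime p" and X: "(X, X') \<in> padic_rel p" and Y: "(Y, Y') \<in> padic_rel p"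
  shows "(\<lambda>n. X n * Y n, \<lambda>n. X' n * Y' n) \<in> padic_rel p"
proof -
  have "(\<lambda>n. padic_abs p (X n * (Y n - Y' n) + Y' n * (X n - X' n))) \<longlonglongrightarrow> 0"
    using X Y by (intro tendsto_0_padic_add tendsto_0_padic_mult p) (auto simp: padic_rel_def)
  then show ?thesis
    using X Y padic_Cauchy_mult[OF p] by (auto simp: padic_rel_def algebra_simps)
qed

lemma padic_add_class:
  assumes p: "prime p" and "X \<in> padic_Cauchy p" "Y \<in> padic_Cauchy p"
  shows "padic_add p (padic_rel p `` {X}) (padic_rel p `` {Y}) = padic_rel p `` {\<lambda>n. X n + Y n}"
  unfolding padic_add_def
  by (rule UN_equiv_class2[OF equiv_padic_rel[OF p] equiv_padic_rel[OF p] _ assms(2,3)],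
      rule congruent2I', rule equiv_class_eq[OF equiv_padic_rel[OF p]], rule padic_rel_add[OF p])

lemma padic_diff_class:
  assumes p: "prime p" and "X \<in> padic_Cauchy p" "Y \<in> padic_Cauchy p"
  shows "padic_diff p (padic_rel p `` {X}) (padic_rel p `` {Y}) = padic_rel p `` {\<lambda>n. X n - Y n}"
  unfolding padic_diff_def
  by (rule UN_equiv_class2[OF equiv_padic_rel[OF p] equiv_padic_rel[OF p] _ assms(2,3)],
      rule congruent2I', rule equiv_class_eq[OF equiv_padic_rel[OF p]], rule padic_rel_diff[OF p])

lemma padic_mult_class:
  assumes p: "prime p" and "X \<in> padic_Cauchy p" "Y \<in> padic_Cauchy p"
  shows "padic_mult p (padic_rel p `` {X}) (padic_rel p `` {Y}) = padic_rel p `` {\<lambda>n. X n * Y n}"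
  unfolding padic_mult_def
  by (rule UN_equiv_class2[OF equiv_padic_rel[OF p] equiv_padic_rel[OF p] _ assms(2,3)],
      rule congruent2I', rule equiv_class_eq[OF equiv_padic_rel[OF p]], rule padic_rel_mult[OF p])

lemma padic_abs_Cauchy_convergent:
  assumes p: "prime p" and X: "X \<in> padic_Cauchy p"
  shows "convergent (\<lambda>n. padic_abs p (X n))"
proof -
  have "Cauchy (\<lambda>n. padic_abs p (X n))"
  proof (rule metric_CauchyI)
    fix e :: real assume "e > 0"
    then obtain N where "\<And>m n. m \<ge> N \<Longrightarrow> n \<ge> N \<Longrightarrow> padic_abs p (X m - X n) < e"
      using padic_CauchyE[OF X] by blast
    then show "\<exists>N. \<forall>m\<ge>N. \<forall>n\<ge>N. dist (padic_abs p (X m)) (padic_abs p (X n)) < e"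
      unfolding dist_real_def using padic_abs_triangle_sub[OF p] by (meson le_less_trans)
  qed
  then show ?thesis by (simp add: Cauchy_convergent_iff)
qed

lemma padic_norm_class:
  assumes p: "prime p" and X: "X \<in> padic_Cauchy p"
  shows "(\<lambda>n. padic_abs p (X n)) \<longlonglongrightarrow> padic_norm p (padic_rel p `` {X})"
proof -
  obtain a where a: "(\<lambda>n. padic_abs p (X n)) \<longlonglongrightarrow> a"
    using padic_abs_Cauchy_convergent[OF p X] by (auto simp: convergent_def)
  have all: "(\<lambda>n. padic_abs p (Y n)) \<longlonglongrightarrow> a" if "Y \<in> padic_rel p `` {X}" for Y
  proof -
    have "(\<lambda>n. padic_abs p (X n - Y n)) \<longlonglongrightarrow> 0"
      using that by (auto simp: padic_rel_def)
    then have "(\<lambda>n. padic_abs p (Y n) - padic_abs p (X n)) \<longlonglongrightarrow> 0"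
    proof (rule Lim_null_comparison[rotated])
      show "\<forall>\<^sub>F n in sequentially. norm (padic_abs p (Y n) - padic_abs p (X n)) \<le> padic_abs p (X n - Y n)"
        using padic_abs_triangle_sub[OF p] padic_abs_minus_commute[of p]
        by (intro always_eventually allI) (metis real_norm_def)
    qed
    from tendsto_add[OF this a] show ?thesis by simp
  qed
  have self: "X \<in> padic_rel p `` {X}"
    using equiv_class_self[OF equiv_padic_rel[OF p] X] .
  have "padic_norm p (padic_rel p `` {X}) = a"
    unfolding padic_norm_def
  proof (rule the_equality)
    fix b assume "\<forall>Y\<in>padic_rel p `` {X}. (\<lambda>n. padic_abs p (Y n)) \<longlonglongrightarrow> b"
    then show "b = a" using self a LIMSEQ_unique by blast
  qed (use all in blast)
  then show ?thesis using a by simp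
qed

lemma padic_norm_of_rat:
  assumes "prime p" shows "padic_norm p (padic_of_rat p q) = padic_abs p q"
  using LIMSEQ_unique[OF padic_norm_class[OF assms padic_Cauchy_const, of q]] 
  unfolding padic_of_rat_def by (metis tendsto_const)

lemma Metric_space_padic:
  assumes p: "prime p" shows "Metric_space (Qp p) (padic_dist p)"
proof -
  have dist: "(\<lambda>n. padic_abs p (X n - Y n)) \<longlonglongrightarrow> padic_dist p (padic_rel p `` {X}) (padic_rel p `` {Y})"
    if "X \<in> padic_Cauchy p" "Y \<in> padic_Cauchy p" for X Y
    using padic_norm_class[OF p padic_Cauchy_diff[OF p that]] that
    by (simp add: padic_dist_def padic_diff_class[OF p] padic_class_in_Qp)
  show ?thesis
  proof
    fix x y
    show "0 \<le> padic_dist p x y"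
    proof (cases "x \<in> Qp p \<and> y \<in> Qp p")
      case True
      then obtain X Y where XY: "X \<in> padic_Cauchy p" "x = padic_rel p `` {X}"
        "Y \<in> padic_Cauchy p" "y = padic_rel p `` {Y}" by (meson Qp_cases)
      show ?thesis
        unfolding XY(2,4) by (rule LIMSEQ_le_const[OF dist[OF XY(1,3)]]) simp
    qed (auto simp: padic_dist_def)
    show "padic_dist p x y = padic_dist p y x"
    proof (cases "x \<in> Qp p \<and> y \<in> Qp p")
      case True
      then obtain X Y where XY: "X \<in> padic_Cauchy p" "x = padic_rel p `` {X}"
        "Y \<in> padic_Cauchy p" "y = padic_rel p `` {Y}" by (meson Qp_cases)
      then show ?thesis
        using dist[of X Y] dist[of Y X] LIMSEQ_unique
        by (simp add: padic_abs_minus_commute[of p "X _"])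
    qed (auto simp: padic_dist_def)
  next
    fix x y assume "x \<in> Qp p" "y \<in> Qp p"
    then obtain X Y where XY: "X \<in> padic_Cauchy p" "x = padic_rel p `` {X}"
      "Y \<in> padic_Cauchy p" "y = padic_rel p `` {Y}" by (meson Qp_cases)
    have "padic_dist p x y = 0 \<longleftrightarrow> (\<lambda>n. padic_abs p (X n - Y n)) \<longlonglongrightarrow> 0"
      using dist[of X Y] XY LIMSEQ_unique by auto
    also have "\<dots> \<longleftrightarrow> (X, Y) \<in> padic_rel p" using XY by (simp add: padic_rel_def)
    also have "\<dots> \<longleftrightarrow> x = y"
      using XY eq_equiv_class_iff[OF equiv_padic_rel[OF p], of X Y] by simp
    finally show "padic_dist p x y = 0 \<longleftrightarrow> x = y" .
  next
    fix x y z assume "x \<in> Qp p" "y \<in> Qp p" "z \<in> Qp p"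
    then obtain X Y Z where XYZ: "X \<in> padic_Cauchy p" "x = padic_rel p `` {X}"
      "Y \<in> padic_Cauchy p" "y = padic_rel p `` {Y}"
      "Z \<in> padic_Cauchy p" "z = padic_rel p `` {Z}" by (meson Qp_cases)
    have "padic_abs p (X n - Z n) \<le> padic_abs p (X n - Y n) + padic_abs p (Y n - Z n)" for n
      using padic_abs_triangle[OF p, of "X n - Y n" "Y n - Z n"] by simp
    then show "padic_dist p x z \<le> padic_dist p x y + padic_dist p y z"
      using XYZ LIMSEQ_le[OF dist[of X Z] tendsto_add[OF dist[of X Y] dist[of Y Z]]] by auto
  qed
qed

subsection \<open>Normalised Haar measure\<close>

text \<open>
  A translation-invariant Borel measure giving the compact open subgroup \<^term>\<open>Zp p\<close> measure 1
  is finite on compact sets, and regular because \<^term>\<open>Qp p\<close> is second countable and locally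
  compact. For prime \<open>p\<close>, by existence and uniqueness of Haar measure, exactly one measure satisfies
  the predicate.
\<close>

definition normalised_Haar :: "nat \<Rightarrow> padic measure \<Rightarrow> bool" where
  "normalised_Haar p \<mu> \<longleftrightarrow>
     sets \<mu> = sets (sigma (Qp p) {U. openin (padic_topology p) U}) \<and>
     (\<forall>a\<in>Qp p. \<forall>A\<in>sets \<mu>. emeasure \<mu> (padic_add p a ` A) = emeasure \<mu> A) \<and>
     emeasure \<mu> (Zp p) = 1"

section \<open>The ring $P^{-1}\mathbb{Z}$ and the space $\mathbb{Q}_P$\<close>

text \<open>
  \<open>S\<close> is the set of finite places $\{p_1, \ldots, p_r\}$ of $P$. A point of $\mathbb{Q}_P$ is a
  pair of its real coordinate and the extensional family of its $p$-adic coordinates, \<open>p \<in> S\<close>.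
\<close>

type_synonym QP = "real \<times> (nat \<Rightarrow> padic)"

definition S_prod :: "nat set \<Rightarrow> (nat \<Rightarrow> int) \<Rightarrow> rat" where
  "S_prod S \<nu> = (\<Prod>p\<in>S. of_nat p powi \<nu> p)"

definition PinvZ :: "nat set \<Rightarrow> rat set" where
  "PinvZ S = {of_int n * S_prod S \<nu> | n \<nu>. True}"

definition coprime_P :: "nat set \<Rightarrow> rat \<Rightarrow> rat \<Rightarrow> bool" where
  "coprime_P S \<beta> \<gamma> \<longleftrightarrow>
     (\<exists>m n \<mu> \<nu>. \<beta> = of_int m * S_prod S \<mu> \<and> \<gamma> = of_int n * S_prod S \<nu> \<and>
        (\<forall>p\<in>S. coprime m (int p) \<and> coprime n (int p)) \<and> gcd m n = 1)"

definition abs_prod :: "nat set \<Rightarrow> rat \<Rightarrow> real" where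
  "abs_prod S \<gamma> = \<bar>real_of_rat \<gamma>\<bar> * (\<Prod>p\<in>S. padic_abs p \<gamma>)"

definition L_P :: "nat set \<Rightarrow> rat \<Rightarrow> real" where
  "L_P S \<gamma> = Max (insert (abs_prod S \<gamma> / \<bar>real_of_rat \<gamma>\<bar>)
                       ((\<lambda>p. abs_prod S \<gamma> / padic_abs p \<gamma>) ` S))"

definition diag :: "nat set \<Rightarrow> rat \<Rightarrow> QP" where
  "diag S q = (real_of_rat q, \<lambda>p\<in>S. padic_of_rat p q)"

definition scale_P :: "nat set \<Rightarrow> rat \<Rightarrow> QP \<Rightarrow> QP" where
  "scale_P S \<gamma> x = (real_of_rat \<gamma> * fst x, \<lambda>p\<in>S. padic_mult p (padic_of_rat p \<gamma>) (snd x p))"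

definition dist_P :: "nat set \<Rightarrow> QP \<Rightarrow> QP \<Rightarrow> real" where
  "dist_P S x y = Max (insert \<bar>fst x - fst y\<bar> ((\<lambda>p. padic_dist p (snd x p) (snd y p)) ` S))"

definition Z_P :: "nat set \<Rightarrow> QP set" where
  "Z_P S = {0..<1} \<times> (\<Pi>\<^sub>E p\<in>S. Zp p)"

definition measure_P :: "nat set \<Rightarrow> (nat \<Rightarrow> padic measure) \<Rightarrow> QP measure" where
  "measure_P S \<mu> = lborel \<Otimes>\<^sub>M (\<Pi>\<^sub>M p\<in>S. \<mu> p)"

definition \<E> :: "nat set \<Rightarrow> (rat \<Rightarrow> real) \<Rightarrow> QP set" where
  "\<E> S \<psi> = {x \<in> Z_P S. infinite {(\<beta>, \<gamma>). \<beta> \<in> PinvZ S \<and> \<gamma> \<in> PinvZ S \<and> coprime_P S \<beta> \<gamma> \<and>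
                                          dist_P S (scale_P S \<gamma> x) (diag S \<beta>) \<le> \<psi> \<gamma>}}"

end

theory Submission
  imports Defs "HOL-Number_Theory.Number_Theory"
begin

text \<open>
  The argument is Gallagher's. Because every radius is below \<open>1\<close>, a solution \<open>(\<beta>, \<gamma>)\<close> for a point
  of $\mathbb{Z}_P$ amounts to an integer \<open>b = \<beta> N / \<gamma>\<close> coprime to the integral part \<open>N\<close> of \<open>\<gamma>\<close>, with
  $|x_\infty - b/N|$ small and \<open>N x \<equiv> b\<close> modulo a prescribed subgroup of the integers; so only the
  residues of the finite coordinates modulo powers of \<open>W = p\<^sub>1 \<cdots> p\<^sub>r\<close> matter, and the problem lives on the
  product of the line with the coherent residue sequences, periodic under the diagonal integers.

  For a prime \<open>l\<close> not dividing \<open>W\<close>, split the denominators according to whether \<open>l\<close> does not divide \<open>N\<close>,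
  divides it exactly once, or \<open>l\<^sup>2\<close> divides \<open>N\<close>. In the first two cases the maps
  $x \mapsto l^k x$ and $x \mapsto l^k x + 1/l$ send solutions to solutions with the real radius enlarged by
  $l^k$ (the finite radii do not change, as \<open>l\<close> is a unit there); by Cassels' lemma, needed only in the real
  direction, enlarging the radius changes the limsup set by a null set, which is therefore almost everywhere
  invariant under translation by $l^{-k}$ for every \<open>k\<close>. In the third case the limsup set is
  invariant under translation by \<open>1 / l\<close>. A set almost invariant under translation by \<open>1 / M\<close> for arbitrarily
  large \<open>M\<close> prime to \<open>W\<close> is independent of every box, because the points \<open>j / M\<close> equidistribute, hence is null
  or conull. So either one of the first two cases already gives a conull set, or for every \<open>l\<close> only the
  third matters.
\<close>

section \<open>Coherent sequences of residues\<close>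

text \<open>The real factor is the whole line rather than the circle because multiplication by
  \<open>M\<close>, a unit at the finite places, is then injective and scales volume by exactly
  \<open>M\<close>. A periodic set mapped into itself by such a map lies in a preimage of equal
  density; the two agree almost everywhere, and the preimage is exactly invariant under steps
  \<open>1 / M\<close>. This takes the place of ergodicity of the dilations. The obstacle is that
  real radii need not tend to 0. By the product formula \<open>N\<close> is the product of all
  absolute values of \<gamma>, and the hypothesis on \<psi> bounds every radius by
  \<open>1 / (2 * N)\<close>. But one \<open>N\<close> can belong to infinitely many \<gamma>,
  differing by powers of the primes, and a long real interval can go with tiny finite radii. If
  infinitely many of these, with real radii bounded below, hit a point with the same
  \<open>b\<close>, then \<open>N * y_p = b\<close> at some place, so the point lies in a null set.
  Hence Cassels' lemma is applied on fibres, off \<open>exceptional\<close>. The bound on the finite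
  radii has a second use: it makes \<open>b\<close> an integer.\<close>

text \<open>
  The \<open>W\<close>-adic integers, as coherent sequences of residues modulo the powers of \<open>W\<close>. They replace
  the product of the rings of \<open>p\<close>-adic integers, and \<open>W = 1\<close> (no finite places) is allowed.
\<close>

definition residue_seqs :: "int \<Rightarrow> (nat \<Rightarrow> int) set" where
  "residue_seqs W = {\<omega>. \<forall>k. 0 \<le> \<omega> k \<and> \<omega> k < W ^ k \<and> \<omega> (Suc k) mod W ^ k = \<omega> k}"

definition cylinder :: "int \<Rightarrow> nat \<Rightarrow> int \<Rightarrow> (nat \<Rightarrow> int) set" where
  "cylinder W k c = {\<omega> \<in> residue_seqs W. \<omega> k = c}"

definition cylinders :: "int \<Rightarrow> (nat \<Rightarrow> int) set set" where
  "cylinders W = insert {} (range (\<lambda>(k, c). cylinder W k c))"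

definition affine_seq :: "int \<Rightarrow> int \<Rightarrow> (nat \<Rightarrow> int) \<Rightarrow> (nat \<Rightarrow> int) \<Rightarrow> nat \<Rightarrow> int" where
  "affine_seq W M \<sigma> \<omega> = (\<lambda>k. (M * \<omega> k + \<sigma> k) mod W ^ k)"

text \<open>Arbitrary integer representatives of a \<open>W\<close>-adic integer. Unlike members of
  \<open>residue_seqs\<close> they need not be reduced, so multiples such as \<open>j * u k\<close>
  serve as translations directly.\<close>

definition coherent :: "int \<Rightarrow> (nat \<Rightarrow> int) \<Rightarrow> bool" where
  "coherent W \<sigma> \<longleftrightarrow> (\<forall>k. [\<sigma> (Suc k) = \<sigma> k] (mod W ^ k))"

lemma residue_seqs_mod:
  assumes "\<omega> \<in> residue_seqs W" "j \<le> k"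
  shows "\<omega> k mod W ^ j = \<omega> j"
  using assms(2)
proof (induction k rule: dec_induct)
  case base
  then show ?case using assms(1) by (simp add: residue_seqs_def)
next
  case (step n)
  have "\<omega> (Suc n) mod W ^ j = \<omega> (Suc n) mod W ^ n mod W ^ j"
    using step by (simp add: le_imp_power_dvd mod_mod_cancel)
  then show ?case using step assms(1) by (simp add: residue_seqs_def)
qed

lemma residue_seqs_mod_self: "\<omega> \<in> residue_seqs W \<Longrightarrow> \<omega> k mod W ^ k = \<omega> k"
  by (rule residue_seqs_mod) auto

lemma cylinder_subset: "cylinder W k c \<subseteq> residue_seqs W"
  by (auto simp: cylinder_def)

lemma cylinder_empty: "\<not> (0 \<le> c \<and> c < W ^ k) \<Longrightarrow> cylinder W k c = {}"
  by (auto simp: cylinder_def residue_seqs_def)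

text \<open>Two cylinders are nested or disjoint, since the finer residue determines the coarser
  one.\<close>

lemma Int_stable_cylinders: "Int_stable (cylinders W)"
proof -
  have le: "cylinder W j d \<inter> cylinder W k c \<in> cylinders W" if "j \<le> k" for j k c d
  proof -
    have "cylinder W j d \<inter> cylinder W k c = (if c mod W ^ j = d then cylinder W k c else {})"
      using residue_seqs_mod[OF _ that] by (auto simp: cylinder_def)
    then show ?thesis by (auto simp: cylinders_def)
  qed
  have "cylinder W j d \<inter> cylinder W k c \<in> cylinders W" for j k c d
    using le[of j k d c] le[of k j c d] by (cases "j \<le> k") (auto simp: Int_commute)
  then show ?thesis by (auto simp: Int_stable_def cylinders_def)
qed

lemma affine_seq_in:
  assumes "W \<ge> 1" "coherent W \<sigma>" "\<omega> \<in> residue_seqs W"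
  shows "affine_seq W M \<sigma> \<omega> \<in> residue_seqs W"
proof -
  have "(M * \<omega> (Suc k) + \<sigma> (Suc k)) mod W ^ Suc k mod W ^ k = (M * \<omega> k + \<sigma> k) mod W ^ k" for k
  proof -
    have "[M * \<omega> (Suc k) + \<sigma> (Suc k) = M * \<omega> k + \<sigma> k] (mod W ^ k)"
      using assms(2,3) residue_seqs_mod[OF assms(3), of k "Suc k"] residue_seqs_mod_self[OF assms(3), of k]
      by (intro cong_add cong_mult) (auto simp: coherent_def cong_def)
    then show ?thesis
      by (simp add: cong_def mod_mod_cancel le_imp_power_dvd)
  qed
  moreover have "W ^ k > 0" for k using assms(1) by simp
  ultimately show ?thesis
    unfolding residue_seqs_def affine_seq_def by (auto intro!: pos_mod_sign pos_mod_bound)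
qed

lemma coherent_const [simp]: "coherent W (\<lambda>_. c)"
  by (simp add: coherent_def)

lemma coherent_mult: "coherent W \<sigma> \<Longrightarrow> coherent W (\<lambda>k. j * \<sigma> k)"
  by (simp add: coherent_def cong_scalar_left)

text \<open>An inverse modulo \<open>W ^ k\<close> is unique modulo \<open>W ^ k\<close>, so
  inverses chosen separately at each level are automatically coherent. The result plays the role of
  \<open>1 / M\<close>.\<close>

lemma coherent_inverse:
  assumes "coprime M W"
  obtains u where "coherent W u" "\<And>k. [M * u k = 1] (mod W ^ k)"
proof -
  have "\<exists>x. [M * x = 1] (mod W ^ k)" for k
    using assms by (simp add: cong_solve_coprime_int)
  then obtain u where u: "\<And>k. [M * u k = 1] (mod W ^ k)" by metis
  have "[u (Suc k) = u k] (mod W ^ k)" for k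
  proof -
    have "[M * u (Suc k) = 1] (mod W ^ k)"
      using u[of "Suc k"] by (rule cong_dvd_modulus) (simp add: le_imp_power_dvd)
    then have "[M * u (Suc k) = M * u k] (mod W ^ k)"
      using u[of k] cong_sym cong_trans by blast
    then show ?thesis
      using assms by (simp add: cong_mult_lcancel)
  qed
  then show ?thesis using that u by (auto simp: coherent_def)
qed

text \<open>
  This congruence rule lets the simplifier turn \<open>lborel \<Otimes>\<^sub>M V\<close> into \<open>borel \<Otimes>\<^sub>M V\<close> inside
  \<^const>\<open>sets\<close>, where facts about the former no longer apply.
\<close>

declare sets_pair_measure_cong [cong del]

text \<open>\<open>V\<close> is the Haar probability measure of the \<open>W\<close>-adic integers,
  pinned down by its values on cylinders.\<close>

locale residue_measure =
  fixes W :: int and V :: "(nat \<Rightarrow> int) measure"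
  assumes W: "W \<ge> 1"
    and sets_V: "sets V = sets (sigma (residue_seqs W) (cylinders W))"
    and emeasure_cylinder: "\<And>k c. 0 \<le> c \<Longrightarrow> c < W ^ k \<Longrightarrow> emeasure V (cylinder W k c) = ennreal (1 / of_int W ^ k)"
begin

lemma cylinders_Pow: "cylinders W \<subseteq> Pow (residue_seqs W)"
  using cylinder_subset by (auto simp: cylinders_def)

lemma sets_V': "sets V = sigma_sets (residue_seqs W) (cylinders W)"
  using cylinders_Pow by (simp add: sets_V sets_measure_of)

lemma space_V: "space V = residue_seqs W"
  using sets_eq_imp_space_eq[OF sets_V] cylinders_Pow by (simp add: space_measure_of)

lemma W_pos: "W ^ k > 0"
  using W by simp

lemma cylinder_sets [measurable]: "cylinder W k c \<in> sets V"
  unfolding sets_V' by (auto simp: cylinders_def)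

lemma residue_seqs_cylinder: "residue_seqs W = cylinder W 0 0"
  by (auto simp: residue_seqs_def cylinder_def) (metis less_one order_antisym_conv power_0 zero_less_iff_neq_zero int_one_le_iff_zero_less linorder_not_less)

lemma emeasure_V_space: "emeasure V (residue_seqs W) = 1"
  unfolding residue_seqs_cylinder using emeasure_cylinder[of 0 0] by simp

sublocale V: finite_measure V
  by standard (simp add: space_V emeasure_V_space)

lemma component_measurable: "(\<lambda>\<omega>. \<omega> k) \<in> measurable V (count_space UNIV)"
proof -
  have "(\<lambda>\<omega>. \<omega> k) -` {a} \<inter> space V = cylinder W k a" for a
    by (auto simp: cylinder_def space_V)
  then show ?thesis
    by (subst measurable_count_space_eq2_countable) auto
qed

lemma component_set_measurable [measurable]: "{\<omega> \<in> residue_seqs W. Q (\<omega> k)} \<in> sets V"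
proof -
  have "(\<lambda>\<omega>. \<omega> k) -` {c. Q c} \<inter> space V \<in> sets V"
    using component_measurable by (rule measurable_sets) simp
  then show ?thesis
    by (simp add: space_V vimage_def Int_def conj_commute)
qed

lemma affine_seq_measurable [measurable]:
  assumes "coherent W \<sigma>"
  shows "affine_seq W M \<sigma> \<in> measurable V V"
proof (rule measurable_sigma_sets[OF sets_V' cylinders_Pow])
  show "affine_seq W M \<sigma> \<in> space V \<rightarrow> residue_seqs W"
    using affine_seq_in[OF W assms] by (auto simp: space_V)
  fix y assume "y \<in> cylinders W"
  then consider "y = {}" | k c where "y = cylinder W k c"
    by (auto simp: cylinders_def)
  then show "affine_seq W M \<sigma> -` y \<inter> space V \<in> sets V"
  proof cases
    case (2 k c)
    have "affine_seq W M \<sigma> -` y \<inter> space V = {\<omega> \<in> residue_seqs W. (M * \<omega> k + \<sigma> k) mod W ^ k = c}"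
      using affine_seq_in[OF W assms] by (auto simp: 2 cylinder_def space_V affine_seq_def)
    also have "\<dots> \<in> sets V" by (rule component_set_measurable)
    finally show ?thesis .
  qed auto
qed

text \<open>Multiplying by a unit and adding a constant permutes the residues modulo
  \<open>W ^ k\<close>, so the preimage of a cylinder is one cylinder of the same level.\<close>

lemma emeasure_affine_cylinder:
  assumes "coprime M W" "coherent W \<sigma>"
  shows "emeasure V (affine_seq W M \<sigma> -` cylinder W k c \<inter> space V) = emeasure V (cylinder W k c)"
proof (cases "0 \<le> c \<and> c < W ^ k")
  case True
  obtain u where u: "\<And>k. [M * u k = 1] (mod W ^ k)"
    using coherent_inverse[OF assms(1)] by metis
  define c' where "c' = (u k * (c - \<sigma> k)) mod W ^ k"
  have c': "0 \<le> c'" "c' < W ^ k"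
    using W_pos[of k] by (simp_all add: c'_def)
  have "(M * x + \<sigma> k) mod W ^ k = c \<longleftrightarrow> x = c'" if "0 \<le> x" "x < W ^ k" for x
  proof -
    have "(M * x + \<sigma> k) mod W ^ k = c \<longleftrightarrow> [M * x + \<sigma> k = c] (mod W ^ k)"
      using True by (simp add: cong_def)
    also have "\<dots> \<longleftrightarrow> [M * x = c - \<sigma> k] (mod W ^ k)"
      by (simp add: cong_iff_dvd_diff algebra_simps)
    also have "\<dots> \<longleftrightarrow> [x = u k * (c - \<sigma> k)] (mod W ^ k)"
    proof
      assume "[M * x = c - \<sigma> k] (mod W ^ k)"
      then have "[u k * (M * x) = u k * (c - \<sigma> k)] (mod W ^ k)"
        by (rule cong_scalar_left)
      moreover have "[M * u k * x = 1 * x] (mod W ^ k)"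
        by (rule cong_scalar_right[OF u])
      ultimately show "[x = u k * (c - \<sigma> k)] (mod W ^ k)"
        by (simp add: ac_simps) (metis cong_sym cong_trans)
    next
      assume "[x = u k * (c - \<sigma> k)] (mod W ^ k)"
      then have "[M * x = M * (u k * (c - \<sigma> k))] (mod W ^ k)"
        by (rule cong_scalar_left)
      moreover have "[M * u k * (c - \<sigma> k) = 1 * (c - \<sigma> k)] (mod W ^ k)"
        by (rule cong_scalar_right[OF u])
      ultimately show "[M * x = c - \<sigma> k] (mod W ^ k)"
        by (simp add: mult.assoc) (metis cong_trans)
    qed
    also have "\<dots> \<longleftrightarrow> x = c'"
      using that by (simp add: cong_def c'_def)
    finally show ?thesis .
  qed
  then have "affine_seq W M \<sigma> -` cylinder W k c \<inter> space V = cylinder W k c'"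
    using affine_seq_in[OF W assms(2)]
    by (fastforce simp: cylinder_def space_V affine_seq_def residue_seqs_def)
  then show ?thesis
    using c' True by (simp add: emeasure_cylinder)
qed (simp add: cylinder_empty)

lemma distr_affine_seq:
  assumes "coprime M W" "coherent W \<sigma>"
  shows "distr V V (affine_seq W M \<sigma>) = V"
proof (rule measure_eqI_generator_eq[OF Int_stable_cylinders cylinders_Pow, where A = "\<lambda>_. residue_seqs W"])
  note [measurable] = affine_seq_measurable[OF assms(2)]
  fix X assume "X \<in> cylinders W"
  then show "emeasure (distr V V (affine_seq W M \<sigma>)) X = emeasure V X"
    using emeasure_affine_cylinder[OF assms] by (auto simp: cylinders_def emeasure_distr)
next
  have "affine_seq W M \<sigma> -` residue_seqs W \<inter> space V = residue_seqs W"
    using affine_seq_in[OF W assms(2)] by (auto simp: space_V)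
  then show "emeasure (distr V V (affine_seq W M \<sigma>)) (residue_seqs W) \<noteq> \<infinity>"
    using affine_seq_measurable[OF assms(2)] residue_seqs_cylinder
    by (simp add: emeasure_distr emeasure_V_space)
qed (auto simp: sets_V' residue_seqs_cylinder cylinders_def)

section \<open>Affine maps of the line times the residue sequences\<close>

abbreviation P :: "(real \<times> (nat \<Rightarrow> int)) measure" where
  "P \<equiv> lborel \<Otimes>\<^sub>M V"

definition affine_map :: "int \<Rightarrow> real \<Rightarrow> (nat \<Rightarrow> int) \<Rightarrow> real \<times> (nat \<Rightarrow> int) \<Rightarrow> real \<times> (nat \<Rightarrow> int)" where
  "affine_map M s \<sigma> z = (of_int M * fst z + s, affine_seq W M \<sigma> (snd z))"

lemma affine_map_measurable [measurable]:
  "coherent W \<sigma> \<Longrightarrow> affine_map M s \<sigma> \<in> measurable P P"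
  unfolding affine_map_def[abs_def] by measurable

lemma space_P: "space P = UNIV \<times> residue_seqs W"
  by (simp add: space_pair_measure space_V)

text \<open>The real factor is stretched by \<open>M\<close>, while on residues the map preserves
  \<open>V\<close> because \<open>M\<close> is a unit there. Fubini combines the two.\<close>

lemma emeasure_affine_map:
  assumes M: "M \<ge> 1" "coprime M W" and \<sigma>: "coherent W \<sigma>" and A: "A \<in> sets P"
  shows "ennreal (of_int M) * emeasure P (affine_map M s \<sigma> -` A \<inter> space P) = emeasure P A"
proof -
  note [measurable] = A affine_map_measurable[OF \<sigma>] affine_seq_measurable[OF \<sigma>]
  have "emeasure P (affine_map M s \<sigma> -` A \<inter> space P)
      = (\<integral>\<^sup>+x. emeasure V (Pair x -` (affine_map M s \<sigma> -` A \<inter> space P)) \<partial>lborel)"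
    by (rule V.emeasure_pair_measure_alt) measurable
  also have "\<dots> = (\<integral>\<^sup>+x. emeasure V (Pair (s + of_int M * x) -` A) \<partial>lborel)"
  proof (rule nn_integral_cong)
    fix x :: real
    have "Pair x -` (affine_map M s \<sigma> -` A \<inter> space P)
        = affine_seq W M \<sigma> -` (Pair (s + of_int M * x) -` A) \<inter> space V"
      by (auto simp: affine_map_def space_P space_V add.commute)
    then show "emeasure V (Pair x -` (affine_map M s \<sigma> -` A \<inter> space P)) = emeasure V (Pair (s + of_int M * x) -` A)"
      using emeasure_distr[OF affine_seq_measurable[OF \<sigma>, of M] sets_Pair1[OF A]]
      by (simp add: distr_affine_seq[OF M(2) \<sigma>] del: vimage_Int)
  qed
  also have "ennreal (of_int M) * \<dots> = (\<integral>\<^sup>+x. emeasure V (Pair x -` A) \<partial>lborel)"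
    using M(1) nn_integral_real_affine[of "\<lambda>x. emeasure V (Pair x -` A)" "of_int M" s]
      V.measurable_emeasure_Pair[OF A] by simp
  also have "\<dots> = emeasure P A"
    by (rule V.emeasure_pair_measure_alt[symmetric]) measurable
  finally show ?thesis .
qed

end

section \<open>Counting integers in an interval and a residue class\<close>

lemma finite_int_between:
  fixes p q :: real
  shows "finite {t::int. p < of_int t \<and> of_int t < q}"
  by (rule finite_subset[of _ "{\<lfloor>p\<rfloor>..\<lceil>q\<rceil>}"]) (auto simp: floor_le_iff le_ceiling_iff)

lemma card_int_between:
  fixes p q :: real
  assumes "p \<le> q"
  shows "\<bar>real (card {t::int. p < of_int t \<and> of_int t < q}) - (q - p)\<bar> \<le> 1"
proof -
  have "{t::int. p < of_int t \<and> of_int t < q} = {\<lfloor>p\<rfloor>+1..\<lceil>q\<rceil>-1}"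
    by (auto simp: floor_less_iff less_ceiling_iff) linarith+
  then have "card {t::int. p < of_int t \<and> of_int t < q} = nat (\<lceil>q\<rceil> - \<lfloor>p\<rfloor> - 1)"
    by simp
  then show ?thesis using assms by linarith
qed

text \<open>Writing \<open>j = e + Q * t\<close> reduces to counting all integers \<open>t\<close>
  in an interval shorter by the factor \<open>Q\<close>. The error 1 is uniform in the interval and
  in \<open>Q\<close>.\<close>

lemma card_residue_between:
  fixes p q :: real and Q e :: int
  assumes "p \<le> q" "Q \<ge> 1" "0 \<le> e" "e < Q"
  defines "A \<equiv> {j::int. p < of_int j \<and> of_int j < q \<and> j mod Q = e}"
  shows "finite A" "\<bar>real (card A) - (q - p) / of_int Q\<bar> \<le> 1"
proof -
  show "finite A"
    unfolding A_def by (rule finite_subset[OF _ finite_int_between[of p q]]) auto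
  have "A = (\<lambda>t. e + Q * t) ` {t::int. (p - of_int e) / of_int Q < of_int t \<and> of_int t < (q - of_int e) / of_int Q}" (is "_ = _ ` ?T")
  proof (intro subset_antisym subsetI)
    fix j assume j: "j \<in> A"
    then have "j = e + Q * (j div Q)"
      using mult_div_mod_eq[of Q j] by (simp add: A_def)
    moreover from this have "of_int j = real_of_int e + of_int Q * of_int (j div Q)"
      by (metis of_int_add of_int_mult)
    ultimately show "j \<in> (\<lambda>t. e + Q * t) ` ?T"
      using j assms(2) by (intro image_eqI[of _ _ "j div Q"]) (auto simp: A_def field_simps)
  next
    fix j assume "j \<in> (\<lambda>t. e + Q * t) ` ?T"
    then obtain t where t: "j = e + Q * t" "(p - of_int e) / of_int Q < of_int t" "of_int t < (q - of_int e) / of_int Q"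
      by auto
    then have "p < of_int j" "of_int j < q"
      using assms(2) by (auto simp: field_simps)
    moreover have "j mod Q = e" using assms(3,4) by (simp add: t(1))
    ultimately show "j \<in> A" by (simp add: A_def)
  qed
  moreover have "inj_on (\<lambda>t. e + Q * t) ?T"
    using assms(2) by (auto simp: inj_on_def)
  ultimately have "card A = card ?T"
    by (simp add: card_image)
  moreover have "(p - of_int e) / of_int Q \<le> (q - of_int e) / of_int Q"
    using assms by (simp add: divide_right_mono)
  ultimately show "\<bar>real (card A) - (q - p) / of_int Q\<bar> \<le> 1"
    using card_int_between[of "(p - of_int e) / of_int Q" "(q - of_int e) / of_int Q"]
    by (simp add: diff_divide_distrib)
qed

context residue_measure
begin

text \<open>Translation by \<open>j / M\<close>; \<open>u\<close> will be an inverse of \<open>M\<close> among the coherent sequences.\<close>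

definition step :: "int \<Rightarrow> (nat \<Rightarrow> int) \<Rightarrow> int \<Rightarrow> real \<times> (nat \<Rightarrow> int) \<Rightarrow> real \<times> (nat \<Rightarrow> int)" where
  "step M u j = affine_map 1 (of_int j / of_int M) (\<lambda>k. j * u k)"

definition step_invariant :: "int \<Rightarrow> (nat \<Rightarrow> int) \<Rightarrow> (real \<times> (nat \<Rightarrow> int)) set \<Rightarrow> bool" where
  "step_invariant M u C \<longleftrightarrow> (\<forall>j. \<forall>z\<in>C. step M u j z \<in> C)"

definition strip :: "real \<Rightarrow> real \<Rightarrow> (real \<times> (nat \<Rightarrow> int)) set" where
  "strip a b = {a..<b} \<times> residue_seqs W"

lemma strip_measurable [measurable]: "strip a b \<in> sets P"
  unfolding strip_def residue_seqs_cylinder by simp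

lemma emeasure_strip: "a \<le> b \<Longrightarrow> emeasure P (strip a b) = ennreal (b - a)"
  unfolding strip_def
  by (subst V.emeasure_pair_measure_Times) (simp_all add: emeasure_V_space residue_seqs_cylinder[symmetric], simp add: residue_seqs_cylinder)

lemma step_apply:
  "step M u j z = (fst z + of_int j / of_int M, \<lambda>k. (snd z k + j * u k) mod W ^ k)"
  by (simp add: step_def affine_map_def affine_seq_def)

lemma step_measurable [measurable]: "coherent W u \<Longrightarrow> step M u j \<in> measurable P P"
  unfolding step_def by (intro affine_map_measurable coherent_mult)

lemma step_in: "coherent W u \<Longrightarrow> z \<in> space P \<Longrightarrow> step M u j z \<in> space P"
  using measurable_space[OF step_measurable] .

lemma emeasure_step:
  assumes "coherent W u" "A \<in> sets P"
  shows "emeasure P (step M u j -` A \<inter> space P) = emeasure P A"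
  using emeasure_affine_map[of 1 "\<lambda>k. j * u k" A "of_int j / of_int M"] assms coherent_mult
  by (simp add: step_def)

lemma step_step_minus:
  assumes "z \<in> space P"
  shows "step M u (-j) (step M u j z) = z"
proof (rule prod_eqI)
  have "((snd z k + j * u k) mod W ^ k + - j * u k) mod W ^ k = snd z k" for k
    using residue_seqs_mod_self[of "snd z" W k] assms
    by (auto simp: space_P mod_simps)
  then show "snd (step M u (-j) (step M u j z)) = snd z"
    by (simp add: step_apply)
qed (simp add: step_apply)

lemma step_invariant_iff:
  assumes "step_invariant M u C" "z \<in> space P"
  shows "step M u j z \<in> C \<longleftrightarrow> z \<in> C"
  using assms step_step_minus[OF assms(2), of M u j] unfolding step_invariant_def by metis

text \<open>The strip over \<open>[0, 1 / M)\<close> is a fundamental domain for the steps. Cutting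
  \<open>C\<close> along its translates, moving each piece back and exchanging sum and integral
  leaves the number of orbit points in \<open>B\<close>, integrated over that domain.\<close>

lemma unfold_invariant:
  assumes M: "M \<ge> 1" and u: "coherent W u" and inv: "step_invariant M u C"
    and [measurable]: "C \<in> sets P" "B \<in> sets P"
  shows "emeasure P (C \<inter> B) = (\<integral>\<^sup>+z. indicator (C \<inter> strip 0 (1 / of_int M)) z *
           (\<integral>\<^sup>+j. indicator B (step M u j z) \<partial>count_space UNIV) \<partial>P)"
proof -
  note [measurable] = step_measurable[OF u]
  define X where "X j = C \<inter> B \<inter> strip (of_int j / of_int M) (of_int (j + 1) / of_int M)" for j :: int
  have M0: "real_of_int M > 0" using M by simp
  have [measurable]: "X j \<in> sets P" for j unfolding X_def by measurable
  have fl: "x \<in> {of_int j / of_int M..<of_int (j + 1) / of_int M} \<longleftrightarrow> \<lfloor>x * of_int M\<rfloor> = j" for x j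
    using M0 by (auto simp: floor_eq_iff field_simps)
  have "C \<subseteq> space P"
    by (rule sets.sets_into_space) fact
  then have UN: "C \<inter> B = (\<Union>j. X j)"
  proof (intro subset_antisym subsetI)
    fix z assume z: "z \<in> C \<inter> B"
    with \<open>C \<subseteq> space P\<close> have "z \<in> X \<lfloor>fst z * of_int M\<rfloor>"
      using fl[of "fst z" "\<lfloor>fst z * of_int M\<rfloor>"] unfolding X_def strip_def space_P
      by (cases z) (simp only: Int_iff mem_Times_iff fst_conv snd_conv, blast)
    then show "z \<in> (\<Union>j. X j)" by blast
  qed (auto simp: X_def)
  have "emeasure P (C \<inter> B) = (\<integral>\<^sup>+j. emeasure P (X j) \<partial>count_space UNIV)"
    unfolding UN
  proof (rule emeasure_UN_countable)
    have "\<lfloor>fst z * of_int M\<rfloor> = j" if "z \<in> X j" for z j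
      using that fl[of "fst z" j] unfolding X_def strip_def
      by (simp only: Int_iff mem_Times_iff fst_conv snd_conv)
    then show "disjoint_family X"
      unfolding disjoint_family_on_def by blast
  qed auto
  also have "\<dots> = (\<integral>\<^sup>+j. (\<integral>\<^sup>+z. indicator (C \<inter> strip 0 (1 / of_int M)) z * indicator B (step M u j z) \<partial>P) \<partial>count_space UNIV)"
  proof (rule nn_integral_cong)
    fix j :: int
    have "emeasure P (X j) = emeasure P (step M u j -` X j \<inter> space P)"
      by (rule emeasure_step[OF u, symmetric]) measurable
    also have "step M u j -` X j \<inter> space P = {z \<in> space P. z \<in> C \<inter> strip 0 (1 / of_int M) \<and> step M u j z \<in> B}"
    proof -
      have "step M u j z \<in> strip (of_int j / of_int M) (of_int (j + 1) / of_int M) \<longleftrightarrow> z \<in> strip 0 (1 / of_int M)"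
        if "z \<in> space P" for z
        using that step_in[OF u that, of M j] M0
        by (auto simp: strip_def space_P step_apply field_simps zero_le_mult_iff)
      then show ?thesis
        using step_invariant_iff[OF inv] unfolding X_def by blast
    qed
    also have "emeasure P \<dots> = (\<integral>\<^sup>+z. indicator {z \<in> space P. z \<in> C \<inter> strip 0 (1 / of_int M) \<and> step M u j z \<in> B} z \<partial>P)"
      by (subst nn_integral_indicator) measurable
    also have "\<dots> = (\<integral>\<^sup>+z. indicator (C \<inter> strip 0 (1 / of_int M)) z * indicator B (step M u j z) \<partial>P)"
      by (intro nn_integral_cong) (auto simp: indicator_def)
    finally show "emeasure P (X j) = \<dots>" .
  qed
  also have "\<dots> = (\<integral>\<^sup>+z. (\<integral>\<^sup>+j. indicator (C \<inter> strip 0 (1 / of_int M)) z * indicator B (step M u j z) \<partial>count_space UNIV) \<partial>P)"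
    by (rule nn_integral_count_space_nn_integral[symmetric]) auto
  also have "\<dots> = (\<integral>\<^sup>+z. indicator (C \<inter> strip 0 (1 / of_int M)) z *
           (\<integral>\<^sup>+j. indicator B (step M u j z) \<partial>count_space UNIV) \<partial>P)"
    by (intro nn_integral_cong nn_integral_cmult) auto
  finally show ?thesis .
qed

lemma nn_integral_count_space_indicator_card:
  assumes "finite {j. f j \<in> B}"
  shows "(\<integral>\<^sup>+j. indicator B (f j) \<partial>count_space UNIV) = of_nat (card {j. f j \<in> B})"
proof -
  have "(\<integral>\<^sup>+j. indicator B (f j) \<partial>count_space UNIV) = (\<integral>\<^sup>+j. indicator {j. f j \<in> B} j \<partial>count_space UNIV)"
    by (intro nn_integral_cong) (auto simp: indicator_def)
  also have "\<dots> = of_nat (card {j. f j \<in> B})"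
    using assms by (simp add: emeasure_count_space_finite)
  finally show ?thesis .
qed

text \<open>With step 1, every orbit meets a half-open strip of integer length \<open>n\<close> in
  exactly \<open>n\<close> points.\<close>

lemma emeasure_invariant_strip:
  assumes inv: "step_invariant 1 (\<lambda>_. 1) C" and [measurable]: "C \<in> sets P" and n: "n \<ge> 0"
  shows "emeasure P (C \<inter> strip t (t + of_int n)) = ennreal (of_int n) * emeasure P (C \<inter> strip 0 1)"
proof -
  have "emeasure P (C \<inter> strip t (t + of_int n)) = (\<integral>\<^sup>+z. indicator (C \<inter> strip 0 1) z *
           (\<integral>\<^sup>+j. indicator (strip t (t + of_int n)) (step 1 (\<lambda>_. 1) j z) \<partial>count_space UNIV) \<partial>P)"
    using unfold_invariant[OF _ _ inv assms(2) strip_measurable, of t "t + of_int n"] by simp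
  also have "\<dots> = (\<integral>\<^sup>+z. ennreal (of_int n) * indicator (C \<inter> strip 0 1) z \<partial>P)"
  proof (rule nn_integral_cong)
    fix z assume z: "z \<in> space P"
    have *: "step 1 (\<lambda>_. 1) j z \<in> strip t (t + of_int n) \<longleftrightarrow> j \<in> {\<lceil>t - fst z\<rceil>..<\<lceil>t - fst z\<rceil> + n}" for j
      using step_in[OF coherent_const z, of 1 1 j]
      by (auto simp: strip_def space_P step_apply ceiling_le_iff) linarith+
    have "(\<integral>\<^sup>+j. indicator (strip t (t + of_int n)) (step 1 (\<lambda>_. 1) j z) \<partial>count_space UNIV) = of_nat (nat n)"
      by (subst nn_integral_count_space_indicator_card) (simp_all only: * Collect_mem_eq, simp_all)
    also have "of_nat (nat n) = ennreal (of_int n)"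
      using n by (simp add: ennreal_of_nat_eq_real_of_nat)
    finally show "indicator (C \<inter> strip 0 1) z * (\<integral>\<^sup>+j. indicator (strip t (t + of_int n)) (step 1 (\<lambda>_. 1) j z) \<partial>count_space UNIV)
      = ennreal (of_int n) * indicator (C \<inter> strip 0 1) z"
      by (simp add: mult.commute)
  qed
  also have "\<dots> = ennreal (of_int n) * emeasure P (C \<inter> strip 0 1)"
    by (rule nn_integral_cmult_indicator) measurable
  finally show ?thesis .
qed

end

section \<open>Equidistribution and the zero-one criterion\<close>

context residue_measure
begin

lemma emeasure_box_cylinder:
  assumes "a \<le> b" "0 \<le> c" "c < W ^ k"
  shows "emeasure P ({a<..<b} \<times> cylinder W k c) = ennreal ((b - a) / of_int W ^ k)"
  using assms W by (subst V.emeasure_pair_measure_Times) (simp_all add: emeasure_cylinder flip: ennreal_mult')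

text \<open>The real coordinate confines \<open>j\<close> to an interval of length
  \<open>M * (b - a)\<close>, the residue coordinate to one class modulo \<open>W ^ k\<close>; the
  error is uniform in \<open>z\<close>.\<close>

lemma step_card:
  assumes M: "M \<ge> 1" "coprime M W" and u: "coherent W u" "\<And>k. [M * u k = 1] (mod W ^ k)"
    and ab: "a \<le> b" and c: "0 \<le> c" "c < W ^ k" and z: "z \<in> space P"
  defines "J \<equiv> {j. step M u j z \<in> {a<..<b} \<times> cylinder W k c}"
  shows "finite J" "\<bar>real (card J) - of_int M * (b - a) / of_int W ^ k\<bar> \<le> 1"
proof -
  \<comment> \<open>Multiplying the congruence by \<open>M\<close> cancels \<open>u k\<close> and
    solves it for \<open>j\<close>.\<close>
  define e where "e = (M * (c - snd z k)) mod W ^ k"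
  have e: "0 \<le> e" "e < W ^ k" using W_pos[of k] by (simp_all add: e_def)
  have res: "(snd z k + j * u k) mod W ^ k = c \<longleftrightarrow> j mod W ^ k = e" for j
  proof -
    have "(snd z k + j * u k) mod W ^ k = c \<longleftrightarrow> [snd z k + j * u k = c] (mod W ^ k)"
      using c by (simp add: cong_def)
    also have "\<dots> \<longleftrightarrow> [j * u k = c - snd z k] (mod W ^ k)"
      by (simp add: cong_iff_dvd_diff algebra_simps)
    also have "\<dots> \<longleftrightarrow> [M * (j * u k) = M * (c - snd z k)] (mod W ^ k)"
      using M(2) by (simp add: cong_mult_lcancel)
    also have "\<dots> \<longleftrightarrow> [j = M * (c - snd z k)] (mod W ^ k)"
    proof -
      have "[j * (M * u k) = j * 1] (mod W ^ k)" by (rule cong_scalar_left[OF u(2)])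
      then have "[M * (j * u k) = j] (mod W ^ k)" by (simp add: ac_simps)
      then show ?thesis by (metis cong_sym cong_trans)
    qed
    finally show ?thesis by (simp add: cong_def e_def)
  qed
  have J: "J = {j. of_int M * (a - fst z) < of_int j \<and> of_int j < of_int M * (b - fst z) \<and> j mod W ^ k = e}"
    using step_in[OF u(1) z, of M] M(1)
    by (auto simp: J_def cylinder_def space_P step_apply res field_simps)
  have le: "real_of_int M * (a - fst z) \<le> of_int M * (b - fst z)"
    using ab M(1) by (intro mult_left_mono) auto
  have W1: "W ^ k \<ge> 1" using W_pos[of k] by linarith
  show "finite J"
    unfolding J by (rule card_residue_between(1)[OF le W1 e])
  show "\<bar>real (card J) - of_int M * (b - a) / of_int W ^ k\<bar> \<le> 1"
    using card_residue_between(2)[OF le W1 e] unfolding J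
    by (simp add: right_diff_distrib)
qed

text \<open>In \<open>unfold_invariant\<close> the count equals its mean \<open>h\<close> up to 1,
  and this error is integrated over a set of measure at most \<open>1 / M\<close>.\<close>

lemma equidistribution:
  assumes M: "M \<ge> 1" "coprime M W" and u: "coherent W u" "\<And>k. [M * u k = 1] (mod W ^ k)"
    and inv: "step_invariant M u C" and C [measurable]: "C \<in> sets P"
    and ab: "a \<le> b" and c: "0 \<le> c" "c < W ^ k"
  shows "\<bar>measure P (C \<inter> ({a<..<b} \<times> cylinder W k c))
          - measure P (C \<inter> strip 0 (1 / of_int M)) * (of_int M * (b - a) / of_int W ^ k)\<bar> \<le> 1 / of_int M"
proof -
  define B where "B = {a<..<b} \<times> cylinder W k c"
  define D where "D = C \<inter> strip 0 (1 / of_int M)"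
  define h where "h = of_int M * (b - a) / of_int W ^ k"
  have [measurable]: "B \<in> sets P" "D \<in> sets P" unfolding B_def D_def by measurable
  have W0: "real_of_int W ^ k > 0" using W by simp
  have h0: "h \<ge> 0" using M ab W by (simp add: h_def)
  have D1: "emeasure P D \<le> ennreal (1 / of_int M)"
    using emeasure_mono[of D "strip 0 (1 / of_int M)" P] emeasure_strip[of 0 "1 / of_int M"] M(1)
    by (simp add: D_def)
  then have Dfin: "emeasure P D = ennreal (measure P D)"
    by (intro emeasure_eq_ennreal_measure) (auto simp: top_unique)
  have Bfin: "emeasure P (C \<inter> B) = ennreal (measure P (C \<inter> B))"
    using emeasure_mono[of "C \<inter> B" B P] emeasure_box_cylinder[OF ab c]
    by (intro emeasure_eq_ennreal_measure) (auto simp: top_unique B_def)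
  have eq: "emeasure P (C \<inter> B) = (\<integral>\<^sup>+z. indicator D z * (\<integral>\<^sup>+j. indicator B (step M u j z) \<partial>count_space UNIV) \<partial>P)"
    unfolding D_def by (rule unfold_invariant[OF M(1) u(1) inv]) measurable
  have n: "(\<integral>\<^sup>+j. indicator B (step M u j z) \<partial>count_space UNIV) = ennreal (real (card {j. step M u j z \<in> B}))"
    "\<bar>real (card {j. step M u j z \<in> B}) - h\<bar> \<le> 1" if "z \<in> space P" for z
    using step_card[OF M u ab c that] unfolding B_def[symmetric] h_def[symmetric]
    by (simp_all add: nn_integral_count_space_indicator_card ennreal_of_nat_eq_real_of_nat)
  have "emeasure P (C \<inter> B) \<le> (\<integral>\<^sup>+z. ennreal (h + 1) * indicator D z \<partial>P)"
    unfolding eq using n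
    by (intro nn_integral_mono) (fastforce simp: indicator_def intro!: ennreal_leI)
  also have "\<dots> = ennreal (h + 1) * emeasure P D"
    by (rule nn_integral_cmult_indicator) measurable
  also have "\<dots> = ennreal ((h + 1) * measure P D)"
    using h0 by (simp only: Dfin ennreal_mult add_nonneg_nonneg zero_le_one measure_nonneg)
  finally have 1: "measure P (C \<inter> B) \<le> (h + 1) * measure P D"
    using h0 by (simp add: Bfin)
  have "ennreal (h - 1) * emeasure P D = (\<integral>\<^sup>+z. ennreal (h - 1) * indicator D z \<partial>P)"
    by (rule nn_integral_cmult_indicator[symmetric]) measurable
  also have "\<dots> \<le> emeasure P (C \<inter> B)"
    unfolding eq using n
    by (intro nn_integral_mono) (fastforce simp: indicator_def intro!: ennreal_leI)
  finally have le: "ennreal (h - 1) * emeasure P D \<le> emeasure P (C \<inter> B)" .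
  \<comment> \<open>\<open>ennreal\<close> truncates negative numbers to 0, so the integral bound is
    informative only for \<open>h \<ge> 1\<close>; otherwise the left side is not positive.\<close>
  have 2: "(h - 1) * measure P D \<le> measure P (C \<inter> B)"
  proof (cases "h \<ge> 1")
    case True
    then show ?thesis
      using le
      by (simp add: Dfin Bfin flip: ennreal_mult)
  next
    case False
    then have "(h - 1) * measure P D \<le> 0" by (simp add: mult_nonpos_nonneg)
    also have "0 \<le> measure P (C \<inter> B)" by simp
    finally show ?thesis .
  qed
  have "measure P D \<le> 1 / of_int M"
    using D1 M(1) by (simp add: Dfin)
  then show ?thesis
    using 1 2 unfolding B_def[symmetric] D_def[symmetric] h_def[symmetric]
    by (simp add: algebra_simps abs_le_iff)
qed

text \<open>Exact invariance is asked of a representative \<open>C\<close> of \<open>F\<close>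
  modulo null sets, because \<open>unfold_invariant\<close> follows individual orbits.\<close>

definition ae_step_invariant :: "int \<Rightarrow> (real \<times> (nat \<Rightarrow> int)) set \<Rightarrow> bool" where
  "ae_step_invariant M F \<longleftrightarrow> M \<ge> 1 \<and> coprime M W \<and>
     (\<exists>u C. coherent W u \<and> (\<forall>k. [M * u k = 1] (mod W ^ k)) \<and> step_invariant M u C \<and> C \<in> sets P \<and>
        (AE z in P. z \<in> F \<longleftrightarrow> z \<in> C))"

text \<open>The mass of \<open>C\<close> in its fundamental strip is unknown and varies with
  \<open>M\<close>. Comparing the box with the unit box eliminates it and leaves an error of order
  \<open>1 / M\<close>, with \<open>M\<close> as large as desired.\<close>

lemma measure_box_cylinder_eq:
  assumes F: "F \<in> sets P" and inv: "\<And>n. \<exists>M\<ge>n. ae_step_invariant M F"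
    and ab: "a \<le> b" and c: "0 \<le> c" "c < W ^ k"
  shows "measure P (F \<inter> ({a<..<b} \<times> cylinder W k c))
    = measure P (F \<inter> ({0<..<1} \<times> cylinder W 0 0)) * ((b - a) / of_int W ^ k)" (is "?l = ?m * ?q")
proof -
  have W0: "real_of_int W ^ k > 0" using W by simp
  then have q0: "?q \<ge> 0" using ab by simp
  have bound: "\<bar>?l - ?m * ?q\<bar> * of_int M \<le> 1 + ?q" if "ae_step_invariant M F" for M
  proof -
    obtain u C where M: "M \<ge> 1" "coprime M W" and u: "coherent W u" "\<And>k. [M * u k = 1] (mod W ^ k)"
      and C: "step_invariant M u C" "C \<in> sets P" "AE z in P. z \<in> F \<longleftrightarrow> z \<in> C"
      using \<open>ae_step_invariant M F\<close> by (auto simp: ae_step_invariant_def)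
    have M0: "real_of_int M > 0" using M by simp
    define d where "d = measure P (C \<inter> strip 0 (1 / of_int M))"
    have FC: "measure P (F \<inter> X) = measure P (C \<inter> X)" if "X \<in> sets P" for X
      using C that F by (intro measure_eq_AE) auto
    have 1: "\<bar>?l - d * (of_int M * ?q)\<bar> \<le> 1 / of_int M"
      using equidistribution[OF M u C(1,2) ab c] by (subst FC) (auto simp: d_def)
    have 2: "\<bar>?m - d * of_int M\<bar> \<le> 1 / of_int M"
      using equidistribution[OF M u C(1,2), of 0 1 0 0] by (subst FC) (auto simp: d_def)
    have "\<bar>?l - ?m * ?q\<bar> \<le> \<bar>?l - d * (of_int M * ?q)\<bar> + \<bar>?m - d * of_int M\<bar> * ?q"
    proof -
      have tri: "\<bar>x - y\<bar> \<le> \<bar>x - w\<bar> + \<bar>y - w\<bar>" for x y w :: real by linarith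
      have "\<bar>?m * ?q - d * (of_int M * ?q)\<bar> = \<bar>(?m - d * of_int M) * ?q\<bar>"
        by (simp only: left_diff_distrib mult.assoc)
      also have "\<dots> = \<bar>?m - d * of_int M\<bar> * ?q"
        by (simp only: abs_mult abs_of_nonneg[OF q0])
      finally show ?thesis using tri by metis
    qed
    also have "\<dots> \<le> 1 / of_int M + 1 / of_int M * ?q"
      using 1 2 q0 by (intro add_mono mult_right_mono)
    also have "\<dots> = (1 + ?q) / of_int M"
      by (simp add: add_divide_distrib)
    finally show ?thesis
      using M0 by (simp add: pos_le_divide_eq)
  qed
  have "\<bar>?l - ?m * ?q\<bar> = 0"
  proof (rule ccontr)
    assume "\<bar>?l - ?m * ?q\<bar> \<noteq> 0"
    then have pos: "\<bar>?l - ?m * ?q\<bar> > 0" by linarith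
    obtain M where M: "M \<ge> \<lceil>(1 + ?q) / \<bar>?l - ?m * ?q\<bar>\<rceil> + 1" "ae_step_invariant M F"
      using inv by blast
    then have "(1 + ?q) / \<bar>?l - ?m * ?q\<bar> < of_int M" by linarith
    then have "1 + ?q < of_int M * \<bar>?l - ?m * ?q\<bar>"
      using pos by (simp only: pos_divide_less_eq)
    then show False using bound[OF M(2)] by (simp add: mult.commute)
  qed
  then show ?thesis by linarith
qed

text \<open>By \<open>measure_box_cylinder_eq\<close> the density of \<open>F\<close> is the same
  constant \<open>m\<close> on all boxes, hence on all measurable sets. Testing on the part of
  \<open>F\<close> in the unit box gives \<open>m = m * m\<close>.\<close>

lemma zero_one_of_invariance:
  assumes F [measurable]: "F \<in> sets P" and inv: "\<And>n. \<exists>M\<ge>n. ae_step_invariant M F"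
  shows "(AE z in P. z \<notin> F) \<or> (AE z in P. z \<in> F)"
proof -
  define m where "m = measure P (F \<inter> ({0<..<1} \<times> cylinder W 0 0))"
  let ?E = "{X \<times> Y | X Y. X \<in> range (\<lambda>(a, b). box a b :: real set) \<and> Y \<in> cylinders W}"
  let ?A = "(\<lambda>n::nat. box (- real n) (real n) \<times> residue_seqs W) ` UNIV"
  have rs: "residue_seqs W \<in> cylinders W"
    unfolding residue_seqs_cylinder by (auto simp: cylinders_def)
  have UN: "(\<Union>n::nat. box (- real n) (real n)) = (UNIV :: real set)"
  proof -
    have "x \<in> (\<Union>n::nat. box (- real n) (real n))" for x :: real
      using reals_Archimedean2[of "\<bar>x\<bar>"] by (auto simp: abs_less_iff) (metis minus_less_iff)
    then show ?thesis by auto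
  qed
  have fin: "emeasure P (F \<inter> B) \<noteq> \<infinity>" if "emeasure P B \<noteq> \<infinity>" "B \<in> sets P" for B
    using emeasure_mono[of "F \<inter> B" B P] that by (auto simp: top_unique)
  have *: "emeasure P (F \<inter> X) = ennreal m * emeasure P X" if XE: "X \<in> ?E" for X
  proof -
    obtain X' Y where X': "X = X' \<times> Y" "X' \<in> range (\<lambda>(a, b). box a b :: real set)" "Y \<in> cylinders W"
      using XE by blast
    moreover from X'(2) obtain a b where "X' = {a<..<b}"
      by (auto simp: image_iff)
    ultimately have X: "X = {a<..<b} \<times> Y" "Y \<in> cylinders W" by auto
    consider "X = {}" | k c where "a \<le> b" "0 \<le> c" "c < W ^ k" "X = {a<..<b} \<times> cylinder W k c"
      using X cylinder_empty by (auto simp: cylinders_def) (metis linorder_linear greaterThanLessThan_empty Sigma_empty1)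
    then show ?thesis
    proof cases
      case (2 k c)
      have "emeasure P (F \<inter> X) = ennreal (measure P (F \<inter> X))"
        using fin[of X] emeasure_box_cylinder[OF 2(1-3)]
        by (intro emeasure_eq_ennreal_measure) (auto simp: 2)
      then show ?thesis
        using measure_box_cylinder_eq[OF F inv 2(1-3)] emeasure_box_cylinder[OF 2(1-3)] 2 W
        by (simp add: m_def flip: ennreal_mult)
    qed simp
  qed
  have sets_P: "sets P = sets (sigma (UNIV \<times> residue_seqs W) ?E)"
  proof -
    have "sets P = sets (sigma (space lborel \<times> space V)
        {X \<times> Y | X Y. X \<in> range (\<lambda>(a, b). box a b :: real set) \<and> Y \<in> cylinders W})"
    proof (rule sets_pair_eq[where Ca = "range (\<lambda>n::nat. box (- real n) (real n))" and Cb = "{residue_seqs W}"])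
      show "sets lborel = sigma_sets (space lborel) (range (\<lambda>(a, b). box a b :: real set))"
        by (subst sets_lborel, subst borel_eq_box) (simp add: sets_measure_of)
      show "range (\<lambda>n::nat. box (- real n) (real n)) \<subseteq> range (\<lambda>(a, b). box a b :: real set)"
        by auto
      show "\<Union>(range (\<lambda>n::nat. box (- real n) (real n))) = space lborel"
        using UN by simp
    qed (use rs cylinders_Pow sets_V' in \<open>auto simp: space_V\<close>)
    then show ?thesis by (simp add: space_V)
  qed
  have dens: "emeasure (density P (indicator F)) X = emeasure P (F \<inter> X)" if "X \<in> sets P" for X
    using that by (simp add: emeasure_density flip: indicator_inter_arith)
  have "density P (indicator F) = density P (\<lambda>_. ennreal m)"
  proof (rule measure_eqI_generator_eq_countable[where E = ?E and A = ?A and \<Omega> = "UNIV \<times> residue_seqs W"])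
    show "Int_stable ?E"
      unfolding Int_stable_def
    proof safe
      fix a b c d :: real and Y Z assume "Y \<in> cylinders W" "Z \<in> cylinders W"
      then have "Y \<inter> Z \<in> cylinders W"
        using Int_stable_cylinders by (auto simp: Int_stable_def)
      moreover have "box a b \<inter> box c d = box (max a c) (min b d)" by auto
      ultimately show "\<exists>X' Y'. box a b \<times> Y \<inter> box c d \<times> Z = X' \<times> Y' \<and> X' \<in> range (\<lambda>(a, b). box a b) \<and> Y' \<in> cylinders W"
        by (intro exI[of _ "box (max a c) (min b d)"] exI[of _ "Y \<inter> Z"]) auto
    qed
    show Pow: "?E \<subseteq> Pow (UNIV \<times> residue_seqs W)"
      using cylinders_Pow by auto
    show "sets (density P (indicator F)) = sigma_sets (UNIV \<times> residue_seqs W) ?E"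
      using sets_P Pow by (simp add: sets_measure_of)
    then show "sets (density P (\<lambda>_. ennreal m)) = sigma_sets (UNIV \<times> residue_seqs W) ?E"
      by simp
    show "emeasure (density P (indicator F)) X = emeasure (density P (\<lambda>_. ennreal m)) X" if "X \<in> ?E" for X
    proof -
      have X: "X \<in> sets P"
        unfolding sets_P sets_measure_of[OF Pow] using that by (rule sigma_sets.Basic)
      show ?thesis
        using *[OF that] X by (simp add: emeasure_density_const dens)
    qed
    show "?A \<subseteq> ?E" using rs by auto
    have "\<Union>?A = (\<Union>n::nat. box (- real n) (real n)) \<times> residue_seqs W" by blast
    then show "\<Union>?A = UNIV \<times> residue_seqs W" unfolding UN .
    show "emeasure (density P (indicator F)) a \<noteq> \<infinity>" if aA: "a \<in> ?A" for a
    proof -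
      obtain n :: nat where a: "a = {- real n<..<real n} \<times> cylinder W 0 0"
        using aA residue_seqs_cylinder by auto
      have "emeasure (density P (indicator F)) a = emeasure P (F \<inter> a)"
        unfolding a by (rule dens) measurable
      then show ?thesis
        using fin[of a] emeasure_box_cylinder[of "- real n" "real n" 0 0] by (simp add: a)
    qed
  qed auto
  then have eq: "emeasure P (F \<inter> X) = ennreal m * emeasure P X" if "X \<in> sets P" for X
    using dens[OF that] that by (simp add: emeasure_density_const)
  define B where "B = {0<..<1::real} \<times> cylinder W 0 0"
  have B: "emeasure P B = 1" "B \<in> sets P"
    using emeasure_box_cylinder[of 0 1 0 0] by (auto simp: B_def)
  have "emeasure P (F \<inter> B) = ennreal m"
    using eq[OF B(2)] B(1) by simp
  moreover have "emeasure P (F \<inter> (F \<inter> B)) = ennreal m * emeasure P (F \<inter> B)"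
    by (rule eq) (use B in auto)
  ultimately have "ennreal m = ennreal (m * m)"
    by (simp add: ennreal_mult m_def flip: Int_assoc)
  then have "m = m * m" by (simp add: m_def)
  then consider "m = 0" | "m = 1" by (metis mult_cancel_left1)
  then show ?thesis
  proof cases
    case 1
    then have "emeasure P F = 0" using eq[OF F] by simp
    then show ?thesis using F by (auto intro!: AE_not_in simp: null_sets_def)
  next
    case 2
    have "emeasure P (F \<inter> (space P - F)) = ennreal m * emeasure P (space P - F)"
      by (rule eq) measurable
    then have "emeasure P (space P - F) = 0" using 2 by simp
    then have "AE z in P. z \<notin> space P - F" by (intro AE_not_in) (auto simp: null_sets_def)
    then have "AE z in P. z \<in> F" using AE_space by eventually_elim auto
    then show ?thesis ..
  qed
qed

text \<open>\<open>F\<close> lies in its preimage \<open>C\<close>; their masses are compared in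
  unit strips, where both are finite and can be subtracted. The identity \<open>comm\<close> turns
  the periodicity of \<open>F\<close> into invariance of \<open>C\<close> under steps
  \<open>1 / M\<close>.\<close>

lemma ae_step_invariant_of_affine:
  assumes F [measurable]: "F \<in> sets P" and shift: "step_invariant 1 (\<lambda>_. 1) F"
    and M: "M \<ge> 1" "coprime M W" and \<sigma>: "coherent W \<sigma>"
    and sub: "\<And>z. z \<in> F \<Longrightarrow> affine_map M s \<sigma> z \<in> F"
  shows "ae_step_invariant M F"
proof -
  define C where "C = affine_map M s \<sigma> -` F \<inter> space P"
  have [measurable]: "C \<in> sets P"
    unfolding C_def using affine_map_measurable[OF \<sigma>] F by (rule measurable_sets)
  obtain u where u: "coherent W u" "\<And>k. [M * u k = 1] (mod W ^ k)"
    using coherent_inverse[OF M(2)] by metis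
  have M0: "real_of_int M > 0" using M by simp
  have comm: "affine_map M s \<sigma> (step M u j z) = step 1 (\<lambda>_. 1) j (affine_map M s \<sigma> z)" for j z
  proof (rule prod_eqI)
    have "(M * ((snd z k + j * u k) mod W ^ k) + \<sigma> k) mod W ^ k = ((M * snd z k + \<sigma> k) mod W ^ k + j) mod W ^ k" for k
    proof -
      have "[j * (M * u k) = j * 1] (mod W ^ k)" by (rule cong_scalar_left[OF u(2)])
      then have "[(M * snd z k + \<sigma> k) + j * (M * u k) = (M * snd z k + \<sigma> k) + j] (mod W ^ k)"
        by (intro cong_add) auto
      then have "(M * (snd z k + j * u k) + \<sigma> k) mod W ^ k = (M * snd z k + \<sigma> k + j) mod W ^ k"
        by (simp add: cong_def algebra_simps)
      then show ?thesis
        by (metis mod_add_left_eq mod_mult_right_eq)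
    qed
    then show "snd (affine_map M s \<sigma> (step M u j z)) = snd (step 1 (\<lambda>_. 1) j (affine_map M s \<sigma> z))"
      by (simp add: step_apply affine_map_def affine_seq_def)
  qed (use M0 in \<open>simp add: step_apply affine_map_def field_simps\<close>)
  have "step_invariant M u C"
    using shift step_in[OF u(1)] unfolding step_invariant_def C_def by (auto simp: comm)
  moreover have "AE z in P. z \<in> F \<longleftrightarrow> z \<in> C"
  proof -
    have FC: "F \<subseteq> C"
      using sub sets.sets_into_space[OF F] by (auto simp: C_def)
    have null: "emeasure P ((C - F) \<inter> strip t (t + 1)) = 0" for t
    proof -
      \<comment> \<open>The map sends the strip over \<open>[t, t + 1)\<close> onto the one over
        \<open>[T, T + M)\<close>, whose length is an integer, so periodicity of \<open>F\<close>
        gives its mass there.\<close>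
      define T where "T = of_int M * t + s"
      have "C \<inter> strip t (t + 1) = affine_map M s \<sigma> -` (F \<inter> strip T (T + of_int M)) \<inter> space P"
      proof -
        have "of_int M * x + s \<in> {T..<T + of_int M} \<longleftrightarrow> x \<in> {t..<t + 1}" for x
        proof -
          have "T \<le> of_int M * x + s \<longleftrightarrow> of_int M * t \<le> of_int M * x"
            by (simp only: T_def add_le_cancel_right)
          moreover have "of_int M * x + s < T + of_int M \<longleftrightarrow> of_int M * x < of_int M * (t + 1)"
            unfolding T_def distrib_left by argo
          ultimately show ?thesis
            by (simp only: atLeastLessThan_iff mult_le_cancel_left_pos[OF M0] mult_less_cancel_left_pos[OF M0])
        qed
        then show ?thesis
          using affine_seq_in[OF W \<sigma>]
          unfolding C_def strip_def affine_map_def space_P by auto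
      qed
      then have "ennreal (of_int M) * emeasure P (C \<inter> strip t (t + 1)) = emeasure P (F \<inter> strip T (T + of_int M))"
        using emeasure_affine_map[OF M \<sigma>, of "F \<inter> strip T (T + of_int M)" s] by simp
      also have "\<dots> = ennreal (of_int M) * emeasure P (F \<inter> strip 0 1)"
        using M(1) by (intro emeasure_invariant_strip[OF shift]) auto
      also have "emeasure P (F \<inter> strip 0 1) = emeasure P (F \<inter> strip t (t + 1))"
        using emeasure_invariant_strip[OF shift F, of 1 t] by simp
      finally have eq: "emeasure P (C \<inter> strip t (t + 1)) = emeasure P (F \<inter> strip t (t + 1))"
        using M0 by (simp add: ennreal_mult_cancel_left)
      have "emeasure P (F \<inter> strip t (t + 1)) \<le> 1"
        using emeasure_mono[of "F \<inter> strip t (t + 1)" "strip t (t + 1)" P] emeasure_strip[of t "t + 1"] by simp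
      then have "emeasure P (C \<inter> strip t (t + 1) - F \<inter> strip t (t + 1)) = 0"
        using FC eq by (subst emeasure_Diff) (auto simp: top_unique intro!: ennreal_diff_self)
      moreover have "C \<inter> strip t (t + 1) - F \<inter> strip t (t + 1) = (C - F) \<inter> strip t (t + 1)" by auto
      ultimately show ?thesis by simp
    qed
    have "C - F = (\<Union>n::int. (C - F) \<inter> strip (of_int n) (of_int n + 1))"
    proof -
      have "z \<in> strip (of_int \<lfloor>fst z\<rfloor>) (of_int \<lfloor>fst z\<rfloor> + 1)" if "z \<in> C" for z
        using that by (auto simp: C_def space_P strip_def mem_Times_iff)
      then show ?thesis by blast
    qed
    moreover have "(\<Union>n::int. (C - F) \<inter> strip (of_int n) (of_int n + 1)) \<in> null_sets P"
      using null by (intro null_sets_UN') (auto simp: null_sets_def)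
    ultimately have "AE z in P. z \<notin> C - F" using AE_not_in by metis
    then show ?thesis by eventually_elim (use FC in blast)
  qed
  ultimately show ?thesis
    using M u unfolding ae_step_invariant_def
    by (intro conjI exI[of _ u] exI[of _ C]) auto
qed

end

section \<open>Cassels' lemma\<close>

text \<open>A set is infinite iff it is contained in no finite set, and a countable index set has
  only countably many finite subsets.\<close>

lemma sets_infinite_many:
  assumes "countable U" and Q: "\<And>u. u \<in> U \<Longrightarrow> {x \<in> space M. Q u x} \<in> sets M"
  shows "{x \<in> space M. infinite {u \<in> U. Q u x}} \<in> sets M"
proof -
  let ?V = "{V. V \<subseteq> U \<and> finite V}"
  have "infinite {u \<in> U. Q u x} \<longleftrightarrow> (\<forall>V\<in>?V. \<exists>u\<in>U - V. Q u x)" for x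
  proof
    assume inf: "infinite {u \<in> U. Q u x}"
    show "\<forall>V\<in>?V. \<exists>u\<in>U - V. Q u x"
    proof
      fix V assume "V \<in> ?V"
      then have "\<not> {u \<in> U. Q u x} \<subseteq> V" using inf finite_subset by blast
      then show "\<exists>u\<in>U - V. Q u x" by blast
    qed
  next
    assume all: "\<forall>V\<in>?V. \<exists>u\<in>U - V. Q u x"
    show "infinite {u \<in> U. Q u x}"
    proof
      assume "finite {u \<in> U. Q u x}"
      then have "{u \<in> U. Q u x} \<in> ?V" by simp
      from bspec[OF all this] show False by blast
    qed
  qed
  moreover have "{x \<in> space M. \<forall>V\<in>?V. \<exists>u\<in>U - V. Q u x} \<in> sets M"
  proof (rule sets.sets_Collect_countable_All')
    show "countable ?V"
      using countable_Collect_finite_subset[OF assms(1)] by (simp add: conj_commute)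
    show "{x \<in> space M. \<exists>u\<in>U - V. Q u x} \<in> sets M" for V
      using assms(1) Q by (intro sets.sets_Collect_countable_Ex') auto
  qed
  ultimately show ?thesis by simp
qed

text \<open>
  Cassels' lemma: on the set where infinitely many dilated intervals, but only finitely many of the
  original ones, contain the point, a Vitali covering by dilated intervals covers at most the
  fraction \<open>1 - 1 / c\<close> of itself, so this set is null.
\<close>

lemma AE_infinite_shrunk_intervals:
  fixes a \<rho> :: "'u \<Rightarrow> real"
  assumes U: "countable U" and c: "c \<ge> 1" and \<rho>: "\<And>u. u \<in> U \<Longrightarrow> 0 < \<rho> u" "\<And>u. u \<in> U \<Longrightarrow> \<rho> u \<le> 1"
    and fin: "\<And>X e. e > 0 \<Longrightarrow> finite {u \<in> U. \<bar>a u\<bar> \<le> X \<and> e \<le> \<rho> u}"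
  shows "AE x in lborel. infinite {u \<in> U. \<bar>x - a u\<bar> \<le> c * \<rho> u} \<longrightarrow> infinite {u \<in> U. \<bar>x - a u\<bar> \<le> \<rho> u}"
proof -
  \<comment> \<open>\<open>V\<close> holds every index whose undilated interval may contain the
    point; the set to be shown null is the countable union of the \<open>D V\<close> over finite
    \<open>V\<close>.\<close>
  define D where "D V = {x. infinite {u \<in> U. \<bar>x - a u\<bar> \<le> c * \<rho> u} \<and> (\<forall>u\<in>U - V. \<bar>x - a u\<bar> > \<rho> u)}" for V
  have D_borel [measurable]: "D V \<in> sets borel" for V
  proof -
    have "{x. infinite {u \<in> U. \<bar>x - a u\<bar> \<le> c * \<rho> u}} \<in> sets borel"
      using sets_infinite_many[OF U, of borel "\<lambda>u x. \<bar>x - a u\<bar> \<le> c * \<rho> u"] by simp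
    moreover have "{x \<in> space borel. \<forall>u\<in>U - V. \<bar>x - a u\<bar> > \<rho> u} \<in> sets borel"
      using U by (intro sets.sets_Collect_countable_All') auto
    ultimately show ?thesis unfolding D_def by (simp add: Collect_conj_eq)
  qed
  have "emeasure lborel (D V \<inter> {-real n..real n}) = 0" if V: "finite V" for V n
  proof -
    define A where "A = D V \<inter> {-real n..real n}"
    have [measurable]: "A \<in> sets borel" by (simp add: A_def)
    have "emeasure lborel A \<le> emeasure lborel {-real n..real n}"
      by (rule emeasure_mono) (auto simp: A_def)
    then have Afin: "emeasure lborel A = ennreal (measure lborel A)"
      by (intro emeasure_eq_ennreal_measure) (auto simp: top_unique)
    have cover: "emeasure lborel A \<le> ennreal (1 - 1 / c) * emeasure lborel G" if G: "open G" "A \<subseteq> G" for G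
    proof -
      define K where "K = {u \<in> U - V. cball (a u) (c * \<rho> u) \<subseteq> G}"
      have cr: "0 < c * \<rho> u" if "u \<in> K" for u
        using that \<rho>(1)[of u] c by (auto simp: K_def)
      have fine: "\<exists>u. u \<in> K \<and> x \<in> cball (a u) (c * \<rho> u) \<and> c * \<rho> u < d" if x: "x \<in> A" "0 < d" for x d
      proof -
        obtain \<delta> where \<delta>: "\<delta> > 0" "ball x \<delta> \<subseteq> G"
          using G x open_contains_ball by blast
        \<comment> \<open>If \<open>\<rho> u < e\<close>, the dilated interval has radius below
          \<open>d\<close> and, once it contains \<open>x\<close>, stays inside
          \<open>ball x \<delta>\<close>.\<close>
        define e where "e = min d \<delta> / (3 * c)"
        have e: "e > 0" using c \<delta> x by (simp add: e_def)
        \<comment> \<open>A dilated interval containing \<open>x\<close> has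
          \<open>\<bar>a u\<bar> \<le> \<bar>x\<bar> + c\<close> because
          \<open>\<rho> u \<le> 1\<close>; so one that is not in this finite set must be
          short.\<close>
        have "finite (V \<union> {u \<in> U. \<bar>a u\<bar> \<le> \<bar>x\<bar> + c \<and> e \<le> \<rho> u})"
          using V fin[OF e] by auto
        moreover have "infinite {u \<in> U. \<bar>x - a u\<bar> \<le> c * \<rho> u}"
          using x by (auto simp: A_def D_def)
        ultimately have "\<not> {u \<in> U. \<bar>x - a u\<bar> \<le> c * \<rho> u} \<subseteq> V \<union> {u \<in> U. \<bar>a u\<bar> \<le> \<bar>x\<bar> + c \<and> e \<le> \<rho> u}"
          using finite_subset by blast
        then obtain u where u: "u \<in> U" "u \<notin> V" "\<bar>x - a u\<bar> \<le> c * \<rho> u" "\<not> (\<bar>a u\<bar> \<le> \<bar>x\<bar> + c \<and> e \<le> \<rho> u)"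
          by auto
        have "c * \<rho> u \<le> c" using c \<rho>(2)[OF u(1)] mult_left_le[of "\<rho> u" c] by simp
        then have "\<rho> u < e" using u(3,4) by linarith
        then have small: "3 * (c * \<rho> u) < min d \<delta>"
          using c by (simp add: e_def field_simps)
        have pos: "0 < c * \<rho> u" using c \<rho>(1)[OF u(1)] by simp
        have "cball (a u) (c * \<rho> u) \<subseteq> ball x \<delta>"
          using small u(3) pos by (auto simp: dist_real_def)
        then show ?thesis
          using u small pos \<delta> by (intro exI[of _ u]) (auto simp: K_def dist_real_def abs_minus_commute)
      qed
      obtain C where C: "countable C" "C \<subseteq> K"
        "pairwise (\<lambda>i j. disjnt (cball (a i) (c * \<rho> i)) (cball (a j) (c * \<rho> j))) C"
        "negligible (A - (\<Union>i\<in>C. cball (a i) (c * \<rho> i)))"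
        by (rule Vitali_covering_theorem_cballs[OF cr fine])
      have "(\<Union>i\<in>C. cball (a i) (c * \<rho> i)) \<in> sets borel"
        using C(1) by (intro sets.countable_UN') auto
      then have "A - (\<Union>i\<in>C. cball (a i) (c * \<rho> i)) \<in> null_sets lborel"
        using C(4) by (simp add: negligible_iff_null_sets null_sets_def emeasure_completion)
      then have "emeasure lborel A = emeasure lborel (A - (A - (\<Union>i\<in>C. cball (a i) (c * \<rho> i))))"
        by (simp add: emeasure_Diff_null_set)
      also have "A - (A - (\<Union>i\<in>C. cball (a i) (c * \<rho> i))) = (\<Union>i\<in>C. A \<inter> cball (a i) (c * \<rho> i))"
        by auto
      also have "emeasure lborel \<dots> = (\<integral>\<^sup>+i. emeasure lborel (A \<inter> cball (a i) (c * \<rho> i)) \<partial>count_space C)"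
        using C(1,3) by (intro emeasure_UN_countable) (auto simp: disjoint_family_on_def pairwise_def disjnt_def)
      also have "\<dots> \<le> (\<integral>\<^sup>+i. ennreal (1 - 1 / c) * emeasure lborel (cball (a i) (c * \<rho> i)) \<partial>count_space C)"
      proof (rule nn_integral_mono)
        fix i assume "i \<in> space (count_space C)"
        then have i: "i \<in> K" "i \<in> U" "i \<notin> V" using C(2) by (auto simp: K_def)
        have r: "0 < \<rho> i" "\<rho> i \<le> c * \<rho> i" using \<rho>(1)[OF i(2)] c by auto
        have "A \<inter> cball (a i) (c * \<rho> i) \<subseteq> cball (a i) (c * \<rho> i) - cball (a i) (\<rho> i)"
        proof
          fix x assume x: "x \<in> A \<inter> cball (a i) (c * \<rho> i)"
          then have "\<rho> i < \<bar>x - a i\<bar>" using i by (auto simp: A_def D_def)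
          then show "x \<in> cball (a i) (c * \<rho> i) - cball (a i) (\<rho> i)"
            using x by (simp add: dist_real_def abs_minus_commute)
        qed
        then have "emeasure lborel (A \<inter> cball (a i) (c * \<rho> i)) \<le> emeasure lborel (cball (a i) (c * \<rho> i) - cball (a i) (\<rho> i))"
          by (rule emeasure_mono) simp
        also have "\<dots> = emeasure lborel (cball (a i) (c * \<rho> i)) - emeasure lborel (cball (a i) (\<rho> i))"
          using r by (intro emeasure_Diff) (auto simp: cball_eq_atLeastAtMost)
        also have "\<dots> = ennreal (2 * (c * \<rho> i)) - ennreal (2 * \<rho> i)"
          using r by (simp add: cball_eq_atLeastAtMost)
        also have "\<dots> = ennreal (2 * (c * \<rho> i) - 2 * \<rho> i)"
          using r by (intro ennreal_minus) auto
        also have "2 * (c * \<rho> i) - 2 * \<rho> i = (1 - 1 / c) * (2 * (c * \<rho> i))"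
          using c by (simp add: field_simps)
        also have "ennreal \<dots> = ennreal (1 - 1 / c) * emeasure lborel (cball (a i) (c * \<rho> i))"
          using r c by (subst ennreal_mult) (auto simp: cball_eq_atLeastAtMost)
        finally show "emeasure lborel (A \<inter> cball (a i) (c * \<rho> i)) \<le> \<dots>" .
      qed
      also have "\<dots> = ennreal (1 - 1 / c) * (\<integral>\<^sup>+i. emeasure lborel (cball (a i) (c * \<rho> i)) \<partial>count_space C)"
        by (rule nn_integral_cmult) simp
      also have "(\<integral>\<^sup>+i. emeasure lborel (cball (a i) (c * \<rho> i)) \<partial>count_space C) = emeasure lborel (\<Union>i\<in>C. cball (a i) (c * \<rho> i))"
        using C(1,3) by (intro emeasure_UN_countable[symmetric]) (auto simp: disjoint_family_on_def pairwise_def disjnt_def)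
      also have "\<dots> \<le> emeasure lborel G"
        using C(2) G by (intro emeasure_mono) (auto simp: K_def)
      finally show ?thesis by (simp add: mult_left_mono)
    qed
    \<comment> \<open>Outer regularity replaces \<open>G\<close> by \<open>A\<close> up to
      \<open>e\<close>; when \<open>e\<close> tends to 0, the factor below 1 forces \<open>A\<close>
      to be null.\<close>
    have eps: "measure lborel A \<le> (1 - 1 / c) * (measure lborel A + e)" if e: "e > 0" for e
    proof -
      obtain G where G: "open G" "A \<subseteq> G" "emeasure lborel (G - A) < ennreal e"
        using outer_regular_lborel[OF _ e, of A] by auto
      have "emeasure lborel G = emeasure lborel A + emeasure lborel (G - A)"
        using plus_emeasure[of A lborel "G - A"] G(1,2) by (simp add: Un_absorb1)
      also have "\<dots> \<le> ennreal (measure lborel A) + ennreal e"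
        unfolding Afin using G(3) by (intro add_left_mono) simp
      also have "\<dots> = ennreal (measure lborel A + e)"
        using e by simp
      finally have "ennreal (1 - 1 / c) * emeasure lborel G \<le> ennreal (1 - 1 / c) * ennreal (measure lborel A + e)"
        by (rule mult_left_mono) simp
      then have "ennreal (measure lborel A) \<le> ennreal ((1 - 1 / c) * (measure lborel A + e))"
        using cover[OF G(1,2)] c e Afin
        by (subst ennreal_mult) (auto intro: order_trans)
      moreover have "0 \<le> (1 - 1 / c) * (measure lborel A + e)"
        using c e by (intro mult_nonneg_nonneg) auto
      ultimately show ?thesis by (simp only: ennreal_le_iff)
    qed
    have "measure lborel A \<le> (1 - 1 / c) * measure lborel A"
    proof (rule field_le_epsilon)
      fix e :: real assume e: "e > 0"
      have "(1 - 1 / c) * e \<le> 1 * e"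
        using c e by (intro mult_right_mono) auto
      then show "measure lborel A \<le> (1 - 1 / c) * measure lborel A + e"
        using eps[OF e] by (simp add: distrib_left)
    qed
    then have "measure lborel A / c \<le> 0" by (simp add: left_diff_distrib)
    then have "measure lborel A \<le> 0"
      using c by (simp add: divide_le_0_iff)
    then have "measure lborel A = 0" by (simp add: measure_le_0_iff)
    then show ?thesis using Afin by (simp add: A_def)
  qed
  then have "(\<Union>n::nat. D V \<inter> {-real n..real n}) \<in> null_sets lborel" if "finite V" for V
    using that by (intro null_sets_UN') (auto simp: null_sets_def)
  moreover have "(\<Union>n::nat. D V \<inter> {-real n..real n}) = D V" for V
  proof -
    have "\<exists>n::nat. x \<in> {-real n..real n}" for x :: real
    proof -
      obtain n :: nat where "\<bar>x\<bar> \<le> real n" using real_arch_simple by blast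
      then show ?thesis by (intro exI[of _ n]) (simp add: abs_le_iff)
    qed
    then show ?thesis by blast
  qed
  ultimately have null: "D V \<in> null_sets lborel" if "finite V" for V
    using that by metis
  have "countable {V. V \<subseteq> U \<and> finite V}"
    using countable_Collect_finite_subset[OF U] by (simp add: conj_commute)
  then have "AE x in lborel. \<forall>V\<in>{V. V \<subseteq> U \<and> finite V}. x \<notin> D V"
    using AE_not_in[OF null] by (subst AE_ball_countable) auto
  then show ?thesis
  proof eventually_elim
    case (elim x)
    show ?case
    proof (intro impI notI)
      assume inf: "infinite {u \<in> U. \<bar>x - a u\<bar> \<le> c * \<rho> u}" and fin: "finite {u \<in> U. \<bar>x - a u\<bar> \<le> \<rho> u}"
      then have "x \<in> D {u \<in> U. \<bar>x - a u\<bar> \<le> \<rho> u}"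
        unfolding D_def by (simp add: not_le)
      then show False using elim fin by auto
    qed
  qed
qed

section \<open>The zero-one law for limsup sets of boxes\<close>

lemma coprime_int_by_primes:
  fixes a b :: int
  assumes "a \<noteq> 0 \<or> b \<noteq> 0" "\<And>q. prime q \<Longrightarrow> q dvd a \<Longrightarrow> q dvd b \<Longrightarrow> False"
  shows "coprime a b"
proof (rule ccontr)
  assume "\<not> coprime a b"
  then have "\<not> is_unit (gcd a b)" by (simp only: is_unit_gcd not_False_eq_True)
  moreover have "gcd a b \<noteq> 0" using assms(1) by simp
  ultimately obtain q where "prime q" "q dvd gcd a b"
    using prime_divisor_exists by metis
  then show False using assms(2)[of q] by simp
qed

text \<open>A common prime factor \<open>l\<close> would divide the first summand but not
  \<open>n div l\<close>, as \<open>l\<close> divides \<open>n\<close> only once; any other common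
  prime divides \<open>n div l\<close> and hence \<open>b\<close>.\<close>

lemma coprime_power_mult_add:
  fixes l b n :: int
  assumes l: "prime l" and n: "n \<noteq> 0" "l dvd n" "\<not> l\<^sup>2 dvd n" and b: "coprime b n" and k: "k \<ge> 1"
  shows "coprime (l ^ k * b + n div l) n"
proof (rule coprime_int_by_primes)
  fix q assume q: "prime q" "q dvd l ^ k * b + n div l" "q dvd n"
  obtain n' where n': "n = l * n'" using n(2) by auto
  have nl: "n div l = n'" using n' l by auto
  have ln': "\<not> l dvd n'" using n(3) by (auto simp: n' power2_eq_square)
  show False
  proof (cases "q = l")
    case True
    have "q dvd l ^ k * b" using k True by (simp add: dvd_power)
    then have "q dvd n'" using q(2) nl by (simp add: dvd_add_right_iff)
    then show False using ln' True by simp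
  next
    case False
    then have ql: "\<not> q dvd l" using q(1) l primes_dvd_imp_eq by blast
    then have "q dvd n'" using q(1,3) by (simp add: n' prime_dvd_mult_iff)
    then have "q dvd l ^ k * b" using q(2) unfolding nl by (simp only: dvd_add_left_iff)
    then have "q dvd b" using q(1) ql prime_dvd_power[OF q(1), of l k] by (simp only: prime_dvd_mult_iff) blast
    then have "is_unit q" using b q(3) coprime_common_divisor by blast
    then show False using q(1) not_prime_unit by blast
  qed
qed (use n in auto)

text \<open>When \<open>l\<^sup>2\<close> divides \<open>n\<close>, \<open>n div l\<close> keeps
  every prime factor of \<open>n\<close>, so adding its multiples preserves coprimality. The value
  \<open>l = 1\<close> gives the integer translations.\<close>

lemma coprime_add_mult_div:
  fixes l b n :: int
  assumes l: "l \<noteq> 0" and n: "n \<noteq> 0" "l\<^sup>2 dvd n" and b: "coprime b n"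
  shows "coprime (b + j * (n div l)) n"
proof (rule coprime_int_by_primes)
  fix q assume q: "prime q" "q dvd b + j * (n div l)" "q dvd n"
  obtain n' where n': "n = l\<^sup>2 * n'" using n(2) by auto
  have nl: "n div l = l * n'" using n' l by (simp add: power2_eq_square mult.assoc)
  have "q dvd l * n'" using q(1,3) unfolding n' power2_eq_square prime_dvd_mult_iff[OF q(1)] by blast
  then have "q dvd j * (n div l)" unfolding nl by (rule dvd_mult)
  then have "q dvd b" using q(2) by (simp only: dvd_add_left_iff)
  then have "is_unit q" using b q(3) coprime_common_divisor by blast
  then show False using q(1) not_prime_unit by blast
qed (use n in auto)

text \<open>
  An index \<open>i\<close> plays the role of \<open>\<gamma>\<close>: \<open>N i\<close> is its integral part, \<open>r i\<close> the real radius of the boxes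
  around the points \<open>b / N i\<close>, and \<open>R i\<close> the group of integers that are small enough at every finite place,
  a condition which depends only on residues modulo \<open>W ^ K i\<close>. The last assumption makes the real radii tend
  to \<open>0\<close> on almost every fibre, as Cassels' lemma requires; it can fail at points with a rational finite coordinate.
\<close>

locale target_system = residue_measure W V for W :: int and V :: "(nat \<Rightarrow> int) measure" +
  fixes I :: "'i set" and N :: "'i \<Rightarrow> int" and K :: "'i \<Rightarrow> nat" and R :: "'i \<Rightarrow> int set"
    and r :: "'i \<Rightarrow> real" and Bad :: "(nat \<Rightarrow> int) set"
  assumes countable_I: "countable I"
    and N_pos: "\<And>i. i \<in> I \<Longrightarrow> N i \<ge> 1"
    and R_add: "\<And>i a b. i \<in> I \<Longrightarrow> a \<in> R i \<Longrightarrow> b \<in> R i \<Longrightarrow> a + b \<in> R i"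
    and R_mult: "\<And>i a c. i \<in> I \<Longrightarrow> a \<in> R i \<Longrightarrow> c * a \<in> R i"
    and R_modulus: "\<And>i. i \<in> I \<Longrightarrow> W ^ K i \<in> R i"
    and r_pos: "\<And>i. i \<in> I \<Longrightarrow> 0 < r i" and r_le: "\<And>i. i \<in> I \<Longrightarrow> r i \<le> 1"
    and Bad_null: "Bad \<in> null_sets V"
    and finite_large: "\<And>\<omega> (e :: real) (X :: real). \<omega> \<in> residue_seqs W - Bad \<Longrightarrow> 0 < e \<Longrightarrow>
      finite {(b, i). i \<in> I \<and> \<bar>of_int b\<bar> \<le> X * of_int (N i) \<and> e \<le> r i \<and> N i * \<omega> (K i) - b \<in> R i}"
begin

text \<open>Only the real radius carries the dilation factor: multiplication by a prime not dividing
  \<open>W\<close> is an isometry at the finite places.\<close>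

definition hit :: "real \<Rightarrow> real \<times> (nat \<Rightarrow> int) \<Rightarrow> int \<Rightarrow> 'i \<Rightarrow> bool" where
  "hit c z b i \<longleftrightarrow> coprime b (N i) \<and> \<bar>fst z - of_int b / of_int (N i)\<bar> \<le> c * r i \<and> N i * snd z (K i) - b \<in> R i"

definition hits :: "real \<Rightarrow> 'i set \<Rightarrow> (real \<times> (nat \<Rightarrow> int)) set" where
  "hits c J = {z \<in> space P. infinite {(b, i). i \<in> J \<and> hit c z b i}}"

lemma R_cong: "i \<in> I \<Longrightarrow> a \<in> R i \<Longrightarrow> [a = b] (mod W ^ K i) \<Longrightarrow> b \<in> R i"
proof -
  assume i: "i \<in> I" and a: "a \<in> R i" and "[a = b] (mod W ^ K i)"
  then obtain t where "b = a + W ^ K i * t"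
    by (metis cong_iff_lin)
  then show "b \<in> R i"
    using R_add[OF i a R_mult[OF i R_modulus[OF i], of t]] by (simp add: mult.commute)
qed

lemma hits_measurable [measurable]:
  assumes "J \<subseteq> I" shows "hits c J \<in> sets P"
proof -
  have "{z \<in> space P. hit c z b i} \<in> sets P" for b i
  proof -
    have "fst -` {x. \<bar>x - of_int b / of_int (N i)\<bar> \<le> c * r i} \<inter> space P \<in> sets P"
      by (rule measurable_sets[OF measurable_fst]) measurable
    moreover have "snd -` {\<omega> \<in> residue_seqs W. N i * \<omega> (K i) - b \<in> R i} \<inter> space P \<in> sets P"
      by (rule measurable_sets[OF measurable_snd]) (rule component_set_measurable)
    ultimately have "(fst -` {x. \<bar>x - of_int b / of_int (N i)\<bar> \<le> c * r i} \<inter> space P) \<inter>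
        (snd -` {\<omega> \<in> residue_seqs W. N i * \<omega> (K i) - b \<in> R i} \<inter> space P) \<in> sets P"
      by (rule sets.Int)
    then have "{z \<in> space P. \<bar>fst z - of_int b / of_int (N i)\<bar> \<le> c * r i \<and> N i * snd z (K i) - b \<in> R i} \<in> sets P"
      by (rule back_subst[where P = "\<lambda>X. X \<in> sets P"]) (auto simp: space_P)
    then show ?thesis
      by (cases "coprime b (N i)") (simp_all add: hit_def)
  qed
  moreover have "countable (UNIV \<times> J :: (int \<times> 'i) set)"
    using countable_I assms by (auto intro: countable_subset)
  ultimately have "{z \<in> space P. infinite {u \<in> UNIV \<times> J. hit c z (fst u) (snd u)}} \<in> sets P"
    by (intro sets_infinite_many) auto
  moreover have "{u \<in> UNIV \<times> J. hit c z (fst u) (snd u)} = {(b, i). i \<in> J \<and> hit c z b i}" for z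
    by auto
  ultimately show ?thesis by (simp add: hits_def)
qed

lemma hits_mono: "J \<subseteq> J' \<Longrightarrow> hits c J \<subseteq> hits c J'"
proof
  fix z assume J: "J \<subseteq> J'" and z: "z \<in> hits c J"
  have "{(b, i). i \<in> J \<and> hit c z b i} \<subseteq> {(b, i). i \<in> J' \<and> hit c z b i}"
    using J by auto
  then show "z \<in> hits c J'"
    using z finite_subset unfolding hits_def by blast
qed

lemma hits_mapI:
  assumes z: "z \<in> hits c J" and z': "z' \<in> space P" and inj: "\<And>i. i \<in> J \<Longrightarrow> inj (g i)"
    and hit: "\<And>b i. i \<in> J \<Longrightarrow> hit c z b i \<Longrightarrow> hit c' z' (g i b) i"
  shows "z' \<in> hits c' J"
proof -
  let ?f = "\<lambda>(b, i). (g i b, i)"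
  have "inj_on ?f {(b, i). i \<in> J \<and> hit c z b i}"
    using inj by (auto simp: inj_on_def inj_def)
  then have "infinite (?f ` {(b, i). i \<in> J \<and> hit c z b i})"
    using z by (simp add: hits_def finite_image_iff)
  moreover have "?f ` {(b, i). i \<in> J \<and> hit c z b i} \<subseteq> {(b, i). i \<in> J \<and> hit c' z' b i}"
    using hit by auto
  ultimately show ?thesis
    using z' finite_subset unfolding hits_def by blast
qed

text \<open>\<open>M * b + e * (N i div l)\<close> is the numerator over \<open>N i\<close> of
  \<open>M * (b / N i) + e / l\<close>, and at the finite places \<open>v\<close> is
  \<open>1 / l\<close>. All cases are instances: \<open>e = 0\<close> for pure dilations,
  \<open>M = 1\<close> for translations, \<open>l = 1\<close> for integer shifts.\<close>

lemma hits_affine: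
  assumes J: "J \<subseteq> I" and l: "l \<ge> 1" and v: "coherent W v" "\<And>k. [l * v k = 1] (mod W ^ k)" and M: "M \<ge> 1"
    and e: "\<And>i. i \<in> J \<Longrightarrow> e = 0 \<or> l dvd N i"
    and cop: "\<And>i b. i \<in> J \<Longrightarrow> coprime b (N i) \<Longrightarrow> coprime (M * b + e * (N i div l)) (N i)"
    and z: "z \<in> hits c J"
  shows "affine_map M (of_int e / of_int l) (\<lambda>k. e * v k) z \<in> hits (of_int M * c) J"
proof (rule hits_mapI[OF z, where g = "\<lambda>i b. M * b + e * (N i div l)"])
  show "affine_map M (of_int e / of_int l) (\<lambda>k. e * v k) z \<in> space P"
    using z measurable_space[OF affine_map_measurable[OF coherent_mult[OF v(1)]]] by (simp add: hits_def)
  show "inj (\<lambda>b. M * b + e * (N i div l))" for i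
    using M by (auto simp: inj_def)
next
  fix b i assume i: "i \<in> J" and hit: "hit c z b i"
  have iI: "i \<in> I" using i J by auto
  let ?z = "affine_map M (of_int e / of_int l) (\<lambda>k. e * v k) z"
  \<comment> \<open>\<open>t\<close> is \<open>e * N i / l\<close>; for \<open>e = 0\<close> it is 0
    even when the integer division is inexact.\<close>
  obtain t where t: "e * (N i div l) = t" "e * N i = l * t"
  proof (cases "e = 0")
    case False
    then have "l * (N i div l) = N i" using e[OF i] by simp
    then show ?thesis using that[of "e * (N i div l)"] by (metis mult.left_commute)
  qed (use that[of 0] in simp)
  have N0: "real_of_int (N i) > 0" using N_pos[OF iI] by simp
  have tl: "real_of_int e / of_int l = of_int t / of_int (N i)"
    using t(2) l N0 by (simp add: field_simps flip: of_int_mult)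
  have "\<bar>of_int M * fst z + of_int e / of_int l - of_int (M * b + t) / of_int (N i)\<bar>
      = of_int M * \<bar>fst z - of_int b / of_int (N i)\<bar>"
  proof -
    have "of_int M * fst z + of_int e / of_int l - of_int (M * b + t) / of_int (N i)
        = of_int M * (fst z - of_int b / of_int (N i))"
      by (simp add: tl add_divide_distrib right_diff_distrib)
    then show ?thesis using M by (simp add: abs_mult)
  qed
  also have "\<dots> \<le> of_int M * c * r i"
    using hit M by (simp add: hit_def mult.assoc)
  finally have 1: "\<bar>of_int M * fst z + of_int e / of_int l - of_int (M * b + t) / of_int (N i)\<bar> \<le> of_int M * c * r i" .
  have "N i * (e * v (K i)) = e * N i * v (K i)" by (simp only: ac_simps)
  also have "\<dots> = t * (l * v (K i))" unfolding t(2) by (simp only: ac_simps)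
  also have "[t * (l * v (K i)) = t * 1] (mod W ^ K i)" by (rule cong_scalar_left[OF v(2)])
  finally have "[t = N i * (e * v (K i))] (mod W ^ K i)" by (simp add: cong_sym)
  \<comment> \<open>The old residue condition times \<open>M\<close> differs from the new one by a
    multiple of \<open>W ^ K i\<close>, which lies in \<open>R i\<close>.\<close>
  then have "[M * (N i * snd z (K i) - b) + t - t = M * (N i * snd z (K i) - b) + N i * (e * v (K i)) - t] (mod W ^ K i)"
    by (intro cong_add cong_diff cong_refl)
  also have "M * (N i * snd z (K i) - b) + N i * (e * v (K i)) - t = N i * (M * snd z (K i) + e * v (K i)) - (M * b + t)"
    by (simp add: algebra_simps)
  finally have "[M * (N i * snd z (K i) - b) + t - t = N i * (M * snd z (K i) + e * v (K i)) - (M * b + t)] (mod W ^ K i)" .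
  moreover have "[N i * (M * snd z (K i) + e * v (K i)) - (M * b + t)
      = N i * ((M * snd z (K i) + e * v (K i)) mod W ^ K i) - (M * b + t)] (mod W ^ K i)"
    by (intro cong_diff cong_mult cong_refl) (simp add: cong_def)
  moreover have "M * (N i * snd z (K i) - b) + t - t \<in> R i"
    using hit R_mult[OF iI] by (simp add: hit_def)
  ultimately have 2: "N i * ((M * snd z (K i) + e * v (K i)) mod W ^ K i) - (M * b + t) \<in> R i"
    using R_cong[OF iI] by blast
  show "hit (of_int M * c) ?z (M * b + e * (N i div l)) i"
    using 1 2 hit cop[OF i, of b] unfolding hit_def affine_map_def affine_seq_def t(1) fst_conv snd_conv
    by blast
qed

lemma hits_shift_invariant:
  assumes "J \<subseteq> I" shows "step_invariant 1 (\<lambda>_. 1) (hits c J)"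
  unfolding step_invariant_def step_def
proof (intro allI ballI)
  fix j z assume z: "z \<in> hits c J"
  have "affine_map 1 (of_int j / of_int 1) (\<lambda>k. j * 1) z \<in> hits (of_int 1 * c) J"
  proof (rule hits_affine[OF assms, where v = "\<lambda>_. 1" and l = 1 and M = 1])
    fix i b assume "i \<in> J" "coprime b (N i)"
    then show "coprime (1 * b + j * (N i div 1)) (N i)"
      using coprime_add_mult_div[of 1 "N i" b j] N_pos[of i] assms by auto
  qed (use z in simp_all)
  then show "affine_map 1 (of_int j / of_int 1) (\<lambda>k. j * 1) z \<in> hits c J" by simp
qed

text \<open>Over a fixed \<open>\<omega>\<close> the coprimality and residue conditions do not
  involve the real coordinate, so they merely select the index set for Cassels' lemma; Fubini then
  discards \<open>Bad\<close>.\<close>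

lemma AE_hits_dilate:
  assumes J: "J \<subseteq> I" and c: "c \<ge> 1"
  shows "AE z in P. z \<in> hits c J \<longleftrightarrow> z \<in> hits 1 J"
proof -
  interpret pair_sigma_finite lborel V ..
  define E where "E = hits c J - hits 1 J"
  have [measurable]: "E \<in> sets P" unfolding E_def using J by measurable
  have fibre: "emeasure lborel ((\<lambda>x. (x, \<omega>)) -` E) = 0" if \<omega>: "\<omega> \<in> residue_seqs W - Bad" for \<omega>
  proof -
    let ?U = "{(b, i). i \<in> J \<and> coprime b (N i) \<and> N i * \<omega> (K i) - b \<in> R i}"
    let ?a = "\<lambda>(b, i). of_int b / of_int (N i) :: real"
    let ?r = "\<lambda>(b :: int, i). r i"
    have "AE x in lborel. infinite {u \<in> ?U. \<bar>x - ?a u\<bar> \<le> c * ?r u} \<longrightarrow> infinite {u \<in> ?U. \<bar>x - ?a u\<bar> \<le> ?r u}"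
    proof (rule AE_infinite_shrunk_intervals[OF _ c])
      have "countable (UNIV \<times> I :: (int \<times> 'i) set)" using countable_I by auto
      then show "countable ?U" by (rule countable_subset[rotated]) (use J in auto)
      show "0 < ?r u" "?r u \<le> 1" if "u \<in> ?U" for u
        using that J r_pos r_le by auto
      show "finite {u \<in> ?U. \<bar>?a u\<bar> \<le> X \<and> e \<le> ?r u}" if "e > 0" for X e
      proof (rule finite_subset[OF _ finite_large[OF \<omega> that, of X]])
        have "\<bar>of_int b\<bar> \<le> X * of_int (N i)" if "i \<in> J" "\<bar>of_int b / of_int (N i)\<bar> \<le> X" for b i
          using that N_pos[of i] J by (auto simp: abs_divide pos_divide_le_eq)
        then show "{u \<in> ?U. \<bar>?a u\<bar> \<le> X \<and> e \<le> ?r u} \<subseteq> {(b, i). i \<in> I \<and> \<bar>of_int b\<bar> \<le> X * of_int (N i) \<and> e \<le> r i \<and> N i * \<omega> (K i) - b \<in> R i}"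
          using J by auto
      qed
    qed
    then have "AE x in lborel. x \<notin> (\<lambda>x. (x, \<omega>)) -` E"
    proof eventually_elim
      case (elim x)
      have hit: "{(b, i). i \<in> J \<and> hit c' (x, \<omega>) b i} = {u \<in> ?U. \<bar>x - ?a u\<bar> \<le> c' * ?r u}" for c'
        by (auto simp: hit_def)
      show ?case
        using elim by (simp only: E_def hits_def hit mult_1 Diff_iff mem_Collect_eq vimage_eq) blast
    qed
    moreover have "(\<lambda>x. (x, \<omega>)) -` E \<in> sets lborel"
      by (rule sets_Pair2) measurable
    ultimately have "(\<lambda>x. (x, \<omega>)) -` E \<in> null_sets lborel"
      by (simp only: AE_iff_null_sets)
    then show ?thesis by (rule null_setsD1)
  qed
  have "emeasure P E = (\<integral>\<^sup>+\<omega>. emeasure lborel ((\<lambda>x. (x, \<omega>)) -` E) \<partial>V)"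
    by (rule emeasure_pair_measure_alt2) measurable
  also have "\<dots> = (\<integral>\<^sup>+\<omega>. 0 \<partial>V)"
  proof (rule nn_integral_cong_AE)
    show "AE \<omega> in V. emeasure lborel ((\<lambda>x. (x, \<omega>)) -` E) = 0"
      using AE_not_in[OF Bad_null] AE_space by eventually_elim (simp add: fibre space_V)
  qed
  finally have "E \<in> null_sets P" by (simp add: null_sets_def)
  then have nE: "AE z in P. z \<notin> E" by (rule AE_not_in)
  have sub: "hits 1 J \<subseteq> hits c J"
  proof
    fix z assume z: "z \<in> hits 1 J"
    show "z \<in> hits c J"
    proof (rule hits_mapI[OF z, where g = "\<lambda>_ b. b"])
      fix b i assume "i \<in> J" "hit 1 z b i"
      moreover from this have "1 * r i \<le> c * r i"
        using J c r_pos[of i] by (intro mult_right_mono) auto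
      ultimately show "hit c z b i" by (auto simp: hit_def)
    qed (use z in \<open>auto simp: hits_def\<close>)
  qed
  show ?thesis
    using nE by eventually_elim (use sub in \<open>auto simp: E_def\<close>)
qed

lemma hits_zero_one_of_dilation:
  assumes J: "J \<subseteq> I" and l: "prime l" "coprime l W"
    and e: "\<And>i. i \<in> J \<Longrightarrow> e = 0 \<or> l dvd N i"
    and cop: "\<And>i b k. i \<in> J \<Longrightarrow> coprime b (N i) \<Longrightarrow> k \<ge> 1 \<Longrightarrow> coprime (l ^ k * b + e * (N i div l)) (N i)"
  shows "(AE z in P. z \<notin> hits 1 J) \<or> (AE z in P. z \<in> hits 1 J)"
proof -
  have l1: "l > 1" using l(1) by (rule prime_gt_1_int)
  obtain v where v: "coherent W v" "\<And>k. [l * v k = 1] (mod W ^ k)"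
    using coherent_inverse[OF l(2)] by metis
  \<comment> \<open>\<open>hits 1 J\<close> need not be mapped into itself, since each dilation
    enlarges the radius; the union over all powers of \<open>l\<close> is, and differs from it by a
    null set.\<close>
  define F where "F = (\<Union>n::nat. hits (of_int l ^ n) J)"
  have F: "F \<in> sets P" unfolding F_def using J by measurable
  have "(AE z in P. z \<notin> F) \<or> (AE z in P. z \<in> F)"
  proof (rule zero_one_of_invariance[OF F])
    fix n :: int
    define k where "k = nat \<bar>n\<bar> + 1"
    then have k: "k \<ge> 1" "n < int k" by simp_all
    have "n < l ^ k"
    proof -
      note k(2)
      also have "int k < 2 ^ k" using of_nat_less_two_power[of k] by simp
      also have "(2::int) ^ k \<le> l ^ k" using l1 by (intro power_mono) auto
      finally show ?thesis .
    qed
    moreover have "ae_step_invariant (l ^ k) F"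
    proof (rule ae_step_invariant_of_affine[OF F])
      show "step_invariant 1 (\<lambda>_. 1) F"
        using hits_shift_invariant[OF J] unfolding step_invariant_def F_def by blast
      show "1 \<le> l ^ k" using l1 by simp
      show "coprime (l ^ k) W" using l(2) by simp
      show "coherent W (\<lambda>k. e * v k)" using v(1) by (rule coherent_mult)
      fix z assume "z \<in> F"
      then obtain n where "z \<in> hits (of_int l ^ n) J" by (auto simp: F_def)
      then have "affine_map (l ^ k) (of_int e / of_int l) (\<lambda>k. e * v k) z \<in> hits (of_int (l ^ k) * of_int l ^ n) J"
        using l1 cop e k(1) by (intro hits_affine[OF J _ v]) auto
      then show "affine_map (l ^ k) (of_int e / of_int l) (\<lambda>k. e * v k) z \<in> F"
        unfolding F_def by (intro UN_I[of "k + n"]) (auto simp: power_add)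
    qed
    ultimately show "\<exists>M\<ge>n. ae_step_invariant M F" using less_imp_le by blast
  qed
  moreover have "AE z in P. z \<in> F \<longleftrightarrow> z \<in> hits 1 J"
  proof -
    have "AE z in P. \<forall>n::nat. z \<in> hits (of_int l ^ n) J \<longleftrightarrow> z \<in> hits 1 J"
      unfolding AE_all_countable using l1 by (intro allI AE_hits_dilate[OF J]) simp
    then show ?thesis by eventually_elim (auto simp: F_def)
  qed
  ultimately show ?thesis
  proof (elim disjE)
    assume "AE z in P. z \<notin> F" "AE z in P. z \<in> F \<longleftrightarrow> z \<in> hits 1 J"
    then have "AE z in P. z \<notin> hits 1 J" by eventually_elim simp
    then show ?thesis ..
  next
    assume "AE z in P. z \<in> F" "AE z in P. z \<in> F \<longleftrightarrow> z \<in> hits 1 J"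
    then have "AE z in P. z \<in> hits 1 J" by eventually_elim simp
    then show ?thesis ..
  qed
qed

theorem hits_zero_one: "(AE z in P. z \<notin> hits 1 I) \<or> (AE z in P. z \<in> hits 1 I)"
proof -
  define A where "A l = {i \<in> I. \<not> l dvd N i}" for l
  define B where "B l = {i \<in> I. l dvd N i \<and> \<not> l\<^sup>2 dvd N i}" for l
  define C where "C l = {i \<in> I. l\<^sup>2 dvd N i}" for l
  have sub: "A l \<subseteq> I" "B l \<subseteq> I" "C l \<subseteq> I" for l by (auto simp: A_def B_def C_def)
  have N0: "i \<in> I \<Longrightarrow> N i \<noteq> 0" for i using N_pos[of i] by auto
  have A: "(AE z in P. z \<notin> hits 1 (A l)) \<or> (AE z in P. z \<in> hits 1 (A l))" if "prime l" "coprime l W" for l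
  proof (rule hits_zero_one_of_dilation[OF sub(1) that, where e = 0])
    show "coprime (l ^ k * b + 0 * (N i div l)) (N i)" if "i \<in> A l" "coprime b (N i)" for i b k
      using that \<open>prime l\<close> by (auto simp: A_def prime_imp_coprime)
  qed auto
  have B: "(AE z in P. z \<notin> hits 1 (B l)) \<or> (AE z in P. z \<in> hits 1 (B l))" if "prime l" "coprime l W" for l
  proof (rule hits_zero_one_of_dilation[OF sub(2) that, where e = 1])
    show "coprime (l ^ k * b + 1 * (N i div l)) (N i)" if "i \<in> B l" "coprime b (N i)" "k \<ge> 1" for i b k
      using coprime_power_mult_add[OF \<open>prime l\<close>, of "N i" b k] that N0[of i] by (auto simp: B_def)
  qed (auto simp: B_def)
  show ?thesis
  \<comment> \<open>Enlarging the index set enlarges \<open>hits\<close>, so one conull piece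
    settles the claim; otherwise the dichotomies make \<open>hits 1 (A l)\<close> and
    \<open>hits 1 (B l)\<close> null for every admissible \<open>l\<close>.\<close>
  proof (cases "\<exists>l. prime l \<and> coprime l W \<and> ((AE z in P. z \<in> hits 1 (A l)) \<or> (AE z in P. z \<in> hits 1 (B l)))")
    case True
    then obtain J where "J \<subseteq> I" "AE z in P. z \<in> hits 1 J" using sub by blast
    from this(2) have "AE z in P. z \<in> hits 1 I"
      by eventually_elim (use hits_mono[OF \<open>J \<subseteq> I\<close>] in blast)
    then show ?thesis ..
  next
    case False
    show ?thesis
    proof (rule zero_one_of_invariance)
      show "hits 1 I \<in> sets P" by simp
      fix n :: int
      \<comment> \<open>A prime above \<open>W\<close> cannot divide it, and being above
        \<open>n\<close> it supplies the arbitrarily large \<open>M\<close> of the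
        criterion.\<close>
      obtain p :: nat where p: "prime p" "p > nat (max n W)" using bigger_prime by blast
      define l where "l = int p"
      have l: "prime l" "l > n" "l > W" using p by (auto simp: l_def)
      have "\<not> l dvd W" using l(3) W zdvd_not_zless[of W l] by auto
      then have cop: "coprime l W" using l(1) by (rule prime_imp_coprime[rotated])
      have l1: "l > 1" using l(1) by (rule prime_gt_1_int)
      obtain v where v: "coherent W v" "\<And>k. [l * v k = 1] (mod W ^ k)"
        using coherent_inverse[OF cop] by metis
      have "step_invariant l v (hits 1 (C l))"
        unfolding step_invariant_def step_def
      proof (intro allI ballI)
        fix j z assume "z \<in> hits 1 (C l)"
        then have "affine_map 1 (of_int j / of_int l) (\<lambda>k. j * v k) z \<in> hits (of_int 1 * 1) (C l)"
          using l1 N0 coprime_add_mult_div[of l]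
          by (intro hits_affine[OF sub(3) _ v]) (auto simp: C_def power2_eq_square)
        then show "affine_map 1 (of_int j / of_int l) (\<lambda>k. j * v k) z \<in> hits 1 (C l)" by simp
      qed
      moreover have "AE z in P. z \<in> hits 1 I \<longleftrightarrow> z \<in> hits 1 (C l)"
      proof -
        have "AE z in P. z \<notin> hits 1 (A l)" "AE z in P. z \<notin> hits 1 (B l)"
          using False A[OF l(1) cop] B[OF l(1) cop] l(1) cop by blast+
        then show ?thesis
        proof eventually_elim
          case (elim z)
          have "{(b, i). i \<in> I \<and> hit 1 z b i} = {(b, i). i \<in> A l \<and> hit 1 z b i} \<union>
              {(b, i). i \<in> B l \<and> hit 1 z b i} \<union> {(b, i). i \<in> C l \<and> hit 1 z b i}"
            by (auto simp: A_def B_def C_def)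
          then show ?case using elim by (auto simp: hits_def)
        qed
      qed
      ultimately have "ae_step_invariant l (hits 1 I)"
        using l1 cop v sub(3) unfolding ae_step_invariant_def
        by (intro conjI exI[of _ v] exI[of _ "hits 1 (C l)"]) auto
      then show "\<exists>M\<ge>n. ae_step_invariant M (hits 1 I)"
        using l(2) less_imp_le by blast
    qed
  qed
qed

end

section \<open>Balls and Haar measure in the $p$-adic numbers\<close>

lemma power_int_le_iff_prime:
  fixes p :: nat assumes "prime p"
  shows "real p powi a \<le> real p powi b \<longleftrightarrow> a \<le> b"
  using power_int_strict_increasing[of b a "real p"] power_int_increasing[of a b "real p"] prime_gt_1_nat[OF assms]
  by (cases "a \<le> b") auto

lemma padic_abs_of_int:
  assumes "prime p" "t \<noteq> 0"
  shows "padic_abs p (of_int t) = real p powi (- int (multiplicity (int p) t))"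
  using padic_abs_Fract[of p t 1] assms by simp

lemma padic_abs_of_int_le_iff:
  assumes "prime p"
  shows "padic_abs p (of_int t) \<le> 1 / real p ^ k \<longleftrightarrow> int p ^ k dvd t"
proof (cases "t = 0")
  case False
  have "1 / real p ^ k = real p powi (- int k)"
    by (simp add: power_int_minus divide_inverse)
  then have "padic_abs p (of_int t) \<le> 1 / real p ^ k \<longleftrightarrow> k \<le> multiplicity (int p) t"
    using False assms by (simp add: padic_abs_of_int power_int_le_iff_prime)
  also have "\<dots> \<longleftrightarrow> int p ^ k dvd t"
    using False assms by (intro power_dvd_iff_le_multiplicity[symmetric]) (auto simp: prime_gt_1_nat)
  finally show ?thesis .
qed simp

lemma padic_abs_of_int_le_1: "prime p \<Longrightarrow> padic_abs p (of_int t) \<le> 1"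
  using padic_abs_of_int_le_iff[of p t 0] by simp

lemma padic_abs_of_int_coprime:
  assumes "prime p" "coprime t (int p)"
  shows "padic_abs p (of_int t) = 1"
proof -
  have "\<not> int p dvd t"
    using assms by (metis coprime_common_divisor dvd_refl not_prime_unit prime_int_nat_transfer nat_int int_one_le_iff_zero_less of_nat_0_le_iff prime_nat_int_transfer)
  moreover from this have "t \<noteq> 0" by auto
  ultimately show ?thesis
    using assms by (simp add: padic_abs_of_int not_dvd_imp_multiplicity_0)
qed

lemma padic_abs_diff_le:
  assumes "prime p" shows "padic_abs p (x - z) \<le> max (padic_abs p (x - y)) (padic_abs p (y - z))"
  using padic_abs_ultrametric[OF assms, of "x - y" "y - z"] by simp

text \<open>Absolute values are powers of \<open>p\<close> or 0, so the bound \<open>< p\<close>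
  already means at most 1: the denominator is prime to \<open>p\<close> and can be inverted modulo
  \<open>p ^ k\<close>.\<close>

lemma rat_near_int:
  assumes p: "prime p" and q: "padic_abs p q < real p"
  obtains c :: int where "padic_abs p (q - of_int c) \<le> 1 / real p ^ k"
proof (cases "q = 0")
  case True
  then show ?thesis using that[of 0] by simp
next
  case False
  obtain a b where ab: "quotient_of q = (a, b)" by (meson surj_pair)
  have b: "b > 0" and cop: "coprime a b" and qe: "q = of_int a / of_int b"
    using quotient_of_denom_pos[OF ab] quotient_of_coprime[OF ab] quotient_of_div[OF ab] by auto
  have a: "a \<noteq> 0" using False qe by auto
  have pb: "\<not> int p dvd b"
  proof
    assume pb: "int p dvd b"
    then have "\<not> int p dvd a"
      using cop p by (meson coprime_common_divisor not_prime_unit prime_nat_int_transfer)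
    then have "multiplicity (int p) a = 0" by (rule not_dvd_imp_multiplicity_0)
    moreover have "multiplicity (int p) b \<ge> 1"
      using pb b p prime_gt_1_nat[OF p] by (intro multiplicity_geI) auto
    ultimately have "real p powi 1 \<le> real p powi (int (multiplicity (int p) b) - int (multiplicity (int p) a))"
      by (subst power_int_le_iff_prime[OF p]) simp
    also have "\<dots> = padic_abs p q"
      unfolding qe using a b p by (intro padic_abs_Fract[symmetric]) auto
    finally show False using q by simp
  qed
  then have "coprime (int p) b"
    using p by (intro prime_imp_coprime) auto
  then have "coprime b (int p ^ k)" by (simp add: coprime_commute)
  then obtain x where x: "[b * x = 1] (mod int p ^ k)"
    using cong_solve_coprime_int by blast
  define c where "c = x * a"
  have "[b * c = a] (mod int p ^ k)"
    using cong_scalar_right[OF x, of a] by (simp add: c_def mult.assoc)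
  then have dvd: "int p ^ k dvd a - b * c" by (simp add: cong_iff_dvd_diff dvd_diff_commute)
  have "q - of_int c = of_int (a - b * c) * (1 / of_int b)"
    using b by (simp add: qe field_simps)
  also have "padic_abs p \<dots> = padic_abs p (of_int (a - b * c))"
  proof -
    have "padic_abs p (of_int 1 / of_int b) = real p powi (int (multiplicity (int p) b) - int (multiplicity (int p) 1))"
      using b p by (intro padic_abs_Fract) auto
    then have 1: "padic_abs p (1 / of_int b) = 1"
      using pb by (simp add: not_dvd_imp_multiplicity_0)
    show ?thesis by (simp only: padic_abs_mult[OF p] 1 mult_1_right)
  qed
  also have "\<dots> \<le> 1 / real p ^ k"
    using dvd by (simp only: padic_abs_of_int_le_iff[OF p])
  finally show ?thesis by (rule that)
qed

lemma padic_of_rat_in_Qp [simp]: "padic_of_rat p q \<in> Qp p"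
  unfolding padic_of_rat_def by (rule padic_class_in_Qp) simp

lemma padic_dist_class:
  assumes p: "prime p" and X: "X \<in> padic_Cauchy p"
  shows "(\<lambda>n. padic_abs p (X n - q)) \<longlonglongrightarrow> padic_dist p (padic_rel p `` {X}) (padic_of_rat p q)"
  using padic_norm_class[OF p padic_Cauchy_diff[OF p X padic_Cauchy_const]] X
  by (simp add: padic_dist_def padic_diff_class[OF p] padic_class_in_Qp padic_of_rat_def)

lemma padic_dist_unique:
  assumes "prime p" "X \<in> padic_Cauchy p" "(\<lambda>n. padic_abs p (X n - q)) \<longlonglongrightarrow> a"
  shows "padic_dist p (padic_rel p `` {X}) (padic_of_rat p q) = a"
  using LIMSEQ_unique[OF padic_dist_class[OF assms(1,2)] assms(3)] .

lemma padic_dist_scale: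
  assumes p: "prime p" and y: "y \<in> Qp p" and g: "\<gamma> \<noteq> 0"
  shows "padic_dist p (padic_mult p (padic_of_rat p \<gamma>) y) (padic_of_rat p \<beta>)
    = padic_abs p \<gamma> * padic_dist p y (padic_of_rat p (\<beta> / \<gamma>))"
proof -
  obtain X where X: "X \<in> padic_Cauchy p" "y = padic_rel p `` {X}" using y by (rule Qp_cases)
  have "padic_abs p (\<gamma> * X n - \<beta>) = padic_abs p \<gamma> * padic_abs p (X n - \<beta> / \<gamma>)" for n
    using g by (simp add: right_diff_distrib flip: padic_abs_mult[OF p])
  then have "(\<lambda>n. padic_abs p (\<gamma> * X n - \<beta>)) \<longlonglongrightarrow> padic_abs p \<gamma> * padic_dist p y (padic_of_rat p (\<beta> / \<gamma>))"
    unfolding X(2) using tendsto_mult_left[OF padic_dist_class[OF p X(1)]] by simp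
  from padic_dist_unique[OF p padic_Cauchy_mult[OF p padic_Cauchy_const X(1)] this] show ?thesis
    using X(1) by (simp add: X(2) padic_of_rat_def padic_mult_class[OF p])
qed

text \<open>The strong triangle inequality for rationals, passed to the limit along a representing
  sequence.\<close>

lemma padic_dist_le_max:
  assumes p: "prime p" and y: "y \<in> Qp p"
  shows "padic_dist p y (padic_of_rat p q) \<le> max (padic_dist p y (padic_of_rat p q')) (padic_abs p (q - q'))"
proof -
  obtain X where X: "X \<in> padic_Cauchy p" "y = padic_rel p `` {X}" using y by (rule Qp_cases)
  show ?thesis
    unfolding X(2)
    by (rule LIMSEQ_le[OF padic_dist_class[OF p X(1)] tendsto_max[OF padic_dist_class[OF p X(1)] tendsto_const]])
      (use padic_abs_diff_le[OF p, of "X _" q q'] in \<open>auto simp: padic_abs_minus_commute[of p q]\<close>)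
qed

lemma padic_abs_le_max_dist:
  assumes p: "prime p" and y: "y \<in> Qp p"
  shows "padic_abs p (q - q') \<le> max (padic_dist p y (padic_of_rat p q)) (padic_dist p y (padic_of_rat p q'))"
proof -
  obtain X where X: "X \<in> padic_Cauchy p" "y = padic_rel p `` {X}" using y by (rule Qp_cases)
  show ?thesis
    unfolding X(2)
    by (rule LIMSEQ_le[OF tendsto_const tendsto_max[OF padic_dist_class[OF p X(1)] padic_dist_class[OF p X(1)]]])
      (use padic_abs_diff_le[OF p, of q q' "X _"] in \<open>auto simp: padic_abs_minus_commute[of p q]\<close>)
qed

lemma padic_norm_eq_dist_0:
  assumes p: "prime p" and y: "y \<in> Qp p"
  shows "padic_norm p y = padic_dist p y (padic_of_rat p 0)"
proof -
  obtain X where X: "X \<in> padic_Cauchy p" "y = padic_rel p `` {X}" using y by (rule Qp_cases)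
  show ?thesis
    using padic_dist_unique[OF p X(1), of 0] padic_norm_class[OF p X(1)] by (simp add: X(2))
qed

lemma Qp_near_rat:
  assumes p: "prime p" and y: "y \<in> Qp p" and e: "e > 0"
  obtains q where "padic_dist p y (padic_of_rat p q) \<le> e"
proof -
  obtain X where X: "X \<in> padic_Cauchy p" "y = padic_rel p `` {X}" using y by (rule Qp_cases)
  obtain n where n: "\<And>m m'. m \<ge> n \<Longrightarrow> m' \<ge> n \<Longrightarrow> padic_abs p (X m - X m') < e"
    using padic_CauchyE[OF X(1) e] by metis
  have "padic_dist p y (padic_of_rat p (X n)) \<le> e"
    unfolding X(2) using n by (intro LIMSEQ_le_const2[OF padic_dist_class[OF p X(1)]]) (meson less_imp_le order_refl)
  then show ?thesis by (rule that)
qed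

definition padic_ball :: "nat \<Rightarrow> rat \<Rightarrow> real \<Rightarrow> padic set" where
  "padic_ball p q e = {y \<in> Qp p. padic_dist p y (padic_of_rat p q) \<le> e}"

lemma Zp_eq_ball: "prime p \<Longrightarrow> Zp p = padic_ball p 0 1"
  by (auto simp: Zp_def padic_ball_def padic_norm_eq_dist_0)

text \<open>Density of the integers: a rational close to \<open>y\<close> has absolute value at most
  1, and such a rational is close to an integer.\<close>

lemma Zp_near_int:
  assumes p: "prime p" and y: "y \<in> Zp p"
  obtains c :: int where "y \<in> padic_ball p (of_int c) (1 / real p ^ k)"
proof -
  have pk: "1 / real p ^ k > 0" "1 / real p ^ k \<le> 1" "1 < real p"
    using prime_gt_1_nat[OF p] by auto
  have yQ: "y \<in> Qp p" and y1: "padic_dist p y (padic_of_rat p 0) \<le> 1"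
    using y Zp_eq_ball[OF p] by (auto simp: padic_ball_def)
  obtain q where q: "padic_dist p y (padic_of_rat p q) \<le> 1 / real p ^ k"
    using Qp_near_rat[OF p yQ pk(1)] by blast
  have "padic_abs p q \<le> 1"
    using padic_abs_le_max_dist[OF p yQ, of q 0] y1 order_trans[OF q pk(2)]
    by (metis diff_zero max.bounded_iff order_trans)
  then obtain c where "padic_abs p (q - of_int c) \<le> 1 / real p ^ k"
    using rat_near_int[OF p, of q k] pk by (metis le_less_trans)
  then have "padic_dist p y (padic_of_rat p (of_int c)) \<le> 1 / real p ^ k"
    using padic_dist_le_max[OF p yQ, of "of_int c" q] q by (simp add: padic_abs_minus_commute)
  then show ?thesis using that yQ by (auto simp: padic_ball_def)
qed

text \<open>In an ultrametric space every point of a ball is a centre, so the integers within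
  \<open>1 / p ^ k\<close> of \<open>y\<close> form one residue class.\<close>

lemma padic_ball_int_iff:
  assumes p: "prime p" and y: "y \<in> padic_ball p (of_int c) (1 / real p ^ k)"
  shows "y \<in> padic_ball p (of_int d) (1 / real p ^ k) \<longleftrightarrow> [c = d] (mod int p ^ k)"
proof -
  have yQ: "y \<in> Qp p" and yc: "padic_dist p y (padic_of_rat p (of_int c)) \<le> 1 / real p ^ k"
    using y by (auto simp: padic_ball_def)
  have "y \<in> padic_ball p (of_int d) (1 / real p ^ k) \<longleftrightarrow> padic_abs p (of_int (c - d)) \<le> 1 / real p ^ k"
    using padic_abs_le_max_dist[OF p yQ, of "of_int c" "of_int d"]
      padic_dist_le_max[OF p yQ, of "of_int d" "of_int c"] yc yQ
    by (auto simp: padic_ball_def padic_abs_minus_commute[of p "of_int d"])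
  then show ?thesis
    by (simp only: padic_abs_of_int_le_iff[OF p] cong_iff_dvd_diff)
qed

lemma padic_ball_int_subset_Zp:
  assumes p: "prime p" shows "padic_ball p (of_int c) (1 / real p ^ k) \<subseteq> Zp p"
proof
  fix y assume y: "y \<in> padic_ball p (of_int c) (1 / real p ^ k)"
  have "1 / real p ^ k \<le> 1" using prime_gt_1_nat[OF p] by simp
  then show "y \<in> Zp p"
    using y padic_dist_le_max[OF p, of y 0 "of_int c"] padic_abs_of_int_le_1[OF p, of c]
    unfolding Zp_eq_ball[OF p] padic_ball_def by (auto simp: max_def split: if_splits)
qed

lemma padic_translate_ball:
  assumes p: "prime p"
  shows "padic_add p (padic_of_rat p c) ` padic_ball p q e = padic_ball p (c + q) e"
proof -
  have tr: "padic_add p (padic_of_rat p c) y \<in> padic_ball p (c + q) e"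
    "padic_add p (padic_of_rat p (- c)) (padic_add p (padic_of_rat p c) y) = y"
    if y: "y \<in> padic_ball p q e" for c q y
  proof -
    obtain X where X: "X \<in> padic_Cauchy p" "y = padic_rel p `` {X}"
      using y Qp_cases unfolding padic_ball_def by blast
    have cX: "(\<lambda>n. c + X n) \<in> padic_Cauchy p"
      using padic_Cauchy_add[OF p padic_Cauchy_const X(1)] .
    have eq: "padic_add p (padic_of_rat p c) y = padic_rel p `` {\<lambda>n. c + X n}"
      using X(1) by (simp add: X(2) padic_of_rat_def padic_add_class[OF p])
    have "padic_dist p (padic_rel p `` {\<lambda>n. c + X n}) (padic_of_rat p (c + q)) = padic_dist p y (padic_of_rat p q)"
      using padic_dist_class[OF p X(1), of q] by (intro padic_dist_unique[OF p cX]) (simp add: X(2))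
    then show "padic_add p (padic_of_rat p c) y \<in> padic_ball p (c + q) e"
      using y padic_class_in_Qp[OF cX] by (simp add: eq padic_ball_def)
    show "padic_add p (padic_of_rat p (- c)) (padic_add p (padic_of_rat p c) y) = y"
      unfolding eq using cX by (simp add: X(2) padic_of_rat_def padic_add_class[OF p])
  qed
  show ?thesis
  proof (intro subset_antisym subsetI)
    fix z assume z: "z \<in> padic_ball p (c + q) e"
    show "z \<in> padic_add p (padic_of_rat p c) ` padic_ball p q e"
      using tr[OF z, of "- c"] by (intro image_eqI[of _ _ "padic_add p (padic_of_rat p (- c)) z"]) auto
  qed (use tr in auto)
qed

section \<open>Haar measure of balls\<close>

context
  fixes p :: nat and \<mu> :: "padic measure"
  assumes p: "prime p" and haar: "normalised_Haar p \<mu>"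
begin

lemma Haar_space: "space \<mu> = Qp p"
  using haar sets_eq_imp_space_eq[of \<mu> "sigma (Qp p) {U. openin (padic_topology p) U}"]
  by (simp add: normalised_Haar_def space_measure_of_conv)

lemma padic_ball_measurable: "padic_ball p q e \<in> sets \<mu>"
proof -
  interpret Metric_space "Qp p" "padic_dist p" using p by (rule Metric_space_padic)
  have top: "padic_topology p = mtopology" by (simp add: padic_topology_def)
  have eq: "padic_ball p q e = mcball (padic_of_rat p q) e"
    by (auto simp: padic_ball_def mcball_def commute)
  then have open': "openin mtopology (Qp p - padic_ball p q e)"
    using closedin_mcball[of "padic_of_rat p q" e] by (auto simp: closedin_def)
  have sub: "{U. openin (padic_topology p) U} \<subseteq> Pow (Qp p)"
    using openin_subset by (fastforce simp: top)
  have "Qp p - padic_ball p q e \<in> sets \<mu>"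
    using haar open' sub by (simp add: normalised_Haar_def sets_measure_of top)
  then have "space \<mu> - (Qp p - padic_ball p q e) \<in> sets \<mu>" by auto
  moreover have "space \<mu> - (Qp p - padic_ball p q e) = padic_ball p q e"
    by (auto simp: Haar_space padic_ball_def)
  ultimately show ?thesis by simp
qed

lemma emeasure_padic_ball_translate: "emeasure \<mu> (padic_ball p (c + q) e) = emeasure \<mu> (padic_ball p q e)"
  using haar padic_ball_measurable[of q e] padic_of_rat_in_Qp[of p c]
  unfolding normalised_Haar_def padic_translate_ball[OF p, of c q e, symmetric] by blast

lemma emeasure_padic_ball_1: "emeasure \<mu> (padic_ball p q 1) = 1"
  using emeasure_padic_ball_translate[of q 0 1] haar by (simp add: normalised_Haar_def Zp_eq_ball[OF p])

text \<open>The \<open>p ^ k\<close> residue classes split \<open>Zp p\<close> into translates of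
  one ball, which share the mass 1 equally.\<close>

lemma emeasure_padic_ball_int: "emeasure \<mu> (padic_ball p (of_int c) (1 / real p ^ k)) = ennreal (1 / real p ^ k)"
proof -
  let ?B = "\<lambda>c :: int. padic_ball p (of_int c) (1 / real p ^ k)"
  have pk: "int p ^ k > 0" using prime_gt_0_nat[OF p] by simp
  have "Zp p = (\<Union>c\<in>{0..<int p ^ k}. ?B c)"
  proof (intro subset_antisym subsetI)
    fix y assume "y \<in> Zp p"
    then obtain c where c: "y \<in> ?B c" using Zp_near_int[OF p] by blast
    then have "y \<in> ?B (c mod int p ^ k)"
      using padic_ball_int_iff[OF p c] by (simp add: cong_def)
    then show "y \<in> (\<Union>c\<in>{0..<int p ^ k}. ?B c)" using pk by auto
  qed (use padic_ball_int_subset_Zp[OF p] in blast)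
  moreover have "emeasure \<mu> (Zp p) = 1" using haar by (simp add: normalised_Haar_def)
  ultimately have "1 = emeasure \<mu> (\<Union>c\<in>{0..<int p ^ k}. ?B c)" by simp
  also have "\<dots> = (\<Sum>c\<in>{0..<int p ^ k}. emeasure \<mu> (?B c))"
  proof (rule sum_emeasure[symmetric])
    show "disjoint_family_on ?B {0..<int p ^ k}"
    proof (unfold disjoint_family_on_def, intro ballI impI)
      fix m n assume mn: "m \<in> {0..<int p ^ k}" "n \<in> {0..<int p ^ k}" "m \<noteq> n"
      then have "\<not> [m = n] (mod int p ^ k)" by (simp add: cong_def)
      then show "?B m \<inter> ?B n = {}" using padic_ball_int_iff[OF p] by blast
    qed
  qed (auto intro: padic_ball_measurable)
  also have "\<dots> = (\<Sum>c\<in>{0..<int p ^ k}. emeasure \<mu> (?B 0))"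
    using emeasure_padic_ball_translate[of "of_int _" 0] by (intro sum.cong) auto
  also have "\<dots> = ennreal (real p ^ k) * emeasure \<mu> (?B 0)"
    by (simp add: ennreal_of_nat_eq_real_of_nat nat_power_eq flip: of_nat_power)
  finally have *: "1 = ennreal (real p ^ k) * emeasure \<mu> (?B 0)" .
  have "ennreal (1 / real p ^ k) * (ennreal (real p ^ k) * emeasure \<mu> (?B 0)) = emeasure \<mu> (?B 0)"
    using prime_gt_0_nat[OF p] by (simp flip: mult.assoc ennreal_mult)
  then have "emeasure \<mu> (?B 0) = ennreal (1 / real p ^ k)"
    using * by simp
  then show ?thesis using emeasure_padic_ball_translate[of "of_int c" 0] by simp
qed

lemma Haar_sigma_finite: "sigma_finite_measure \<mu>"
proof
  show "\<exists>A. countable A \<and> A \<subseteq> sets \<mu> \<and> \<Union>A = space \<mu> \<and> (\<forall>a\<in>A. emeasure \<mu> a \<noteq> \<infinity>)"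
  proof (intro exI conjI)
    show "countable (range (\<lambda>q. padic_ball p q 1))" by simp
    show "range (\<lambda>q. padic_ball p q 1) \<subseteq> sets \<mu>" using padic_ball_measurable by auto
    show "\<Union>(range (\<lambda>q. padic_ball p q 1)) = space \<mu>"
      using Qp_near_rat[OF p _ zero_less_one] by (auto simp: Haar_space padic_ball_def) blast
  qed (auto simp: emeasure_padic_ball_1)
qed

end

section \<open>Residues of points of the finite part\<close>

context residue_measure
begin

text \<open>These sequences solve \<open>n * \<omega> = b\<close> in the p-adic integers.
  Translations carry the set to the solution sets for \<open>b - n * t\<close>, which are disjoint
  and of equal measure in a probability space.\<close>

lemma rational_residue_seqs_null:
  assumes p: "prime p" "p dvd W" and n: "n \<noteq> 0"
  shows "{\<omega> \<in> residue_seqs W. \<forall>k. p ^ k dvd n * \<omega> k - b} \<in> null_sets V"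
proof -
  define D where "D b = {\<omega> \<in> residue_seqs W. \<forall>k. p ^ k dvd n * \<omega> k - b}" for b
  have p1: "p > 1" using p(1) by (rule prime_gt_1_int)
  have meas [measurable]: "D b \<in> sets V" for b
  proof -
    have "(\<Inter>k. {\<omega> \<in> residue_seqs W. p ^ k dvd n * \<omega> k - b}) \<in> sets V"
      by (intro sets.countable_INT) (auto intro: component_set_measurable)
    moreover have "(\<Inter>k. {\<omega> \<in> residue_seqs W. p ^ k dvd n * \<omega> k - b}) = D b"
      by (auto simp: D_def)
    ultimately show ?thesis by simp
  qed
  have shift: "emeasure V (D (b - n * t)) = emeasure V (D b)" for t
  proof -
    have dvd_iff: "p ^ k dvd n * ((x + t) mod W ^ k) - b \<longleftrightarrow> p ^ k dvd n * x - (b - n * t)" for x k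
    proof -
      have "[(x + t) mod W ^ k = x + t] (mod p ^ k)"
        by (rule cong_dvd_modulus[of _ _ "W ^ k"]) (simp_all add: dvd_power_same p(2) cong_def)
      then have "[n * ((x + t) mod W ^ k) - b = n * (x + t) - b] (mod p ^ k)"
        by (intro cong_diff cong_scalar_left cong_refl)
      then have "p ^ k dvd n * ((x + t) mod W ^ k) - b \<longleftrightarrow> p ^ k dvd n * (x + t) - b"
        by (simp only: cong_dvd_iff)
      then show ?thesis by (simp add: algebra_simps)
    qed
    have "affine_seq W 1 (\<lambda>_. t) -` D b \<inter> space V = D (b - n * t)"
      using affine_seq_in[OF W coherent_const, of _ 1 t]
      by (auto simp: D_def space_V affine_seq_def dvd_iff)
    then show ?thesis
      using emeasure_distr[OF affine_seq_measurable[OF coherent_const] meas, of 1 t b] distr_affine_seq[of 1 "\<lambda>_. t"]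
      by simp
  qed
  have disj: "D (b - n * s) \<inter> D (b - n * t) = {}" if "s \<noteq> t" for s t
  proof (rule ccontr)
    assume "D (b - n * s) \<inter> D (b - n * t) \<noteq> {}"
    then obtain \<omega> where w: "\<And>k. p ^ k dvd n * \<omega> k - (b - n * s)" "\<And>k. p ^ k dvd n * \<omega> k - (b - n * t)"
      by (auto simp: D_def)
    \<comment> \<open>With this \<open>k\<close>, \<open>p ^ k\<close> exceeds
      \<open>\<bar>n * (s - t)\<bar>\<close>, so it cannot divide that nonzero number.\<close>
    define k where "k = nat \<bar>n * (s - t)\<bar>"
    have "p ^ k dvd (n * \<omega> k - (b - n * s)) - (n * \<omega> k - (b - n * t))"
      using w by (rule dvd_diff)
    then have "p ^ k dvd n * (s - t)" by (simp add: algebra_simps)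
    then have "\<bar>p ^ k\<bar> \<le> \<bar>n * (s - t)\<bar>"
      using n that by (intro dvd_imp_le_int) simp_all
    then have "p ^ k \<le> \<bar>n * (s - t)\<bar>" by linarith
    moreover have "int k < p ^ k"
    proof -
      have "int k < 2 ^ k" using of_nat_less_two_power[of k] by simp
      also have "(2::int) ^ k \<le> p ^ k" using p1 by (intro power_mono) auto
      finally show ?thesis .
    qed
    ultimately show False by (simp add: k_def)
  qed
  have "real m * measure V (D b) \<le> 1" for m :: nat
  proof -
    have "disjoint_family_on (\<lambda>t. D (b - n * int t)) {..<m}"
      unfolding disjoint_family_on_def using disj by simp
    then have "measure V (\<Union>t<m. D (b - n * int t)) = (\<Sum>t<m. measure V (D (b - n * int t)))"
      by (intro V.finite_measure_finite_Union) auto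
    also have "\<dots> = real m * measure V (D b)"
      using shift by (simp add: measure_def)
    finally have "real m * measure V (D b) = measure V (\<Union>t<m. D (b - n * int t))" by simp
    also have "\<dots> \<le> measure V (space V)" by (rule V.bounded_measure)
    also have "\<dots> = 1" by (simp add: measure_def space_V emeasure_V_space)
    finally show ?thesis .
  qed
  then have "measure V (D b) \<le> 0"
    by (metis linorder_not_less mult.commute reals_Archimedean3)
  then have "measure V (D b) = 0" by (simp add: measure_le_0_iff)
  then show ?thesis
    by (simp add: null_sets_def V.emeasure_eq_measure flip: D_def)
qed

end

locale padic_product =
  fixes S :: "nat set" and \<mu> :: "nat \<Rightarrow> padic measure"
  assumes finite_S: "finite S" and prime_S: "\<And>p. p \<in> S \<Longrightarrow> prime p"
    and haar: "\<And>p. p \<in> S \<Longrightarrow> normalised_Haar p (\<mu> p)"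
begin

definition modulus :: int where "modulus = (\<Prod>p\<in>S. int p)"

abbreviation "\<nu> \<equiv> \<Pi>\<^sub>M p\<in>S. \<mu> p"

abbreviation "Zhat \<equiv> \<Pi>\<^sub>E p\<in>S. Zp p"

lemma modulus_power: "modulus ^ k = (\<Prod>p\<in>S. int p ^ k)"
  by (simp add: modulus_def prod_power_distrib)

lemma modulus_ge_1: "modulus \<ge> 1"
  unfolding modulus_def using prime_S by (intro prod_ge_1) (auto simp: Suc_le_eq prime_gt_0_nat)

lemma power_dvd_modulus: "p \<in> S \<Longrightarrow> int p ^ k dvd modulus ^ k"
  unfolding modulus_power using finite_S by (intro dvd_prodI) auto

lemma cong_modulus_iff: "[a = b] (mod modulus ^ k) \<longleftrightarrow> (\<forall>p\<in>S. [a = b] (mod int p ^ k))"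
proof
  assume "\<forall>p\<in>S. [a = b] (mod int p ^ k)"
  then show "[a = b] (mod modulus ^ k)"
    unfolding modulus_power using prime_S
    by (intro cong_cong_prod_coprime) (auto simp: primes_coprime)
qed (use power_dvd_modulus in \<open>auto elim: cong_dvd_modulus\<close>)

text \<open>Each coordinate is approximated by an integer modulo \<open>p ^ k\<close>, and the
  Chinese remainder theorem glues these.\<close>

lemma ex_residue:
  assumes y: "y \<in> Zhat"
  shows "\<exists>!c. 0 \<le> c \<and> c < modulus ^ k \<and> (\<forall>p\<in>S. y p \<in> padic_ball p (of_int c) (1 / real p ^ k))"
proof -
  have W: "modulus ^ k > 0" using modulus_ge_1 by simp
  have "\<exists>c. y p \<in> padic_ball p (of_int c) (1 / real p ^ k)" if "p \<in> S" for p
    using Zp_near_int[OF prime_S[OF that], of "y p" k] y that by (auto simp: PiE_iff)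
  then obtain c where c: "\<And>p. p \<in> S \<Longrightarrow> y p \<in> padic_ball p (of_int (c p)) (1 / real p ^ k)"
    by metis
  have "\<exists>x. \<forall>p\<in>S. [x = nat (c p mod int p ^ k)] (mod p ^ k)"
    using prime_S by (intro chinese_remainder_nat finite_S) (auto simp: primes_coprime)
  then obtain x where x: "\<And>p. p \<in> S \<Longrightarrow> [x = nat (c p mod int p ^ k)] (mod p ^ k)" by blast
  have xc: "[c p = int x mod modulus ^ k] (mod int p ^ k)" if "p \<in> S" for p
  proof -
    have "int p ^ k > 0" using prime_gt_0_nat[OF prime_S[OF that]] by simp
    then have "[int x = c p mod int p ^ k] (mod int p ^ k)"
      using x[OF that] by (simp flip: cong_int_iff)
    moreover have "[int x mod modulus ^ k = int x] (mod int p ^ k)"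
      by (rule cong_dvd_modulus[of _ _ "modulus ^ k"]) (simp_all add: power_dvd_modulus[OF that] cong_def)
    ultimately show ?thesis by (simp add: cong_def)
  qed
  show ?thesis
  proof (rule ex1I[of _ "int x mod modulus ^ k"])
    show "0 \<le> int x mod modulus ^ k \<and> int x mod modulus ^ k < modulus ^ k \<and>
        (\<forall>p\<in>S. y p \<in> padic_ball p (of_int (int x mod modulus ^ k)) (1 / real p ^ k))"
    proof (intro conjI ballI)
      fix p assume p: "p \<in> S"
      show "y p \<in> padic_ball p (of_int (int x mod modulus ^ k)) (1 / real p ^ k)"
        using xc[OF p] padic_ball_int_iff[OF prime_S[OF p] c[OF p]] by blast
    qed (use W in simp_all)
    fix d assume d: "0 \<le> d \<and> d < modulus ^ k \<and> (\<forall>p\<in>S. y p \<in> padic_ball p (of_int d) (1 / real p ^ k))"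
    then have "[d = int x mod modulus ^ k] (mod int p ^ k)" if "p \<in> S" for p
      using that xc[OF that] c[OF that] padic_ball_int_iff[OF prime_S[OF that]] cong_trans cong_sym by blast
    then have "[d = int x mod modulus ^ k] (mod modulus ^ k)"
      unfolding cong_modulus_iff by blast
    then show "d = int x mod modulus ^ k" using d by (simp add: cong_def)
  qed
qed

text \<open>On \<open>Zhat\<close> this is the isomorphism from the product of the
  \<open>Zp p\<close> to the \<open>W\<close>-adic integers with \<open>W = modulus\<close>.\<close>

definition residues :: "(nat \<Rightarrow> padic) \<Rightarrow> nat \<Rightarrow> int" where
  "residues y k = (THE c. 0 \<le> c \<and> c < modulus ^ k \<and> (\<forall>p\<in>S. y p \<in> padic_ball p (of_int c) (1 / real p ^ k)))"

lemma residues: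
  assumes "y \<in> Zhat"
  shows "0 \<le> residues y k" "residues y k < modulus ^ k"
    "p \<in> S \<Longrightarrow> y p \<in> padic_ball p (of_int (residues y k)) (1 / real p ^ k)"
  using theI'[OF ex_residue[OF assms]] unfolding residues_def by blast+

lemma residues_eq:
  assumes "y \<in> Zhat" "0 \<le> c" "c < modulus ^ k" "\<And>p. p \<in> S \<Longrightarrow> y p \<in> padic_ball p (of_int c) (1 / real p ^ k)"
  shows "residues y k = c"
  unfolding residues_def using assms by (intro the1_equality[OF ex_residue]) auto

lemma residues_in: "y \<in> Zhat \<Longrightarrow> residues y \<in> residue_seqs modulus"
proof -
  assume y: "y \<in> Zhat"
  have "residues y (Suc k) mod modulus ^ k = residues y k" for k
  proof (rule residues_eq[OF y, symmetric])
    have W: "modulus ^ k > 0" using modulus_ge_1 by simp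
    then show "0 \<le> residues y (Suc k) mod modulus ^ k" "residues y (Suc k) mod modulus ^ k < modulus ^ k" by auto
    fix p assume p: "p \<in> S"
    have "1 / real p ^ Suc k \<le> 1 / real p ^ k"
      using prime_gt_1_nat[OF prime_S[OF p]] by (intro divide_left_mono power_increasing) auto
    then have "y p \<in> padic_ball p (of_int (residues y (Suc k))) (1 / real p ^ k)"
      using residues(3)[OF y p, of "Suc k"] by (auto simp: padic_ball_def)
    moreover have "[residues y (Suc k) = residues y (Suc k) mod modulus ^ k] (mod int p ^ k)"
      by (rule cong_dvd_modulus[of _ _ "modulus ^ k"]) (simp_all add: power_dvd_modulus[OF p] cong_def)
    ultimately show "y p \<in> padic_ball p (of_int (residues y (Suc k) mod modulus ^ k)) (1 / real p ^ k)"
      using padic_ball_int_iff[OF prime_S[OF p]] by blast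
  qed
  then show ?thesis using residues(1,2)[OF y] by (simp add: residue_seqs_def)
qed

lemma residues_fibre:
  assumes c: "0 \<le> c" "c < modulus ^ k"
  shows "{y \<in> Zhat. residues y k = c} = (\<Pi>\<^sub>E p\<in>S. padic_ball p (of_int c) (1 / real p ^ k))"
proof (intro subset_antisym subsetI)
  fix y assume "y \<in> {y \<in> Zhat. residues y k = c}"
  then show "y \<in> (\<Pi>\<^sub>E p\<in>S. padic_ball p (of_int c) (1 / real p ^ k))"
    using residues(3)[of y _ k] by (auto simp: PiE_iff)
next
  fix y assume y: "y \<in> (\<Pi>\<^sub>E p\<in>S. padic_ball p (of_int c) (1 / real p ^ k))"
  then have "y \<in> Zhat"
    using padic_ball_int_subset_Zp[OF prime_S] by (fastforce simp: PiE_iff)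
  then show "y \<in> {y \<in> Zhat. residues y k = c}"
    using residues_eq c y by (auto simp: PiE_iff)
qed

text \<open>\<open>\<mu>\<close> is arbitrary outside \<open>S\<close>, while
  \<open>product_sigma_finite\<close> asks every factor to be sigma-finite; a trivial measure fills
  the other indices.\<close>

lemma \<nu>_eq: "\<nu> = (\<Pi>\<^sub>M p\<in>S. if p \<in> S then \<mu> p else count_space {})"
  by (rule PiM_cong) auto

lemma product_sigma_finite: "product_sigma_finite (\<lambda>p. if p \<in> S then \<mu> p else count_space {})"
  unfolding product_sigma_finite_def
  by (auto intro: Haar_sigma_finite[OF prime_S haar] sigma_finite_measure_count_space_finite)

lemma sigma_finite_\<nu>: "sigma_finite_measure \<nu>"
  unfolding \<nu>_eq by (rule product_sigma_finite.sigma_finite[OF product_sigma_finite finite_S])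

lemma emeasure_\<nu>_PiE:
  assumes "\<And>p. p \<in> S \<Longrightarrow> A p \<in> sets (\<mu> p)"
  shows "emeasure \<nu> (\<Pi>\<^sub>E p\<in>S. A p) = (\<Prod>p\<in>S. emeasure (\<mu> p) (A p))"
  unfolding \<nu>_eq using assms
  by (subst product_sigma_finite.emeasure_PiM[OF product_sigma_finite finite_S]) auto

lemma Zhat_measurable [measurable]: "Zhat \<in> sets \<nu>"
  using padic_ball_measurable[OF prime_S haar] Zp_eq_ball[OF prime_S] by (intro sets_PiM_I_finite finite_S) simp

definition \<nu>Z :: "(nat \<Rightarrow> padic) measure" where "\<nu>Z = restrict_space \<nu> Zhat"

lemma space_\<nu>Z: "space \<nu>Z = Zhat"
  using sets.sets_into_space[OF Zhat_measurable] by (auto simp: \<nu>Z_def space_restrict_space)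

lemma sets_\<nu>Z: "A \<in> sets \<nu>Z \<longleftrightarrow> A \<subseteq> Zhat \<and> A \<in> sets \<nu>"
  unfolding \<nu>Z_def by (rule sets_restrict_space_iff) measurable

lemma emeasure_\<nu>Z: "A \<subseteq> Zhat \<Longrightarrow> emeasure \<nu>Z A = emeasure \<nu> A"
  unfolding \<nu>Z_def by (rule emeasure_restrict_space) measurable

lemma emeasure_residues_fibre:
  assumes "0 \<le> c" "c < modulus ^ k"
  shows "emeasure \<nu> {y \<in> Zhat. residues y k = c} = ennreal (1 / of_int modulus ^ k)"
proof -
  have "emeasure \<nu> {y \<in> Zhat. residues y k = c} = (\<Prod>p\<in>S. ennreal (1 / real p ^ k))"
    unfolding residues_fibre[OF assms]
    by (subst emeasure_\<nu>_PiE)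
      (auto simp: emeasure_padic_ball_int[OF prime_S haar] padic_ball_measurable[OF prime_S haar])
  also have "\<dots> = ennreal (\<Prod>p\<in>S. 1 / real p ^ k)"
    by (rule prod_ennreal) simp
  also have "(\<Prod>p\<in>S. 1 / real p ^ k) = 1 / of_int modulus ^ k"
    by (simp add: prod_dividef modulus_def prod_power_distrib)
  finally show ?thesis .
qed

lemma residues_measurable: "residues \<in> measurable \<nu>Z (sigma (residue_seqs modulus) (cylinders modulus))"
proof (rule measurable_measure_of)
  show "cylinders modulus \<subseteq> Pow (residue_seqs modulus)"
    using cylinder_subset by (auto simp: cylinders_def)
  show "residues \<in> space \<nu>Z \<rightarrow> residue_seqs modulus"
    using residues_in by (auto simp: space_\<nu>Z)
  fix Y assume "Y \<in> cylinders modulus"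
  then consider "Y = {}" | k c where "0 \<le> c" "c < modulus ^ k" "Y = cylinder modulus k c"
    using cylinder_empty by (auto simp: cylinders_def) metis
  then show "residues -` Y \<inter> space \<nu>Z \<in> sets \<nu>Z"
  proof cases
    case (2 k c)
    have "residues -` Y \<inter> space \<nu>Z = {y \<in> Zhat. residues y k = c}"
      using residues_in by (auto simp: 2 space_\<nu>Z cylinder_def)
    then show ?thesis
      using padic_ball_measurable[OF prime_S haar]
      by (auto simp: sets_\<nu>Z residues_fibre[OF 2(1,2)] intro!: sets_PiM_I_finite finite_S)
        (metis (no_types, lifting) "2"(1) "2"(2) PiE_mem mem_Collect_eq residues_fibre)
  qed auto
qed

definition residue_distr :: "(nat \<Rightarrow> int) measure" where
  "residue_distr = distr \<nu>Z (sigma (residue_seqs modulus) (cylinders modulus)) residues"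

lemma residue_measure_distr: "residue_measure modulus residue_distr"
proof
  show "1 \<le> modulus" by (rule modulus_ge_1)
  show "sets residue_distr = sets (sigma (residue_seqs modulus) (cylinders modulus))"
    by (simp add: residue_distr_def)
  fix k c assume c: "0 \<le> c" "c < modulus ^ k"
  have "cylinders modulus \<subseteq> Pow (residue_seqs modulus)"
    using cylinder_subset by (auto simp: cylinders_def)
  then have cyl: "cylinder modulus k c \<in> sets (sigma (residue_seqs modulus) (cylinders modulus))"
    by (auto simp: sets_measure_of cylinders_def)
  have "residues -` cylinder modulus k c \<inter> space \<nu>Z = {y \<in> Zhat. residues y k = c}"
    using residues_in by (auto simp: space_\<nu>Z cylinder_def)
  then show "emeasure residue_distr (cylinder modulus k c) = ennreal (1 / of_int modulus ^ k)"
    using emeasure_residues_fibre[OF c]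
    by (simp add: residue_distr_def emeasure_distr[OF residues_measurable cyl] emeasure_\<nu>Z)
qed

end

section \<open>Reduction to integer numerators\<close>

text \<open>\<open>n\<close> is the signed integral part of \<open>\<gamma>\<close>. Nonvanishing is
  demanded explicitly because coprimality is vacuous for empty \<open>S\<close>.\<close>

definition P_reduced :: "nat set \<Rightarrow> rat \<Rightarrow> int \<Rightarrow> (nat \<Rightarrow> int) \<Rightarrow> bool" where
  "P_reduced S \<gamma> n v \<longleftrightarrow> \<gamma> = of_int n * S_prod S v \<and> n \<noteq> 0 \<and> (\<forall>p\<in>S. coprime n (int p))"

lemma S_prod_nonzero: "(\<And>p. p \<in> S \<Longrightarrow> prime p) \<Longrightarrow> finite S \<Longrightarrow> S_prod S v \<noteq> 0"
  by (force simp: S_prod_def)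

lemma S_prod_add:
  assumes "\<And>p. p \<in> S \<Longrightarrow> prime p"
  shows "S_prod S (\<lambda>p. v p + w p) = S_prod S v * S_prod S w"
  unfolding S_prod_def prod.distrib[symmetric]
  using assms by (intro prod.cong refl power_int_add) force

lemma padic_abs_power_int:
  assumes p: "prime p"
  shows "padic_abs p (x powi k) = padic_abs p x powi k"
proof -
  have 1: "padic_abs p 1 = 1" using padic_abs_of_int_coprime[OF p, of 1] by simp
  have pow: "padic_abs p (x ^ n) = padic_abs p x ^ n" for x n
    by (induction n) (simp_all add: 1 padic_abs_mult[OF p])
  have inv: "padic_abs p (inverse x) = inverse (padic_abs p x)" for x
  proof (cases "x = 0")
    case False
    then have "padic_abs p x * padic_abs p (inverse x) = 1" by (simp add: 1 flip: padic_abs_mult[OF p])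
    then show ?thesis by (metis inverse_unique)
  qed simp
  show ?thesis by (simp add: power_int_def pow inv)
qed

lemma of_rat_power_int: "of_rat (x powi k) = (of_rat x powi k :: 'a :: field_char_0)"
  by (simp add: power_int_def of_rat_power of_rat_inverse)

lemma padic_abs_other_prime:
  assumes "prime p" "prime q" "p \<noteq> q" shows "padic_abs p (of_nat q) = 1"
  using padic_abs_of_int_coprime[of p "int q"] assms by (simp add: primes_coprime)

lemma padic_abs_prod:
  assumes p: "prime p" shows "padic_abs p (\<Prod>i\<in>A. f i) = (\<Prod>i\<in>A. padic_abs p (f i))"
proof -
  have "padic_abs p 1 = 1" using padic_abs_of_int_coprime[OF p, of 1] by simp
  then show ?thesis
    by (induction A rule: infinite_finite_induct) (simp_all add: padic_abs_mult[OF p])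
qed

context
  fixes S :: "nat set"
  assumes fin: "finite S" and prime: "\<And>p. p \<in> S \<Longrightarrow> prime p"
begin

lemma padic_abs_S_prod:
  assumes "p \<in> S"
  shows "padic_abs p (S_prod S v) = real p powi (- v p)"
proof -
  have "padic_abs p (S_prod S v) = (\<Prod>q\<in>S. padic_abs p (of_nat q) powi v q)"
    by (simp add: S_prod_def padic_abs_prod[OF prime[OF assms]] padic_abs_power_int[OF prime[OF assms]])
  also have "\<dots> = (\<Prod>q\<in>S. if q = p then real p powi (- v p) else 1)"
    using assms prime by (intro prod.cong refl)
      (auto simp: padic_abs_self padic_abs_other_prime power_int_minus power_int_inverse divide_inverse)
  also have "\<dots> = real p powi (- v p)" using fin assms by simp
  finally show ?thesis .
qed

lemma padic_abs_P_reduced: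
  assumes "P_reduced S \<gamma> n v" "p \<in> S"
  shows "padic_abs p \<gamma> = real p powi (- v p)"
  using assms prime by (simp add: P_reduced_def padic_abs_mult padic_abs_of_int_coprime padic_abs_S_prod)

text \<open>Product formula: the powers of the primes in \<open>S\<close> cancel between the real
  and the finite absolute values.\<close>

lemma abs_prod_P_reduced:
  assumes g: "P_reduced S \<gamma> n v"
  shows "abs_prod S \<gamma> = \<bar>of_int n\<bar>"
proof -
  have "real_of_rat (S_prod S v) = (\<Prod>p\<in>S. real p powi v p)"
    by (simp add: S_prod_def of_rat_prod of_rat_power_int)
  moreover have "(\<Prod>p\<in>S. padic_abs p \<gamma>) = (\<Prod>p\<in>S. real p powi (- v p))"
    using padic_abs_P_reduced[OF g] by (intro prod.cong) auto
  moreover have "(\<Prod>p\<in>S. real p powi v p) * (\<Prod>p\<in>S. real p powi (- v p)) = 1"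
    unfolding prod.distrib[symmetric]
    using prime by (intro prod.neutral ballI) (force simp: power_int_minus)
  moreover have "(\<Prod>p\<in>S. real p powi v p) \<ge> 0" by (intro prod_nonneg) simp
  ultimately show ?thesis
    using g by (simp add: P_reduced_def abs_prod_def of_rat_mult abs_mult)
qed

lemma P_reduced_nonzero: "P_reduced S \<gamma> n v \<Longrightarrow> \<gamma> \<noteq> 0"
  using S_prod_nonzero[OF prime fin] by (auto simp: P_reduced_def)

lemma int_factor_out_primes:
  fixes b :: int
  assumes "b \<noteq> 0"
  obtains m :: int and e :: "nat \<Rightarrow> nat" where "b = m * (\<Prod>p\<in>S. int p ^ e p)" "\<And>p. p \<in> S \<Longrightarrow> coprime m (int p)" "m \<noteq> 0"
proof -
  have "\<exists>m e. b = m * (\<Prod>p\<in>S. int p ^ e p) \<and> (\<forall>p\<in>S. coprime m (int p))"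
    using fin prime
  proof (induction S rule: finite_induct)
    case (insert p S)
    then obtain m e where m: "b = m * (\<Prod>p\<in>S. int p ^ e p)" "\<forall>p\<in>S. coprime m (int p)" by auto
    have "m \<noteq> 0" using m(1) assms by auto
    then obtain m' where m': "m = int p ^ multiplicity (int p) m * m'" "\<not> int p dvd m'"
      using insert.prems prime_gt_1_nat by (metis insertI1 multiplicity_decompose' not_prime_unit prime_nat_int_transfer)
    have "coprime m' (int p)"
      using m'(2) insert.prems by (metis coprime_commute insertI1 prime_imp_coprime prime_nat_int_transfer)
    moreover have "coprime m' (int q)" if "q \<in> S" for q
      using m(2) that m'(1) by (metis coprime_mult_left_iff)
    moreover have "b = m' * (\<Prod>q\<in>insert p S. int q ^ (e(p := multiplicity (int p) m)) q)"
    proof -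
      have "(\<Prod>q\<in>S. int q ^ (e(p := multiplicity (int p) m)) q) = (\<Prod>q\<in>S. int q ^ e q)"
        using insert.hyps by (intro prod.cong) auto
      then show ?thesis
        using insert.hyps m(1) m'(1) by (simp add: ac_simps)
    qed
    ultimately show ?case by blast
  qed auto
  then obtain m e where "b = m * (\<Prod>p\<in>S. int p ^ e p)" "\<forall>p\<in>S. coprime m (int p)" by blast
  moreover from this have "m \<noteq> 0" using assms by auto
  ultimately show ?thesis using that by blast
qed

lemma L_P_ge:
  shows "abs_prod S \<gamma> / \<bar>real_of_rat \<gamma>\<bar> \<le> L_P S \<gamma>"
    and "p \<in> S \<Longrightarrow> abs_prod S \<gamma> / padic_abs p \<gamma> \<le> L_P S \<gamma>"
  unfolding L_P_def using fin by (auto intro: Max_ge)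

text \<open>Dividing by \<open>\<gamma>\<close> place by place gives one common centre
  \<open>\<beta> / \<gamma>\<close> but a separate radius at each place.\<close>

lemma dist_P_le_iff:
  assumes y: "\<And>p. p \<in> S \<Longrightarrow> y p \<in> Qp p" and g: "\<gamma> \<noteq> 0"
  shows "dist_P S (scale_P S \<gamma> (x, y)) (diag S \<beta>) \<le> s \<longleftrightarrow>
    \<bar>x - of_rat (\<beta> / \<gamma>)\<bar> \<le> s / \<bar>of_rat \<gamma>\<bar> \<and> (\<forall>p\<in>S. y p \<in> padic_ball p (\<beta> / \<gamma>) (s / padic_abs p \<gamma>))"
proof -
  have "dist_P S (scale_P S \<gamma> (x, y)) (diag S \<beta>) \<le> s \<longleftrightarrow>
      \<bar>of_rat \<gamma> * x - of_rat \<beta>\<bar> \<le> s \<and> (\<forall>p\<in>S. padic_abs p \<gamma> * padic_dist p (y p) (padic_of_rat p (\<beta> / \<gamma>)) \<le> s)"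
    unfolding dist_P_def using fin padic_dist_scale[OF prime y g] by (simp add: scale_P_def diag_def)
  also have "of_rat \<gamma> * x - of_rat \<beta> = of_rat \<gamma> * (x - of_rat (\<beta> / \<gamma>))"
    using g by (simp add: of_rat_divide right_diff_distrib)
  also have "\<bar>\<dots>\<bar> = \<bar>of_rat \<gamma>\<bar> * \<bar>x - of_rat (\<beta> / \<gamma>)\<bar>"
    by (rule abs_mult)
  also have "\<dots> \<le> s \<longleftrightarrow> \<bar>x - of_rat (\<beta> / \<gamma>)\<bar> \<le> s / \<bar>of_rat \<gamma>\<bar>"
    using g by (simp add: pos_le_divide_eq mult.commute)
  also have "(\<forall>p\<in>S. padic_abs p \<gamma> * padic_dist p (y p) (padic_of_rat p (\<beta> / \<gamma>)) \<le> s)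
      \<longleftrightarrow> (\<forall>p\<in>S. y p \<in> padic_ball p (\<beta> / \<gamma>) (s / padic_abs p \<gamma>))"
  proof (intro ball_cong refl)
    fix p assume p: "p \<in> S"
    then have "padic_abs p \<gamma> > 0"
      using g prime padic_abs_nonneg[of p \<gamma>] padic_abs_eq_0_iff[of p \<gamma>] by (simp add: less_le)
    then show "padic_abs p \<gamma> * padic_dist p (y p) (padic_of_rat p (\<beta> / \<gamma>)) \<le> s
      \<longleftrightarrow> y p \<in> padic_ball p (\<beta> / \<gamma>) (s / padic_abs p \<gamma>)"
      using y[OF p] by (simp add: padic_ball_def pos_le_divide_eq mult.commute)
  qed
  finally show ?thesis .
qed

end

text \<open>\<open>n\<close> is a unit at \<open>p\<close>, so multiplication by it preserves
  distances, and \<open>c\<close> can stand for \<open>y\<close> at any radius not below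
  \<open>1 / p ^ k\<close>.\<close>

lemma padic_ball_iff_near_int:
  assumes p: "prime p" and y: "y \<in> padic_ball p (of_int c) (1 / real p ^ k)"
    and s: "1 / real p ^ k \<le> s" and n: "n \<noteq> 0" "coprime n (int p)"
  shows "y \<in> padic_ball p (of_int b / of_int n) s \<longleftrightarrow> padic_abs p (of_int (n * c - b)) \<le> s"
proof -
  have yQ: "y \<in> Qp p" and yc: "padic_dist p y (padic_of_rat p (of_int c)) \<le> s"
    using y s by (auto simp: padic_ball_def)
  have "of_int (n * c - b) = of_int n * (of_int c - of_int b / of_int n :: rat)"
    using n by (simp add: field_simps)
  then have eq: "padic_abs p (of_int (n * c - b)) = padic_abs p (of_int c - of_int b / of_int n)"
    by (simp only: padic_abs_mult[OF p] padic_abs_of_int_coprime[OF p n(2)] mult_1)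
  show ?thesis
    unfolding eq
    using padic_abs_le_max_dist[OF p yQ, of "of_int c" "of_int b / of_int n"]
      padic_dist_le_max[OF p yQ, of "of_int b / of_int n" "of_int c"] yc yQ
    by (auto simp: padic_ball_def padic_abs_minus_commute[of p "of_int b / of_int n"])
qed

locale approximation = padic_product S \<mu> for S :: "nat set" and \<mu> :: "nat \<Rightarrow> padic measure" +
  fixes \<psi> :: "rat \<Rightarrow> real"
  assumes \<psi>_nonneg: "\<And>\<gamma>. \<gamma> \<in> PinvZ S \<Longrightarrow> 0 \<le> \<psi> \<gamma>"
    and \<psi>_le: "\<And>\<gamma>. \<gamma> \<in> PinvZ S \<Longrightarrow> \<gamma> \<noteq> 0 \<Longrightarrow> \<psi> \<gamma> \<le> 1 / (2 * L_P S \<gamma>)"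
begin

text \<open>Excluding \<open>\<psi> \<gamma> = 0\<close> makes all radii positive; nonzero
  \<open>\<gamma>\<close> with \<open>\<psi> \<gamma> = 0\<close> have solutions only at rational
  \<open>x\<close>.\<close>

definition denominators :: "rat set" where
  "denominators = {\<gamma>. 0 < \<psi> \<gamma> \<and> (\<exists>n v. P_reduced S \<gamma> n v)}"

text \<open>The floor only changes the type: for nonzero \<open>\<gamma>\<close> in
  \<open>PinvZ S\<close>, \<open>abs_prod\<close> is already the integer
  \<open>\<bar>n\<bar>\<close> of its reduced form.\<close>

definition norm_P :: "rat \<Rightarrow> int" where "norm_P \<gamma> = \<lfloor>abs_prod S \<gamma>\<rfloor>"

definition real_radius :: "rat \<Rightarrow> real" where "real_radius \<gamma> = \<psi> \<gamma> / \<bar>of_rat \<gamma>\<bar>"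

definition padic_radius :: "nat \<Rightarrow> rat \<Rightarrow> real" where "padic_radius p \<gamma> = \<psi> \<gamma> / padic_abs p \<gamma>"

text \<open>A modulus fine enough to resolve all finite radii: residues at this level decide every
  ball condition for \<open>\<gamma>\<close>.\<close>

definition level :: "rat \<Rightarrow> nat" where "level \<gamma> = (SOME k. \<forall>p\<in>S. 1 / real p ^ k \<le> padic_radius p \<gamma>)"

definition subgroup :: "rat \<Rightarrow> int set" where
  "subgroup \<gamma> = {t. \<forall>p\<in>S. padic_abs p (of_int t) \<le> padic_radius p \<gamma>}"

text \<open>Sequences whose component at some place is a fraction \<open>b / n\<close>.\<close>

definition exceptional :: "(nat \<Rightarrow> int) set" where
  "exceptional = (\<Union>p\<in>S. \<Union>n\<in>{1..}. \<Union>b. {\<omega> \<in> residue_seqs modulus. \<forall>k. int p ^ k dvd n * \<omega> k - b})"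

lemma norm_P_eq: "P_reduced S \<gamma> n v \<Longrightarrow> norm_P \<gamma> = \<bar>n\<bar>"
  using abs_prod_P_reduced[OF finite_S prime_S] by (simp add: norm_P_def flip: of_int_abs)

lemma abs_prod_eq_norm_P: "P_reduced S \<gamma> n v \<Longrightarrow> abs_prod S \<gamma> = of_int (norm_P \<gamma>)"
  using abs_prod_P_reduced[OF finite_S prime_S, of \<gamma> n v] norm_P_eq[of \<gamma> n v] by simp

lemma P_reduced_PinvZ: "P_reduced S \<gamma> n v \<Longrightarrow> \<gamma> \<in> PinvZ S"
  by (auto simp: P_reduced_def PinvZ_def)

context
  fixes \<gamma> assumes \<gamma>: "\<gamma> \<in> denominators"
begin

lemma norm_P_ge_1: "norm_P \<gamma> \<ge> 1"
  and norm_P_coprime: "p \<in> S \<Longrightarrow> coprime (norm_P \<gamma>) (int p)"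
proof -
  obtain n v where g: "P_reduced S \<gamma> n v" using \<gamma> by (auto simp: denominators_def)
  then have "n \<noteq> 0" "p \<in> S \<Longrightarrow> coprime n (int p)" by (simp_all add: P_reduced_def)
  then show "norm_P \<gamma> \<ge> 1" "p \<in> S \<Longrightarrow> coprime (norm_P \<gamma>) (int p)"
    using norm_P_eq[OF g] by simp_all
qed

lemma denominator_pos: "\<bar>real_of_rat \<gamma>\<bar> > 0" "p \<in> S \<Longrightarrow> padic_abs p \<gamma> > 0" "\<psi> \<gamma> > 0"
proof -
  have "\<gamma> \<noteq> 0" using \<gamma> P_reduced_nonzero[OF finite_S prime_S] by (auto simp: denominators_def)
  then show "\<bar>real_of_rat \<gamma>\<bar> > 0" "p \<in> S \<Longrightarrow> padic_abs p \<gamma> > 0"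
    using prime_S padic_abs_nonneg[of p \<gamma>] padic_abs_eq_0_iff[of p \<gamma>] by (auto simp: less_le)
  show "\<psi> \<gamma> > 0" using \<gamma> by (simp add: denominators_def)
qed

lemma radius_pos: "real_radius \<gamma> > 0" "p \<in> S \<Longrightarrow> padic_radius p \<gamma> > 0"
  using denominator_pos by (auto simp: real_radius_def padic_radius_def)

text \<open>\<open>L_P\<close> is the maximum of \<open>norm_P \<gamma> / d\<close> over the
  absolute values \<open>d\<close> of \<open>\<gamma>\<close>, so the hypothesis on
  \<open>\<psi>\<close> bounds the radii at all places by the same number.\<close>

lemma \<psi>_le_of_L:
  assumes "d > 0" "of_int (norm_P \<gamma>) / d \<le> L_P S \<gamma>"
  shows "\<psi> \<gamma> / d \<le> 1 / (2 * of_int (norm_P \<gamma>))"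
proof -
  have N: "real_of_int (norm_P \<gamma>) > 0" using norm_P_ge_1 by simp
  have "\<psi> \<gamma> \<le> 1 / (2 * L_P S \<gamma>)"
    using \<gamma> P_reduced_PinvZ denominator_pos(1) by (intro \<psi>_le) (auto simp: denominators_def)
  also have "\<dots> \<le> 1 / (2 * (of_int (norm_P \<gamma>) / d))"
    using assms N by (intro divide_left_mono mult_pos_pos) (auto intro: less_le_trans[of 0 "of_int (norm_P \<gamma>) / d"])
  also have "\<dots> = d / (2 * of_int (norm_P \<gamma>))" by simp
  finally show ?thesis using assms(1) N by (simp add: field_simps)
qed

lemma real_radius_le: "real_radius \<gamma> \<le> 1 / (2 * of_int (norm_P \<gamma>))"
  using \<gamma> L_P_ge(1)[OF finite_S prime_S, of \<gamma>] abs_prod_eq_norm_P denominator_pos(1)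
  unfolding real_radius_def by (intro \<psi>_le_of_L) (auto simp: denominators_def)

lemma padic_radius_le: "p \<in> S \<Longrightarrow> padic_radius p \<gamma> \<le> 1 / (2 * of_int (norm_P \<gamma>))"
  using \<gamma> L_P_ge(2)[OF finite_S prime_S, of p \<gamma>] abs_prod_eq_norm_P denominator_pos(2)
  unfolding padic_radius_def by (intro \<psi>_le_of_L) (auto simp: denominators_def)

lemma inverse_norm_P_le: "1 / (2 * real_of_int (norm_P \<gamma>)) \<le> 1 / 2"
  using norm_P_ge_1 by (intro divide_left_mono) auto

lemma level: "p \<in> S \<Longrightarrow> 1 / real p ^ level \<gamma> \<le> padic_radius p \<gamma>"
proof -
  have "\<exists>k. 1 / real p ^ k \<le> padic_radius p \<gamma>" if p: "p \<in> S" for p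
  proof -
    have "1 / real p < 1" using prime_gt_1_nat[OF prime_S[OF p]] by simp
    then obtain k where "(1 / real p) ^ k < padic_radius p \<gamma>"
      using real_arch_pow_inv[OF radius_pos(2)[OF p]] by blast
    then show ?thesis by (auto simp: power_one_over intro: less_imp_le)
  qed
  then obtain k where k: "\<And>p. p \<in> S \<Longrightarrow> 1 / real p ^ k p \<le> padic_radius p \<gamma>" by metis
  have "\<forall>p\<in>S. 1 / real p ^ Max (k ` S) \<le> padic_radius p \<gamma>"
  proof
    fix p assume p: "p \<in> S"
    have "1 / real p ^ Max (k ` S) \<le> 1 / real p ^ k p"
      using prime_gt_1_nat[OF prime_S[OF p]] finite_S p
      by (intro divide_left_mono power_increasing) auto
    then show "1 / real p ^ Max (k ` S) \<le> padic_radius p \<gamma>" using k[OF p] by linarith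
  qed
  then have "\<forall>p\<in>S. 1 / real p ^ level \<gamma> \<le> padic_radius p \<gamma>"
    unfolding level_def by (rule someI)
  then show "p \<in> S \<Longrightarrow> 1 / real p ^ level \<gamma> \<le> padic_radius p \<gamma>" by blast
qed

lemma subgroup_add: "a \<in> subgroup \<gamma> \<Longrightarrow> b \<in> subgroup \<gamma> \<Longrightarrow> a + b \<in> subgroup \<gamma>"
proof -
  assume ab: "a \<in> subgroup \<gamma>" "b \<in> subgroup \<gamma>"
  have "padic_abs p (of_int (a + b)) \<le> padic_radius p \<gamma>" if p: "p \<in> S" for p
  proof -
    have "padic_abs p (of_int (a + b)) \<le> max (padic_abs p (of_int a)) (padic_abs p (of_int b))"
      unfolding of_int_add by (rule padic_abs_ultrametric[OF prime_S[OF p]])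
    also have "\<dots> \<le> padic_radius p \<gamma>" using ab p by (simp add: subgroup_def)
    finally show ?thesis .
  qed
  then show ?thesis by (simp add: subgroup_def)
qed

lemma subgroup_mult: "a \<in> subgroup \<gamma> \<Longrightarrow> c * a \<in> subgroup \<gamma>"
proof -
  assume a: "a \<in> subgroup \<gamma>"
  have "padic_abs p (of_int (c * a)) \<le> padic_radius p \<gamma>" if p: "p \<in> S" for p
  proof -
    have "padic_abs p (of_int (c * a)) \<le> 1 * padic_abs p (of_int a)"
      unfolding of_int_mult padic_abs_mult[OF prime_S[OF p]]
      by (intro mult_right_mono padic_abs_of_int_le_1 prime_S p) simp
    then show ?thesis using a p by (auto simp: subgroup_def)
  qed
  then show ?thesis by (simp add: subgroup_def)
qed

lemma subgroup_modulus: "modulus ^ level \<gamma> \<in> subgroup \<gamma>"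
proof -
  have "padic_abs p (of_int (modulus ^ level \<gamma>)) \<le> padic_radius p \<gamma>" if p: "p \<in> S" for p
    using power_dvd_modulus[OF p, of "level \<gamma>"] level[OF p]
    by (simp only: padic_abs_of_int_le_iff[OF prime_S[OF p], symmetric])
  then show ?thesis by (simp add: subgroup_def)
qed

lemma residues_hit_iff:
  assumes y: "y \<in> Zhat"
  shows "norm_P \<gamma> * residues y (level \<gamma>) - b \<in> subgroup \<gamma> \<longleftrightarrow>
    (\<forall>p\<in>S. y p \<in> padic_ball p (of_int b / of_int (norm_P \<gamma>)) (padic_radius p \<gamma>))"
proof -
  have "y p \<in> padic_ball p (of_int b / of_int (norm_P \<gamma>)) (padic_radius p \<gamma>) \<longleftrightarrow>
      padic_abs p (of_int (norm_P \<gamma> * residues y (level \<gamma>) - b)) \<le> padic_radius p \<gamma>" if p: "p \<in> S" for p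
    using norm_P_ge_1 norm_P_coprime[OF p]
    by (intro padic_ball_iff_near_int[OF prime_S[OF p] residues(3)[OF y p] level[OF p]]) auto
  then show ?thesis by (simp add: subgroup_def)
qed

end

sublocale residue_measure modulus residue_distr
  by (rule residue_measure_distr)

lemma exceptional_null: "exceptional \<in> null_sets residue_distr"
proof -
  have "{\<omega> \<in> residue_seqs modulus. \<forall>k. int p ^ k dvd n * \<omega> k - b} \<in> null_sets residue_distr"
    if "p \<in> S" "n \<in> {1..}" for p n b
    using that prime_S power_dvd_modulus[OF that(1), of 1] by (intro rational_residue_seqs_null) auto
  then show ?thesis
    unfolding exceptional_def by (intro null_sets_UN' countable_finite[OF finite_S]) auto
qed

text \<open>A hit with radius below \<open>1 / p ^ k\<close> would see \<open>\<omega>\<close>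
  modulo \<open>p ^ k\<close> and force the divisibility that \<open>nd\<close> excludes.\<close>

lemma padic_radius_bounded_below:
  assumes w: "\<omega> \<in> residue_seqs modulus" and nd: "\<not> int p ^ k dvd norm_P \<gamma> * \<omega> k - b"
    and g: "\<gamma> \<in> denominators" and p: "p \<in> S" and hit: "norm_P \<gamma> * \<omega> (level \<gamma>) - b \<in> subgroup \<gamma>"
  shows "1 / real p ^ k \<le> padic_radius p \<gamma>"
proof (rule ccontr)
  assume "\<not> ?thesis"
  then have less: "padic_radius p \<gamma> < 1 / real p ^ k" by simp
  have p1: "1 < real p" using prime_gt_1_nat[OF prime_S[OF p]] by simp
  have "1 / real p ^ level \<gamma> < 1 / real p ^ k"
    using level[OF g p] less by linarith
  then have "real p ^ k < real p ^ level \<gamma>"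
    using p1 by (simp add: field_simps)
  then have "k \<le> level \<gamma>"
    using p1 by (simp add: power_strict_increasing_iff)
  then have "\<omega> (level \<gamma>) mod modulus ^ k = \<omega> k"
    by (rule residue_seqs_mod[OF w])
  then have "[\<omega> (level \<gamma>) = \<omega> k] (mod modulus ^ k)"
    using residue_seqs_mod_self[OF w, of k] by (simp add: cong_def)
  then have "[\<omega> (level \<gamma>) = \<omega> k] (mod int p ^ k)"
    by (rule cong_dvd_modulus) (rule power_dvd_modulus[OF p])
  then have "[norm_P \<gamma> * \<omega> (level \<gamma>) - b = norm_P \<gamma> * \<omega> k - b] (mod int p ^ k)"
    by (intro cong_diff cong_scalar_left cong_refl)
  then have "int p ^ k dvd norm_P \<gamma> * \<omega> (level \<gamma>) - b \<longleftrightarrow> int p ^ k dvd norm_P \<gamma> * \<omega> k - b"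
    by (rule cong_dvd_iff)
  moreover have "padic_abs p (of_int (norm_P \<gamma> * \<omega> (level \<gamma>) - b)) \<le> 1 / real p ^ k"
    using hit p less by (fastforce simp: subgroup_def)
  then have "int p ^ k dvd norm_P \<gamma> * \<omega> (level \<gamma>) - b"
    by (simp only: padic_abs_of_int_le_iff[OF prime_S[OF p]])
  ultimately show False using nd by blast
qed

lemma prod_between:
  fixes a :: "'b \<Rightarrow> real"
  assumes "finite A" and "\<And>i. i \<in> A \<Longrightarrow> l \<le> a i" "\<And>i. i \<in> A \<Longrightarrow> a i \<le> u" "0 \<le> l"
  shows "l ^ card A \<le> prod a A" "prod a A \<le> u ^ card A"
  using prod_mono[of A "\<lambda>_. l" a] prod_mono[of A a "\<lambda>_. u"] assms by (auto intro: order_trans)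

text \<open>All radii lie between \<open>D\<close> and 1, so each absolute value of
  \<open>\<gamma>\<close> agrees with \<open>\<psi> \<gamma>\<close> up to the factor
  \<open>1 / D\<close>. Their product is \<open>n\<close>, which confines
  \<open>\<psi> \<gamma>\<close> and with it every exponent.\<close>

lemma finite_bounded_denominators:
  assumes D: "0 < D"
  shows "finite {\<gamma> \<in> denominators. norm_P \<gamma> = n \<and> D \<le> real_radius \<gamma> \<and> (\<forall>p\<in>S. D \<le> padic_radius p \<gamma>)}"
proof -
  \<comment> \<open>Every absolute value of \<open>\<gamma>\<close> will lie between
    \<open>1 / B\<close> and \<open>B\<close>; the two entries come from
    \<open>D \<le> \<psi> \<gamma>\<close> and \<open>\<psi> \<gamma> \<le> n\<close>.\<close>
  define B where "B = max (1 / D) (of_int n / D)"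
  obtain m :: nat where m: "B < 2 ^ m" using real_arch_pow[of 2 B] by auto
  let ?f = "\<lambda>(s, v). of_int s * S_prod S v"
  let ?V = "{n, -n} \<times> (\<Pi>\<^sub>E p\<in>S. {- int m..int m})"
  have "\<gamma> \<in> ?f ` ?V" if g: "\<gamma> \<in> denominators" and n: "norm_P \<gamma> = n" and rr: "D \<le> real_radius \<gamma>"
    and pr: "\<And>p. p \<in> S \<Longrightarrow> D \<le> padic_radius p \<gamma>" for \<gamma>
  proof -
    obtain n' v where red: "P_reduced S \<gamma> n' v" using g by (auto simp: denominators_def)
    have n1: "real_of_int n \<ge> 1" using norm_P_ge_1[OF g] n by simp
    let ?s = "\<psi> \<gamma>"
    have s: "?s > 0" using denominator_pos(3)[OF g] .
    have half: "1 / (2 * real_of_int n) \<le> 1" using inverse_norm_P_le[OF g] n by simp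
    have lo: "?s \<le> \<bar>of_rat \<gamma>\<bar>" "\<And>p. p \<in> S \<Longrightarrow> ?s \<le> padic_abs p \<gamma>"
    proof -
      have "real_radius \<gamma> \<le> 1" using real_radius_le[OF g] half n by simp
      then show "?s \<le> \<bar>of_rat \<gamma>\<bar>"
        using denominator_pos(1)[OF g] by (simp only: real_radius_def pos_divide_le_eq mult_1)
      fix p assume p: "p \<in> S"
      have "padic_radius p \<gamma> \<le> 1" using padic_radius_le[OF g p] half n by simp
      then show "?s \<le> padic_abs p \<gamma>"
        using denominator_pos(2)[OF g p] by (simp only: padic_radius_def pos_divide_le_eq mult_1)
    qed
    have hi: "\<bar>of_rat \<gamma>\<bar> \<le> ?s / D" "\<And>p. p \<in> S \<Longrightarrow> padic_abs p \<gamma> \<le> ?s / D"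
    proof -
      show "\<bar>of_rat \<gamma>\<bar> \<le> ?s / D"
        using rr D denominator_pos(1)[OF g] by (simp add: real_radius_def field_simps)
      fix p assume p: "p \<in> S"
      show "padic_abs p \<gamma> \<le> ?s / D"
        using pr[OF p] D denominator_pos(2)[OF g p] by (simp add: padic_radius_def field_simps)
    qed
    have prod: "\<bar>of_rat \<gamma>\<bar> * (\<Prod>p\<in>S. padic_abs p \<gamma>) = of_int n"
      using abs_prod_eq_norm_P[OF red] n by (simp add: abs_prod_def)
    \<comment> \<open>If \<open>\<psi> \<gamma>\<close> exceeded \<open>n \<ge> 1\<close>, all
      absolute values would be at least \<open>\<psi> \<gamma>\<close>, and so would their product
      \<open>n\<close>. The lower bound that follows is dual.\<close>
    have "?s \<le> of_int n"
    proof (rule ccontr)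
      assume "\<not> ?thesis"
      then have "?s > 1" using n1 by linarith
      have "?s * 1 \<le> ?s * ?s ^ card S" using \<open>?s > 1\<close> by (intro mult_left_mono one_le_power) auto
      also have "\<dots> \<le> \<bar>of_rat \<gamma>\<bar> * (\<Prod>p\<in>S. padic_abs p \<gamma>)"
        using prod_between(1)[OF finite_S, of ?s "\<lambda>p. padic_abs p \<gamma>" "?s / D"] lo hi s
        by (intro mult_mono) auto
      finally show False using prod \<open>\<not> ?s \<le> of_int n\<close> by linarith
    qed
    moreover have "1 \<le> ?s / D"
    proof (rule ccontr)
      assume "\<not> ?thesis"
      then have l1: "?s / D < 1" by simp
      have "of_int n \<le> ?s / D * (?s / D) ^ card S"
        unfolding prod[symmetric]
        using prod_between(2)[OF finite_S, of ?s "\<lambda>p. padic_abs p \<gamma>" "?s / D"] lo hi s D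
        by (intro mult_mono prod_nonneg) auto
      also have "\<dots> \<le> ?s / D * 1"
        using l1 s D by (intro mult_left_mono power_le_one) auto
      finally show False using l1 n1 by linarith
    qed
    ultimately have bd: "1 / B \<le> ?s" "?s / D \<le> B"
    proof -
      assume a: "?s \<le> of_int n" "1 \<le> ?s / D"
      have "1 / D \<le> B" "0 < 1 / D" using D by (auto simp: B_def)
      then have "1 / B \<le> 1 / (1 / D)" by (intro divide_left_mono mult_pos_pos) linarith+
      then show "1 / B \<le> ?s" using a(2) D by (simp add: pos_le_divide_eq)
      have "?s / D \<le> of_int n / D" using a(1) D by (intro divide_right_mono) auto
      then show "?s / D \<le> B" by (simp add: B_def)
    qed
    have v: "v p \<in> {- int m..int m}" if p: "p \<in> S" for p
    proof -
      have p2: "2 \<le> real p" using prime_ge_2_nat[OF prime_S[OF p]] by simp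
      have B0: "B > 0" using D by (simp add: B_def less_max_iff_disj)
      have pv: "padic_abs p \<gamma> = real p powi (- v p)"
        by (rule padic_abs_P_reduced[OF finite_S prime_S red p])
      have 2: "2 ^ m \<le> real p ^ m" using p2 by (intro power_mono) auto
      have "real p powi (- v p) \<le> B" using hi(2)[OF p] bd(2) pv by linarith
      then have "real p powi (- v p) < real p powi int m" using m 2 by simp
      then have "- v p \<le> int m"
        using power_int_le_iff_prime[OF prime_S[OF p], of "- v p" "int m"] by simp
      moreover have "real p powi (- int m) < real p powi (- v p)"
      proof -
        have "real p powi (- int m) = 1 / real p ^ m" by (simp add: power_int_minus divide_inverse)
        also have "\<dots> < 1 / B" using m 2 B0 p2 by (intro divide_strict_left_mono mult_pos_pos) auto
        also have "\<dots> \<le> real p powi (- v p)" using lo(2)[OF p] bd(1) pv by linarith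
        finally show ?thesis .
      qed
      then have "- int m \<le> - v p"
        using power_int_le_iff_prime[OF prime_S[OF p], of "- int m" "- v p"] by simp
      ultimately show ?thesis by simp
    qed
    have "n' \<in> {n, - n}" using norm_P_eq[OF red] n by auto
    moreover have "\<gamma> = of_int n' * S_prod S (restrict v S)"
      using red by (simp add: P_reduced_def S_prod_def)
    moreover have "restrict v S \<in> (\<Pi>\<^sub>E p\<in>S. {- int m..int m})" using v by auto
    ultimately show ?thesis by (intro image_eqI[of _ _ "(n', restrict v S)"]) auto
  qed
  then have "{\<gamma> \<in> denominators. norm_P \<gamma> = n \<and> D \<le> real_radius \<gamma> \<and> (\<forall>p\<in>S. D \<le> padic_radius p \<gamma>)} \<subseteq> ?f ` ?V"
    by blast
  moreover have "finite (?f ` ?V)" using finite_S by (intro finite_imageI finite_SigmaI finite_PiE) auto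
  ultimately show ?thesis by (rule finite_subset)
qed

text \<open>A real radius of at least \<open>e\<close> bounds \<open>norm_P \<gamma>\<close> and
  hence \<open>b\<close>. For each such pair of values, a nonexceptional \<open>\<omega>\<close>
  keeps the finite radii away from 0.\<close>

lemma finite_large_hits:
  fixes e X :: real
  assumes w: "\<omega> \<in> residue_seqs modulus - exceptional" and e: "0 < e"
  shows "finite {(b, \<gamma>). \<gamma> \<in> denominators \<and> \<bar>of_int b\<bar> \<le> X * of_int (norm_P \<gamma>) \<and> e \<le> real_radius \<gamma> \<and>
    norm_P \<gamma> * \<omega> (level \<gamma>) - b \<in> subgroup \<gamma>}" (is "finite ?A")
proof -
  define T where "T n b = {\<gamma> \<in> denominators. norm_P \<gamma> = n \<and> e \<le> real_radius \<gamma> \<and> n * \<omega> (level \<gamma>) - b \<in> subgroup \<gamma>}" for n b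
  have T: "finite (T n b)" if n: "n \<ge> 1" for n b
  proof -
    have "\<forall>p\<in>S. \<exists>k. \<not> int p ^ k dvd n * \<omega> k - b"
      using w n by (auto simp: exceptional_def)
    then obtain k where k: "\<And>p. p \<in> S \<Longrightarrow> \<not> int p ^ k p dvd n * \<omega> (k p) - b" by metis
    \<comment> \<open>Inserting \<open>e\<close> covers the real radius and keeps the set nonempty
      when \<open>S\<close> is empty.\<close>
    define D where "D = Min (insert e ((\<lambda>p. 1 / real p ^ k p) ` S))"
    have D0: "D > 0"
      unfolding D_def using finite_S e prime_gt_0_nat[OF prime_S] by (subst Min_gr_iff) auto
    have De: "D \<le> e" "\<And>p. p \<in> S \<Longrightarrow> D \<le> 1 / real p ^ k p"
      unfolding D_def using finite_S by (auto intro: Min_le)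
    have "T n b \<subseteq> {\<gamma> \<in> denominators. norm_P \<gamma> = n \<and> D \<le> real_radius \<gamma> \<and> (\<forall>p\<in>S. D \<le> padic_radius p \<gamma>)}"
    proof
      fix \<gamma> assume "\<gamma> \<in> T n b"
      then have g: "\<gamma> \<in> denominators" "norm_P \<gamma> = n" "e \<le> real_radius \<gamma>" "norm_P \<gamma> * \<omega> (level \<gamma>) - b \<in> subgroup \<gamma>"
        by (auto simp: T_def)
      have "D \<le> padic_radius p \<gamma>" if p: "p \<in> S" for p
      proof -
        have "\<not> int p ^ k p dvd norm_P \<gamma> * \<omega> (k p) - b" using k[OF p] g(2) by simp
        then have "1 / real p ^ k p \<le> padic_radius p \<gamma>"
          using w g(1,4) p by (intro padic_radius_bounded_below[of \<omega> p "k p" \<gamma> b]) simp_all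
        then show ?thesis using De(2)[OF p] by linarith
      qed
      then show "\<gamma> \<in> {\<gamma> \<in> denominators. norm_P \<gamma> = n \<and> D \<le> real_radius \<gamma> \<and> (\<forall>p\<in>S. D \<le> padic_radius p \<gamma>)}"
        using g De(1) by auto
    qed
    then show ?thesis using finite_bounded_denominators[OF D0] by (rule finite_subset)
  qed
  define m where "m = \<lfloor>1 / e\<rfloor>"
  define B where "B = \<lceil>\<bar>X\<bar> * of_int m\<rceil>"
  have "?A \<subseteq> (\<Union>n\<in>{1..m}. \<Union>b\<in>{-B..B}. {b} \<times> T n b)"
  proof
    fix u assume "u \<in> ?A"
    then obtain b \<gamma> where u: "u = (b, \<gamma>)" and g: "\<gamma> \<in> denominators" "\<bar>of_int b\<bar> \<le> X * of_int (norm_P \<gamma>)"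
      "e \<le> real_radius \<gamma>" "norm_P \<gamma> * \<omega> (level \<gamma>) - b \<in> subgroup \<gamma>" by auto
    have n1: "norm_P \<gamma> \<ge> 1" using norm_P_ge_1[OF g(1)] .
    have "e \<le> 1 / (2 * of_int (norm_P \<gamma>))" using real_radius_le[OF g(1)] g(3) by linarith
    also have "\<dots> \<le> 1 / of_int (norm_P \<gamma>)" using n1 by (intro divide_left_mono) auto
    finally have "of_int (norm_P \<gamma>) \<le> 1 / e" using e n1 by (simp add: field_simps)
    then have nm: "norm_P \<gamma> \<le> m" by (simp add: m_def le_floor_iff)
    have "X * of_int (norm_P \<gamma>) \<le> \<bar>X\<bar> * of_int (norm_P \<gamma>)"
      using n1 by (intro mult_right_mono) auto
    then have "\<bar>of_int b\<bar> \<le> \<bar>X\<bar> * of_int (norm_P \<gamma>)"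
      using g(2) by linarith
    also have "\<dots> \<le> \<bar>X\<bar> * of_int m" using nm by (intro mult_left_mono) auto
    finally have "\<bar>b\<bar> \<le> B" unfolding B_def by linarith
    then show "u \<in> (\<Union>n\<in>{1..m}. \<Union>b\<in>{-B..B}. {b} \<times> T n b)"
      using u g n1 nm by (auto simp: T_def)
  qed
  moreover have "finite (\<Union>n\<in>{1..m}. \<Union>b\<in>{-B..B}. {b} \<times> T n b)" using T by auto
  ultimately show ?thesis by (rule finite_subset)
qed

sublocale target_system modulus residue_distr denominators norm_P level subgroup real_radius exceptional
proof
  show "real_radius i \<le> 1" if "i \<in> denominators" for i
    using real_radius_le[OF that] inverse_norm_P_le[OF that] by linarith
  show "countable denominators" by (rule countable_subset[OF subset_UNIV]) simp
  show "1 \<le> norm_P i" if "i \<in> denominators" for i by (rule norm_P_ge_1[OF that])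
  show "a + b \<in> subgroup i" if "i \<in> denominators" "a \<in> subgroup i" "b \<in> subgroup i" for i a b
    using that by (rule subgroup_add)
  show "c * a \<in> subgroup i" if "i \<in> denominators" "a \<in> subgroup i" for i a c
    using that by (rule subgroup_mult)
  show "modulus ^ level i \<in> subgroup i" if "i \<in> denominators" for i by (rule subgroup_modulus[OF that])
  show "0 < real_radius i" if "i \<in> denominators" for i by (rule radius_pos(1)[OF that])
  show "exceptional \<in> null_sets residue_distr" by (rule exceptional_null)
qed (rule finite_large_hits)

section \<open>Passing between integer numerators and coprime pairs\<close>

lemma S_prod_of_nat: "S_prod S (\<lambda>p. int (e p)) = of_int (\<Prod>p\<in>S. int p ^ e p)"
  by (simp add: S_prod_def)

text \<open>The primes of \<open>S\<close> dividing \<open>b\<close> move into the exponents of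
  \<open>\<beta>\<close>, and \<open>sgn n\<close> accounts for
  \<open>norm_P \<gamma> = \<bar>n\<bar>\<close>. The value \<open>b = 0\<close> admits no such
  factorisation.\<close>

lemma numerator_coprime_P:
  assumes g: "\<gamma> \<in> denominators" and b: "b \<noteq> 0" "coprime b (norm_P \<gamma>)"
  defines "\<beta> \<equiv> of_int b * \<gamma> / of_int (norm_P \<gamma>)"
  shows "coprime_P S \<beta> \<gamma>" "\<beta> \<in> PinvZ S"
proof -
  obtain n v where red: "P_reduced S \<gamma> n v" using g by (auto simp: denominators_def)
  then have n: "n \<noteq> 0" "\<gamma> = of_int n * S_prod S v" "\<And>p. p \<in> S \<Longrightarrow> coprime n (int p)"
    by (auto simp: P_reduced_def)
  have N: "norm_P \<gamma> = \<bar>n\<bar>" by (rule norm_P_eq[OF red])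
  obtain m e where m: "b = m * (\<Prod>p\<in>S. int p ^ e p)" "\<And>p. p \<in> S \<Longrightarrow> coprime m (int p)"
    using int_factor_out_primes[OF finite_S prime_S b(1)] by metis
  have "of_int n / of_int \<bar>n\<bar> = (of_int (sgn n) :: rat)"
    using n(1) by (simp add: sgn_if)
  moreover have "\<beta> = of_int n / of_int \<bar>n\<bar> * of_int b * S_prod S v"
    unfolding \<beta>_def N by (simp only: n(2) times_divide_eq_left times_divide_eq_right ac_simps)
  ultimately have "\<beta> = of_int (sgn n) * of_int b * S_prod S v" by simp
  also have "\<dots> = of_int (sgn n * m) * S_prod S (\<lambda>p. int (e p) + v p)"
    using prime_S by (simp only: m(1) S_prod_add S_prod_of_nat of_int_mult ac_simps)
  finally have \<beta>: "\<beta> = of_int (sgn n * m) * S_prod S (\<lambda>p. int (e p) + v p)" .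
  have "coprime m n" using b(2) m(1) by (simp add: N)
  then have "coprime (sgn n * m) n" using n(1) by (simp add: sgn_if)
  then have "gcd (sgn n * m) n = 1" by (simp only: coprime_iff_gcd_eq_1)
  moreover have "coprime (sgn n * m) (int p)" if "p \<in> S" for p
    using m(2)[OF that] n(1) by (simp add: sgn_if)
  ultimately show "coprime_P S \<beta> \<gamma>"
    unfolding coprime_P_def using \<beta> n(2,3)
    by (intro exI[of _ "sgn n * m"] exI[of _ n] exI[of _ "\<lambda>p. int (e p) + v p"] exI[of _ v]) simp
  show "\<beta> \<in> PinvZ S"
    unfolding PinvZ_def mem_Collect_eq
    by (intro exI[of _ "sgn n * m"] exI[of _ "\<lambda>p. int (e p) + v p"] conjI TrueI) (rule \<beta>)
qed

text \<open>\<open>y p\<close> is a p-adic integer within distance 1 of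
  \<open>\<beta> / \<gamma>\<close>, so \<open>\<beta> / \<gamma>\<close> is integral at every place
  of \<open>S\<close> and only \<open>n\<close> remains in its denominator. This is where the bound
  on the finite radii enters.\<close>

lemma coprime_P_numerator:
  assumes cop: "coprime_P S \<beta> \<gamma>" and g: "\<gamma> \<noteq> 0" "\<psi> \<gamma> > 0" and y: "y \<in> Zhat"
    and ball: "\<And>p. p \<in> S \<Longrightarrow> y p \<in> padic_ball p (\<beta> / \<gamma>) (padic_radius p \<gamma>)"
  obtains b where "\<gamma> \<in> denominators" "\<beta> = of_int b * \<gamma> / of_int (norm_P \<gamma>)" "coprime b (norm_P \<gamma>)"
proof -
  obtain m n u v where "\<beta> = of_int m * S_prod S u \<and> \<gamma> = of_int n * S_prod S v \<and>
      (\<forall>p\<in>S. coprime m (int p) \<and> coprime n (int p)) \<and> gcd m n = 1"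
    using cop unfolding coprime_P_def by (elim exE)
  then have mn: "\<beta> = of_int m * S_prod S u" "\<gamma> = of_int n * S_prod S v"
    "\<And>p. p \<in> S \<Longrightarrow> coprime m (int p)" "\<And>p. p \<in> S \<Longrightarrow> coprime n (int p)" "gcd m n = 1"
    by auto
  have n: "n \<noteq> 0" using g(1) mn(2) by auto
  have red: "P_reduced S \<gamma> n v" using mn n by (auto simp: P_reduced_def)
  have den: "\<gamma> \<in> denominators" using g(2) red by (auto simp: denominators_def)
  have N: "norm_P \<gamma> = \<bar>n\<bar>" by (rule norm_P_eq[OF red])
  show ?thesis
  proof (cases "m = 0")
    \<comment> \<open>\<open>gcd m n = 1\<close> then makes \<open>\<bar>n\<bar> = 1\<close>, and 0
      is coprime to 1.\<close>
    case True
    then have "\<bar>n\<bar> = 1" using mn(5) by simp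
    then show ?thesis using that[OF den, of 0] True mn(1) N by simp
  next
    case False
    have red': "P_reduced S \<beta> m u" using mn False by (auto simp: P_reduced_def)
    have le: "v p \<le> u p" if p: "p \<in> S" for p
    proof -
      have "y p \<in> Zp p" using y p by auto
      then have yp: "y p \<in> Qp p" "padic_dist p (y p) (padic_of_rat p 0) \<le> 1"
        using Zp_eq_ball[OF prime_S[OF p]] by (auto simp: padic_ball_def)
      have "padic_radius p \<gamma> \<le> 1" using padic_radius_le[OF den p] inverse_norm_P_le[OF den] by linarith
      then have d1: "padic_dist p (y p) (padic_of_rat p (\<beta> / \<gamma>)) \<le> 1"
        using ball[OF p] by (simp add: padic_ball_def)
      have "padic_abs p (\<beta> / \<gamma> - 0) \<le> max (padic_dist p (y p) (padic_of_rat p (\<beta> / \<gamma>))) (padic_dist p (y p) (padic_of_rat p 0))"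
        by (rule padic_abs_le_max_dist[OF prime_S[OF p] yp(1)])
      also have "\<dots> \<le> 1" using d1 yp(2) by (rule max.boundedI)
      finally have "padic_abs p (\<beta> / \<gamma>) \<le> 1" by simp
      then have "padic_abs p (\<beta> / \<gamma>) * padic_abs p \<gamma> \<le> 1 * padic_abs p \<gamma>"
        by (intro mult_right_mono) auto
      then have "padic_abs p \<beta> \<le> padic_abs p \<gamma>"
        using g(1) by (simp flip: padic_abs_mult[OF prime_S[OF p]])
      then show ?thesis
        using padic_abs_P_reduced[OF finite_S prime_S red p] padic_abs_P_reduced[OF finite_S prime_S red' p]
          power_int_le_iff_prime[OF prime_S[OF p], of "- u p" "- v p"] by simp
    qed
    define e where "e p = nat (u p - v p)" for p
    define b where "b = sgn n * m * (\<Prod>p\<in>S. int p ^ e p)"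
    have "S_prod S u = S_prod S (\<lambda>p. v p + int (e p))"
      unfolding S_prod_def using le by (intro prod.cong) (auto simp: e_def)
    also have "\<dots> = S_prod S v * of_int (\<Prod>p\<in>S. int p ^ e p)"
      using prime_S by (simp only: S_prod_add S_prod_of_nat)
    finally have u: "S_prod S u = S_prod S v * of_int (\<Prod>p\<in>S. int p ^ e p)" .
    have sgn: "of_int (sgn n) * of_int n / of_int \<bar>n\<bar> = (1 :: rat)"
      using n by (simp add: sgn_if)
    have "of_int b * \<gamma> / of_int (norm_P \<gamma>) = \<beta> * (of_int (sgn n) * of_int n / of_int \<bar>n\<bar>)"
      unfolding N by (simp only: b_def mn(1,2) u of_int_mult times_divide_eq_right times_divide_eq_left ac_simps)
    then have \<beta>: "\<beta> = of_int b * \<gamma> / of_int (norm_P \<gamma>)" unfolding sgn by simp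
    have "coprime (\<Prod>p\<in>S. int p ^ e p) n"
      using mn(4) by (intro prod_coprime_left) (simp add: coprime_commute)
    moreover have "coprime m n" using mn(5) by (simp only: coprime_iff_gcd_eq_1)
    ultimately have "coprime b (norm_P \<gamma>)"
      using n by (simp add: b_def N sgn_if)
    then show ?thesis using that den \<beta> by blast
  qed
qed

text \<open>Since 0 is coprime to no prime, \<open>S\<close> must be empty, and the gcd condition
  leaves \<open>m = 1\<close> or \<open>m = -1\<close>. So \<open>\<gamma> = 0\<close>, where the
  upper bound on \<open>\<psi>\<close> is not assumed, contributes at most two pairs.\<close>

lemma coprime_P_zero:
  assumes "coprime_P S \<beta> 0" shows "\<beta> \<in> {1, -1}"
proof -
  obtain m n u v where "\<beta> = of_int m * S_prod S u \<and> 0 = of_int n * S_prod S v \<and>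
      (\<forall>p\<in>S. coprime m (int p) \<and> coprime n (int p)) \<and> gcd m n = 1"
    using assms unfolding coprime_P_def by (elim exE)
  then have mn: "\<beta> = of_int m * S_prod S u" "0 = of_int n * S_prod S v" "\<forall>p\<in>S. coprime n (int p)" "gcd m n = 1"
    by auto
  have n: "n = 0" using mn(2) S_prod_nonzero[OF prime_S finite_S, of v] by simp
  then have "S = {}" using mn(3) prime_S not_prime_unit by fastforce
  moreover have "m = 1 \<or> m = -1"
  proof -
    have "\<bar>m\<bar> = 1" using mn(4) n by simp
    then show ?thesis by linarith
  qed
  ultimately show ?thesis using mn(1) by (auto simp: S_prod_def)
qed

definition solutions :: "real \<Rightarrow> (nat \<Rightarrow> padic) \<Rightarrow> (rat \<times> rat) set" where
  "solutions x y = {(\<beta>, \<gamma>). \<beta> \<in> PinvZ S \<and> \<gamma> \<in> PinvZ S \<and> coprime_P S \<beta> \<gamma> \<and>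
    dist_P S (scale_P S \<gamma> (x, y)) (diag S \<beta>) \<le> \<psi> \<gamma>}"

text \<open>
  The limsup set has to admit the numerator \<open>b = 0\<close> to be periodic, whereas \<^const>\<open>coprime_P\<close> excludes
  \<open>\<beta> = 0\<close> unless \<open>S\<close> is empty; but only finitely many hits of a generic point have \<open>b = 0\<close>.
\<close>

lemma infinite_solutions_iff:
  assumes x: "x \<notin> \<rat>" and y: "y \<in> Zhat" and gen: "residues y \<notin> exceptional"
  shows "infinite (solutions x y) \<longleftrightarrow> (x, residues y) \<in> hits 1 denominators"
proof -
  define H where "H = {(b, \<gamma>). \<gamma> \<in> denominators \<and> hit 1 (x, residues y) b \<gamma>}"
  define G where "G = (\<lambda>(b, \<gamma>). (of_int b * \<gamma> / of_int (norm_P \<gamma>), \<gamma>))"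
  have yQ: "y p \<in> Qp p" if "p \<in> S" for p
    using y that by (auto simp: Zp_def)
  have dist: "dist_P S (scale_P S \<gamma> (x, y)) (diag S \<beta>) \<le> \<psi> \<gamma> \<longleftrightarrow>
      \<bar>x - of_rat (\<beta> / \<gamma>)\<bar> \<le> real_radius \<gamma> \<and> (\<forall>p\<in>S. y p \<in> padic_ball p (\<beta> / \<gamma>) (padic_radius p \<gamma>))"
    if "\<gamma> \<noteq> 0" for \<beta> \<gamma>
    using dist_P_le_iff[OF finite_S prime_S yQ that] by (simp add: real_radius_def padic_radius_def)
  have quot: "of_int b * \<gamma> / of_int (norm_P \<gamma>) / \<gamma> = of_int b / of_int (norm_P \<gamma>)"
    "\<gamma> \<noteq> 0" if "\<gamma> \<in> denominators" for b \<gamma>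
    using denominator_pos(1)[OF that] by auto
  have hit: "hit 1 (x, residues y) b \<gamma> \<longleftrightarrow> coprime b (norm_P \<gamma>) \<and>
      dist_P S (scale_P S \<gamma> (x, y)) (diag S (of_int b * \<gamma> / of_int (norm_P \<gamma>))) \<le> \<psi> \<gamma>"
    if "\<gamma> \<in> denominators" for b \<gamma>
    unfolding dist[OF quot(2)[OF that]] quot(1)[OF that]
    using residues_hit_iff[OF that y] by (simp add: hit_def of_rat_divide)
  have "finite (solutions x y) \<longleftrightarrow> finite H"
  proof
    assume fin: "finite H"
    have "solutions x y \<subseteq> G ` H \<union> {(1, 0), (-1, 0)}"
    proof
      fix z assume "z \<in> solutions x y"
      then obtain \<beta> \<gamma> where z: "z = (\<beta>, \<gamma>)" and s: "\<gamma> \<in> PinvZ S" "coprime_P S \<beta> \<gamma>"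
        "dist_P S (scale_P S \<gamma> (x, y)) (diag S \<beta>) \<le> \<psi> \<gamma>" by (auto simp: solutions_def)
      show "z \<in> G ` H \<union> {(1, 0), (-1, 0)}"
      proof (cases "\<gamma> = 0")
        case True
        then show ?thesis using coprime_P_zero s(2) z by auto
      next
        case False
        \<comment> \<open>A zero radius would make the irrational \<open>x\<close> equal to
          \<open>\<beta> / \<gamma>\<close>.\<close>
        have "\<psi> \<gamma> \<noteq> 0"
        proof
          assume "\<psi> \<gamma> = 0"
          then have "x = of_rat (\<beta> / \<gamma>)" using s(3) dist[OF False] by (simp add: real_radius_def)
          then show False using x by simp
        qed
        then have "\<psi> \<gamma> > 0" using \<psi>_nonneg[OF s(1)] by simp
        then obtain b where b: "\<gamma> \<in> denominators" "\<beta> = of_int b * \<gamma> / of_int (norm_P \<gamma>)" "coprime b (norm_P \<gamma>)"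
          using coprime_P_numerator[OF s(2) False _ y] s(3) dist[OF False] by metis
        then have "(b, \<gamma>) \<in> H" using hit[OF b(1)] s(3) by (simp add: H_def)
        moreover have "z = G (b, \<gamma>)" by (simp add: z G_def b(2))
        ultimately show ?thesis by blast
      qed
    qed
    then show "finite (solutions x y)" by (rule finite_subset) (use fin in simp)
  next
    assume fin: "finite (solutions x y)"
    have "x \<noteq> 0" using x by auto
    then have "finite {(b, \<gamma>) \<in> H. b = 0}"
    proof -
      assume "x \<noteq> 0"
      \<comment> \<open>A hit with \<open>b = 0\<close> needs a real radius of at least
        \<open>\<bar>x\<bar> > 0\<close>, so the finiteness lemma applies with \<open>X = 0\<close>
        and \<open>e = \<bar>x\<bar>\<close>.\<close>
      have "{(b, \<gamma>) \<in> H. b = 0} \<subseteq> {(b, \<gamma>). \<gamma> \<in> denominators \<and> \<bar>of_int b\<bar> \<le> (0 :: real) * of_int (norm_P \<gamma>) \<and> \<bar>x\<bar> \<le> real_radius \<gamma> \<and>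
          norm_P \<gamma> * residues y (level \<gamma>) - b \<in> subgroup \<gamma>}"
        by (auto simp: H_def hit_def)
      then show ?thesis
        by (rule finite_subset) (intro finite_large_hits, use \<open>x \<noteq> 0\<close> gen residues_in[OF y] in auto)
    qed
    moreover have "finite {(b, \<gamma>) \<in> H. b \<noteq> 0}"
    proof (rule finite_imageD)
      have "G u \<in> solutions x y" if u: "u \<in> {(b, \<gamma>) \<in> H. b \<noteq> 0}" for u
      proof -
        obtain b \<gamma> where b: "u = (b, \<gamma>)" "\<gamma> \<in> denominators" "hit 1 (x, residues y) b \<gamma>" "b \<noteq> 0"
          using u by (auto simp: H_def)
        have "\<gamma> \<in> PinvZ S" using b(2) P_reduced_PinvZ by (auto simp: denominators_def)
        then show ?thesis
          using numerator_coprime_P[OF b(2,4)] hit[OF b(2)] b(3) by (simp add: b(1) G_def solutions_def)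
      qed
      then show "finite (G ` {(b, \<gamma>) \<in> H. b \<noteq> 0})"
        using fin by (meson finite_subset image_subsetI)
      show "inj_on G {(b, \<gamma>) \<in> H. b \<noteq> 0}"
      proof (rule inj_onI)
        fix u u' assume a: "u \<in> {(b, \<gamma>) \<in> H. b \<noteq> 0}" "u' \<in> {(b, \<gamma>) \<in> H. b \<noteq> 0}" "G u = G u'"
        then obtain b b' \<gamma> where u: "u = (b, \<gamma>)" "u' = (b', \<gamma>)" "\<gamma> \<in> denominators"
          "of_int b * \<gamma> / of_int (norm_P \<gamma>) = of_int b' * \<gamma> / of_int (norm_P \<gamma>)"
          by (auto simp: H_def G_def)
        then show "u = u'" using quot(2)[OF u(3)] norm_P_ge_1[OF u(3)] by auto
      qed
    qed
    ultimately have "finite ({(b, \<gamma>) \<in> H. b = 0} \<union> {(b, \<gamma>) \<in> H. b \<noteq> 0})" by (rule finite_UnI)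
    then show "finite H" by (rule finite_subset[rotated]) auto
  qed
  moreover have "(x, residues y) \<in> space P" using residues_in[OF y] by (simp add: space_P)
  ultimately show ?thesis by (simp add: hits_def H_def)
qed

subsection \<open>The measure of the limsup set\<close>

lemma \<E>_eq: "\<E> S \<psi> = {z \<in> Z_P S. infinite (solutions (fst z) (snd z))}"
  by (simp only: \<E>_def solutions_def prod.collapse)

text \<open>Only the at most two pairs with \<open>\<gamma> = 0\<close> are dropped, where division
  by \<open>\<gamma>\<close> is impossible.\<close>

lemma infinite_solutions_nonzero:
  "infinite (solutions x y) \<longleftrightarrow> infinite {u \<in> {(\<beta>, \<gamma>). \<beta> \<in> PinvZ S \<and> \<gamma> \<in> PinvZ S \<and> coprime_P S \<beta> \<gamma> \<and> \<gamma> \<noteq> 0}.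
    dist_P S (scale_P S (snd u) (x, y)) (diag S (fst u)) \<le> \<psi> (snd u)}" (is "_ \<longleftrightarrow> infinite ?B")
proof -
  have "solutions x y \<subseteq> ?B \<union> {(1, 0), (-1, 0)}"
    using coprime_P_zero by (auto simp: solutions_def)
  moreover have "?B \<subseteq> solutions x y" by (auto simp: solutions_def)
  ultimately have "finite (solutions x y) \<longleftrightarrow> finite ?B"
    using finite_subset[of "solutions x y" "?B \<union> {(1, 0), (-1, 0)}"] finite_subset[of ?B "solutions x y"]
    by (simp only: finite_Un finite_insert finite.emptyI simp_thms) blast
  then show ?thesis by (simp only:)
qed

lemma \<E>_measurable: "\<E> S \<psi> \<in> sets (measure_P S \<mu>)"
proof -
  let ?M = "measure_P S \<mu>"
  let ?U = "{(\<beta>, \<gamma>). \<beta> \<in> PinvZ S \<and> \<gamma> \<in> PinvZ S \<and> coprime_P S \<beta> \<gamma> \<and> \<gamma> \<noteq> 0}"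
  \<comment> \<open>Membership in \<open>Z_P S\<close> is part of the condition so that
    \<open>dist_P_le_iff\<close> applies and each solution set becomes a measurable
    rectangle.\<close>
  let ?Q = "\<lambda>u z. z \<in> Z_P S \<and> dist_P S (scale_P S (snd u) z) (diag S (fst u)) \<le> \<psi> (snd u)"
  have Z: "Z_P S \<in> sets ?M"
    unfolding Z_P_def measure_P_def using Zhat_measurable by simp
  then have Zsub: "Z_P S \<subseteq> space ?M" by (rule sets.sets_into_space)
  have meas: "{z \<in> space ?M. ?Q u z} \<in> sets ?M" if u: "u \<in> ?U" for u
  proof -
    obtain \<beta> \<gamma> where bg: "u = (\<beta>, \<gamma>)" "\<gamma> \<noteq> 0" using u by auto
    have "{z \<in> space ?M. ?Q u z} = ({x. \<bar>x - of_rat (\<beta> / \<gamma>)\<bar> \<le> \<psi> \<gamma> / \<bar>of_rat \<gamma>\<bar>} \<inter> {0..<1}) \<times>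
        (\<Pi>\<^sub>E p\<in>S. Zp p \<inter> padic_ball p (\<beta> / \<gamma>) (\<psi> \<gamma> / padic_abs p \<gamma>))" (is "_ = ?R")
    proof (rule Set.set_eqI)
      fix z
      have "z \<in> {z \<in> space ?M. ?Q u z} \<longleftrightarrow> z \<in> Z_P S \<and> dist_P S (scale_P S \<gamma> z) (diag S \<beta>) \<le> \<psi> \<gamma>"
        using Zsub by (auto simp: bg(1))
      also have "\<dots> \<longleftrightarrow> z \<in> Z_P S \<and> \<bar>fst z - of_rat (\<beta> / \<gamma>)\<bar> \<le> \<psi> \<gamma> / \<bar>of_rat \<gamma>\<bar> \<and>
          (\<forall>p\<in>S. snd z p \<in> padic_ball p (\<beta> / \<gamma>) (\<psi> \<gamma> / padic_abs p \<gamma>))"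
      proof (rule conj_cong[OF refl])
        assume "z \<in> Z_P S"
        then have "snd z p \<in> Qp p" if "p \<in> S" for p
          using that by (auto simp: Z_P_def Zp_def mem_Times_iff PiE_iff)
        from dist_P_le_iff[OF finite_S prime_S this bg(2), of "fst z" \<beta> "\<psi> \<gamma>"]
        show "dist_P S (scale_P S \<gamma> z) (diag S \<beta>) \<le> \<psi> \<gamma> \<longleftrightarrow> \<bar>fst z - of_rat (\<beta> / \<gamma>)\<bar> \<le> \<psi> \<gamma> / \<bar>of_rat \<gamma>\<bar> \<and>
          (\<forall>p\<in>S. snd z p \<in> padic_ball p (\<beta> / \<gamma>) (\<psi> \<gamma> / padic_abs p \<gamma>))"
          by (simp only: prod.collapse)
      qed
      also have "\<dots> \<longleftrightarrow> z \<in> ?R"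
        by (auto simp: Z_P_def mem_Times_iff PiE_iff)
      finally show "z \<in> {z \<in> space ?M. ?Q u z} \<longleftrightarrow> z \<in> ?R" .
    qed
    also have "\<dots> \<in> sets ?M"
      unfolding measure_P_def
    proof (rule pair_measureI)
      show "{x. \<bar>x - of_rat (\<beta> / \<gamma>)\<bar> \<le> \<psi> \<gamma> / \<bar>of_rat \<gamma>\<bar>} \<inter> {0..<1} \<in> sets lborel" by measurable
      show "(\<Pi>\<^sub>E p\<in>S. Zp p \<inter> padic_ball p (\<beta> / \<gamma>) (\<psi> \<gamma> / padic_abs p \<gamma>)) \<in> sets \<nu>"
        using padic_ball_measurable[OF prime_S haar] Zp_eq_ball[OF prime_S]
        by (intro sets_PiM_I_finite finite_S) auto
    qed
    finally show ?thesis .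
  qed
  have "{z \<in> space ?M. infinite {u \<in> ?U. ?Q u z}} \<in> sets ?M"
    by (rule sets_infinite_many[OF countableI_type meas])
  also have "{z \<in> space ?M. infinite {u \<in> ?U. ?Q u z}} = \<E> S \<psi>"
  proof -
    have "infinite {u \<in> ?U. ?Q u z} \<longleftrightarrow> z \<in> Z_P S \<and> infinite (solutions (fst z) (snd z))" for z
      unfolding infinite_solutions_nonzero by (cases "z \<in> Z_P S") simp_all
    then show ?thesis using Zsub by (auto simp: \<E>_eq)
  qed
  finally show ?thesis .
qed

lemma emeasure_residues_preimage:
  assumes "A \<in> sets residue_distr"
  shows "emeasure \<nu>Z {y \<in> Zhat. residues y \<in> A} = emeasure residue_distr A"
    and "{y \<in> Zhat. residues y \<in> A} \<in> sets \<nu>Z"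
proof -
  have A: "A \<in> sets (sigma (residue_seqs modulus) (cylinders modulus))"
    using assms by (simp add: residue_distr_def)
  have "residues -` A \<inter> space \<nu>Z = {y \<in> Zhat. residues y \<in> A}" by (auto simp: space_\<nu>Z)
  then show "emeasure \<nu>Z {y \<in> Zhat. residues y \<in> A} = emeasure residue_distr A"
    "{y \<in> Zhat. residues y \<in> A} \<in> sets \<nu>Z"
    using emeasure_distr[OF residues_measurable A] measurable_sets[OF residues_measurable A]
    by (simp_all add: residue_distr_def)
qed

text \<open>For irrational \<open>x\<close> and almost every \<open>y\<close> the two limsup
  conditions agree, and \<open>residues\<close> carries \<open>\<nu>Z\<close> to
  \<open>residue_distr\<close> by construction.\<close>

lemma emeasure_\<E>_fibre:
  assumes x: "x \<notin> \<rat>" "x \<in> {0..<1}"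
  shows "emeasure \<nu> (Pair x -` \<E> S \<psi>) = emeasure residue_distr (Pair x -` hits 1 denominators)"
proof -
  let ?H = "Pair x -` hits 1 denominators"
  have H: "?H \<in> sets residue_distr" using sets_Pair1[OF hits_measurable[OF order_refl]] .
  have E: "Pair x -` \<E> S \<psi> \<in> sets \<nu>"
    by (rule sets_Pair1[OF \<E>_measurable[unfolded measure_P_def]])
  have sub: "Pair x -` \<E> S \<psi> \<subseteq> Zhat" by (auto simp: \<E>_eq Z_P_def)
  have "AE y in \<nu>Z. residues y \<notin> exceptional"
    by (rule AE_distrD[OF residues_measurable AE_not_in[OF exceptional_null, unfolded residue_distr_def]])
  then have "AE y in \<nu>Z. y \<in> Pair x -` \<E> S \<psi> \<longleftrightarrow> y \<in> {y \<in> Zhat. residues y \<in> ?H}"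
    using AE_space
  proof eventually_elim
    case (elim y)
    then have "y \<in> Zhat" by (simp add: space_\<nu>Z)
    then show ?case
      using infinite_solutions_iff[OF x(1) _ elim(1)] x(2) by (simp add: \<E>_eq Z_P_def)
  qed
  moreover have "Pair x -` \<E> S \<psi> \<in> sets \<nu>Z" using E sub by (simp only: sets_\<nu>Z)
  ultimately have "emeasure \<nu>Z (Pair x -` \<E> S \<psi>) = emeasure \<nu>Z {y \<in> Zhat. residues y \<in> ?H}"
    using emeasure_residues_preimage(2)[OF H] by (rule emeasure_eq_AE)
  then show ?thesis
    unfolding emeasure_residues_preimage(1)[OF H] emeasure_\<nu>Z[OF sub] .
qed

text \<open>Fubini over the real coordinate: almost all fibres of a null set of \<open>P\<close> are
  null, rational \<open>x\<close> form a null set, and outside \<open>[0, 1)\<close> the fibres of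
  \<open>\<E> S \<psi>\<close> are empty.\<close>

lemma emeasure_\<E>: "emeasure (measure_P S \<mu>) (\<E> S \<psi>) \<in> {0, 1}"
proof -
  interpret \<nu>: sigma_finite_measure \<nu> by (rule sigma_finite_\<nu>)
  let ?H = "hits 1 denominators"
  have H: "?H \<in> sets P" by (rule hits_measurable) simp
  have E: "emeasure (measure_P S \<mu>) (\<E> S \<psi>) = (\<integral>\<^sup>+x. emeasure \<nu> (Pair x -` \<E> S \<psi>) \<partial>lborel)"
    using \<E>_measurable unfolding measure_P_def by (rule \<nu>.emeasure_pair_measure_alt)
  have irr: "AE x::real in lborel. x \<notin> \<rat>"
    using countable_rat by (intro AE_not_in countable_imp_null_set_lborel)
  have out: "emeasure \<nu> (Pair x -` \<E> S \<psi>) = 0" if "x \<notin> {0..<1}" for x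
  proof -
    have "Pair x -` \<E> S \<psi> = {}" using that by (auto simp: \<E>_eq Z_P_def)
    then show ?thesis by simp
  qed
  have fibres: "AE x in lborel. emeasure residue_distr (Pair x -` A) = 0" if A: "A \<in> null_sets P" for A
  proof -
    have "(\<integral>\<^sup>+x. emeasure residue_distr (Pair x -` A) \<partial>lborel) = 0"
      using A V.emeasure_pair_measure_alt[of A lborel] by (auto simp: null_sets_def)
    moreover have "(\<lambda>x. emeasure residue_distr (Pair x -` A)) \<in> borel_measurable lborel"
      by (rule V.measurable_emeasure_Pair) (use A in auto)
    ultimately show ?thesis by (simp only: nn_integral_0_iff_AE)
  qed
  from hits_zero_one show ?thesis
  proof
    assume "AE z in P. z \<notin> ?H"
    then have "?H \<in> null_sets P" using H by (simp only: AE_iff_null_sets)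
    from fibres[OF this] irr have "AE x in lborel. emeasure \<nu> (Pair x -` \<E> S \<psi>) = 0"
    proof eventually_elim
      case (elim x)
      show ?case
      proof (cases "x \<in> {0..<1}")
        case True
        show ?thesis unfolding emeasure_\<E>_fibre[OF elim(2) True] by (rule elim(1))
      qed (rule out)
    qed
    then have "emeasure (measure_P S \<mu>) (\<E> S \<psi>) = (\<integral>\<^sup>+x. 0 \<partial>(lborel :: real measure))"
      unfolding E by (rule nn_integral_cong_AE)
    then show ?thesis by simp
  next
    \<comment> \<open>Almost every fibre of the complement is null, so those over
      \<open>[0, 1)\<close> have full mass 1 and the integral is the length of that
      interval.\<close>
    assume "AE z in P. z \<in> ?H"
    then have "AE z in P. z \<notin> space P - ?H" by eventually_elim simp
    then have "space P - ?H \<in> null_sets P"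
      by (simp only: AE_iff_null_sets[OF sets.compl_sets[OF H]])
    from fibres[OF this] irr have "AE x in lborel. emeasure \<nu> (Pair x -` \<E> S \<psi>) = indicator {0..<1} x"
    proof eventually_elim
      case (elim x)
      show ?case
      proof (cases "x \<in> {0..<1}")
        case True
        have Hx: "Pair x -` ?H \<in> sets residue_distr" using sets_Pair1[OF H] .
        have eq: "Pair x -` (space P - ?H) = space residue_distr - Pair x -` ?H"
          by (auto simp: space_P space_V)
        have "space residue_distr - Pair x -` ?H \<in> null_sets residue_distr"
          using elim(1) Hx unfolding eq by (simp add: null_sets_def)
        then have "emeasure residue_distr (space residue_distr - (space residue_distr - Pair x -` ?H))
            = emeasure residue_distr (space residue_distr)"
          by (rule emeasure_Diff_null_set) simp
        also have "space residue_distr - (space residue_distr - Pair x -` ?H) = Pair x -` ?H"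
          using sets.sets_into_space[OF Hx] by auto
        finally have "emeasure residue_distr (Pair x -` ?H) = emeasure residue_distr (space residue_distr)" .
        then show ?thesis
          using emeasure_\<E>_fibre[OF elim(2) True] True by (simp add: space_V emeasure_V_space)
      next
        case False
        then show ?thesis using out[OF False] by simp
      qed
    qed
    then have "emeasure (measure_P S \<mu>) (\<E> S \<psi>) = (\<integral>\<^sup>+x. indicator {0..<1::real} x \<partial>lborel)"
      unfolding E by (rule nn_integral_cong_AE)
    then show ?thesis by simp
  qed
qed

end

theorem theorem3:
  fixes S :: "nat set" and \<mu> :: "nat \<Rightarrow> padic measure" and \<psi> :: "rat \<Rightarrow> real"
  assumes "finite S" and "\<And>p. p \<in> S \<Longrightarrow> prime p"
    and "\<And>p. p \<in> S \<Longrightarrow> normalised_Haar p (\<mu> p)"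
    and "\<And>\<gamma>. \<gamma> \<in> PinvZ S \<Longrightarrow> 0 \<le> \<psi> \<gamma>"
    and "\<And>\<gamma>. \<gamma> \<in> PinvZ S \<Longrightarrow> \<gamma> \<noteq> 0 \<Longrightarrow> \<psi> \<gamma> \<le> 1 / (2 * L_P S \<gamma>)"
  shows "\<E> S \<psi> \<in> sets (measure_P S \<mu>) \<and>
         (emeasure (measure_P S \<mu>) (\<E> S \<psi>) = 0 \<or> emeasure (measure_P S \<mu>) (\<E> S \<psi>) = 1)"
proof -
  interpret approximation S \<mu> \<psi> by standard (fact assms)+
  show ?thesis using \<E>_measurable emeasure_\<E> by simp
qed

end
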